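(* Let $W=(W_t)_{t\ge 0}$ be a standard Brownian motion and let $\{F_n\}_{n\geq 1}$ be a sequence of double Wiener integrals with respect to $W$ (i.e. $F_n=I_2^W(f_n)$ with $f_n\in L^2_s(\mathbb{R}_+^2)$) that converges in law to a random variable $F_\infty$. Then there exist $\lambda_0\in\mathbb{R}$ and $f\in L^2_s(\mathbb{R}_+^2)$ such that $$F_\infty \overset{\rm law}{=} N + I_2^W(f),$$ where $N\sim\mathcal{N}(0,\lambda_0^2)$ is independent of $W$.
   Context: $L^2_s(\mathbb{R}_+^2)$ denotes the set of real-valued square-integrable functions $f$ on $\mathbb{R}_+^2$ with $f(x,y)=f(y,x)$ a.e. $W=(W_t)_{t\ge0}$ is a standard Brownian motion on a probability space $(\Omega,\mathcal{F},P)$. For $f\in L^2_s(\mathbb{R}_+^2)$, $I_2^W(f)$ is the double Wiener–Itô integral of $f$: the unique continuous linear map $L^2_s(\mathbb{R}_+^2)\to L^2(\Omega)$ with $I_2^W(h\otimes h)=\left(\int_0^\infty h\,dW\right)^2-\int_0^\infty h^2(t)\,dt$ for $h\in L^2(\mathbb{R}_+)$, where $(h\otimes h)(x,y)=h(x)h(y)$; it satisfies $E[I_2^W(f)^2]=2\|f\|^2_{L^2(\mathbb{R}_+^2)}$. $\mathcal{N}(0,0)$ is the Dirac mass at $0$. The variable $N$ may live on an enlargement of the probability space. *)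

theory Defs
  imports "HOL-Probability.Probability"
begin

section \<open>Square-integrable functions\<close>

text \<open>
  Elements of $L^2$ are represented by functions, not by equivalence classes; identities between
  elements of $L^2$ are therefore stated almost everywhere.
\<close>

definition L2_fun :: "'a measure \<Rightarrow> ('a \<Rightarrow> real) set" where
  "L2_fun M = {f. f \<in> borel_measurable M \<and> integrable M (\<lambda>x. (f x)\<^sup>2)}"

definition L2_norm :: "'a measure \<Rightarrow> ('a \<Rightarrow> real) \<Rightarrow> real" where
  "L2_norm M f = sqrt (\<integral>x. (f x)\<^sup>2 \<partial>M)"

definition half_line :: "real measure" where
  "half_line = restrict_space lborel {0..}"

definition quadrant :: "(real \<times> real) measure" where
  "quadrant = half_line \<Otimes>\<^sub>M half_line"

definition L2_sym :: "(real \<times> real \<Rightarrow> real) set" where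
  "L2_sym = {f \<in> L2_fun quadrant. AE (x, y) in quadrant. f (x, y) = f (y, x)}"

text \<open>
  Continuous linear maps from a subspace \<open>V\<close> of $L^2(A)$ to $L^2(B)$. Continuity (with respect to the
  seminorms) forces such a map to respect almost everywhere equality.
\<close>

definition continuous_linear_L2 ::
  "'a measure \<Rightarrow> ('a \<Rightarrow> real) set \<Rightarrow> 'b measure \<Rightarrow> (('a \<Rightarrow> real) \<Rightarrow> 'b \<Rightarrow> real) \<Rightarrow> bool" where
  "continuous_linear_L2 A V B T \<longleftrightarrow>
     (\<forall>f\<in>V. T f \<in> L2_fun B) \<and>
     (\<forall>f\<in>V. \<forall>g\<in>V. \<forall>a b::real.
        AE \<omega> in B. T (\<lambda>x. a * f x + b * g x) \<omega> = a * T f \<omega> + b * T g \<omega>) \<and>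
     (\<forall>f\<in>V. \<forall>\<epsilon>>0. \<exists>\<delta>>0. \<forall>g\<in>V.
        L2_norm A (\<lambda>x. g x - f x) < \<delta> \<longrightarrow> L2_norm B (\<lambda>\<omega>. T g \<omega> - T f \<omega>) < \<epsilon>)"

section \<open>Brownian motion and Wiener integrals\<close>

text \<open>The Gaussian law with mean \<open>\<mu>\<close> and variance \<open>v\<close>; the Dirac mass at \<open>\<mu>\<close> if \<open>v = 0\<close>.\<close>

definition normal_law :: "real \<Rightarrow> real \<Rightarrow> real measure" where
  "normal_law \<mu> v =
     (if v = 0 then return borel \<mu> else density lborel (\<lambda>x. ennreal (normal_density \<mu> (sqrt v) x)))"

definition standard_brownian_motion :: "'w measure \<Rightarrow> (real \<Rightarrow> 'w \<Rightarrow> real) \<Rightarrow> bool" where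
  "standard_brownian_motion M W \<longleftrightarrow>
     prob_space M \<and>
     (\<forall>t\<ge>0. W t \<in> borel_measurable M) \<and>
     (AE \<omega> in M. W 0 \<omega> = 0) \<and>
     (AE \<omega> in M. continuous_on {0..} (\<lambda>t. W t \<omega>)) \<and>
     (\<forall>s t. 0 \<le> s \<longrightarrow> s \<le> t \<longrightarrow> distr M borel (\<lambda>\<omega>. W t \<omega> - W s \<omega>) = normal_law 0 (t - s)) \<and>
     (\<forall>(n::nat) (t::nat \<Rightarrow> real). 0 \<le> t 0 \<longrightarrow> mono_on {..n} t \<longrightarrow>
        prob_space.indep_vars M (\<lambda>_. borel) (\<lambda>i \<omega>. W (t (Suc i)) \<omega> - W (t i) \<omega>) {..<n})"

text \<open>
  Both integrals are determined only up to almost sure equality (by density of step functions, and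
  of the span of the functions $h \otimes h$, respectively), so \<open>SOME\<close> chooses versions.
\<close>

definition is_wiener_integral ::
  "'w measure \<Rightarrow> (real \<Rightarrow> 'w \<Rightarrow> real) \<Rightarrow> ((real \<Rightarrow> real) \<Rightarrow> 'w \<Rightarrow> real) \<Rightarrow> bool" where
  "is_wiener_integral M W J \<longleftrightarrow>
     continuous_linear_L2 half_line (L2_fun half_line) M J \<and>
     (\<forall>s t. 0 \<le> s \<longrightarrow> s \<le> t \<longrightarrow> (AE \<omega> in M. J (indicator {s<..t}) \<omega> = W t \<omega> - W s \<omega>))"

definition wiener_integral ::
  "'w measure \<Rightarrow> (real \<Rightarrow> 'w \<Rightarrow> real) \<Rightarrow> (real \<Rightarrow> real) \<Rightarrow> 'w \<Rightarrow> real" where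
  "wiener_integral M W = (SOME J. is_wiener_integral M W J)"

definition is_double_wiener_integral ::
  "'w measure \<Rightarrow> (real \<Rightarrow> 'w \<Rightarrow> real) \<Rightarrow> ((real \<times> real \<Rightarrow> real) \<Rightarrow> 'w \<Rightarrow> real) \<Rightarrow> bool" where
  "is_double_wiener_integral M W I \<longleftrightarrow>
     continuous_linear_L2 quadrant L2_sym M I \<and>
     (\<forall>h\<in>L2_fun half_line. AE \<omega> in M.
        I (\<lambda>(x, y). h x * h y) \<omega> = (wiener_integral M W h \<omega>)\<^sup>2 - (\<integral>t. (h t)\<^sup>2 \<partial>half_line))"

definition double_wiener_integral ::
  "'w measure \<Rightarrow> (real \<Rightarrow> 'w \<Rightarrow> real) \<Rightarrow> (real \<times> real \<Rightarrow> real) \<Rightarrow> 'w \<Rightarrow> real" where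
  "double_wiener_integral M W = (SOME I. is_double_wiener_integral M W I)"

section \<open>Independence of a process and enlargements of a probability space\<close>

text \<open>
  Independence of the $\sigma$-algebras generated by \<open>N\<close> and by the whole process, since
  \<open>prob_space.indep_var\<close> needs both random variables to have the same type of values.
\<close>

definition independent_of_process ::
  "'w measure \<Rightarrow> ('w \<Rightarrow> real) \<Rightarrow> (real \<Rightarrow> 'w \<Rightarrow> real) \<Rightarrow> bool" where
  "independent_of_process M N W \<longleftrightarrow>
     prob_space.indep_set M
       (sets (vimage_algebra (space M) N borel))
       (sets (vimage_algebra (space M) (\<lambda>\<omega>. \<lambda>t\<in>{0..}. W t \<omega>) (PiM {0..} (\<lambda>_. borel))))"

text \<open>
  A random variable \<open>X\<close> on \<open>M\<close> is identified with \<open>\<lambda>\<omega>. X (\<pi> \<omega>)\<close> on the enlargement \<open>M'\<close>.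
\<close>

definition enlargement :: "'w measure \<Rightarrow> 'v measure \<Rightarrow> ('v \<Rightarrow> 'w) \<Rightarrow> bool" where
  "enlargement M M' \<pi> \<longleftrightarrow> prob_space M' \<and> \<pi> \<in> measurable M' M \<and> distr M' M \<pi> = M"

end

theory Submission
  imports Defs "HOL-Library.Diagonal_Subsequence"
begin

text \<open>
  Every double Wiener integral is an $L^2$ limit of finite quadratic forms in Brownian increments
  $W_sW_t - s \wedge t$. Written in independent standard Gaussian variables and diagonalized by
  Jacobi rotations, which preserve the standard Gaussian law, such a form has the law of
  $\sum_k d_k (\xi_k^2 - 1)$, whose characteristic function is a product of factors $\psi(t d_k)$
  with $\psi(u) = e^{-u^2} + O(|u|^3)$. Tightness bounds $\sum_k d_{n,k}^2$ uniformly in $n$. After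
  sorting the coefficients and extracting a diagonal subsequence, $d_{n,k} \to \mu_k$ for each $k$.
  The coefficients with $k \ge K$ are $O(K^{-1/2})$, so their contribution is asymptotically
  Gaussian. The mass of $\sum_k d_{n,k}^2$ lost in the limit is the source of the Gaussian
  component $N$, and the series $\sum_k \mu_k e_k \otimes e_k$ with
  $e_k = 1_{(k, k+1]}$ provides the kernel $f$.

  Both integrals are defined by a choice operator, which would return an arbitrary map if none had
  the characterizing property. Such maps exist because step functions are dense and the prescribed
  values define a bounded linear map on them.
\<close>

section \<open>Square-integrable functions\<close>

text \<open>The kernels \<open>f n\<close> need not converge in any sense, since a law determines a
  kernel only up to orthogonal changes of basis. The limit is therefore taken on the level of laws
  alone, and a kernel is rebuilt from the limiting coefficients. Intervals with disjoint interiors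
  suit this purpose: the series has at most one nonzero term at each point, and its integrals are
  explicit in independent Brownian increments. Approximating before diagonalizing replaces the
  spectral theorem for Hilbert-Schmidt operators by an extremal argument on finite arrays.

  The obstacle is that ever more, ever smaller coefficients may carry a fixed share of the sum of
  squares, which termwise limits miss. Head and tail of the product of characteristic functions are
  hence separated at an index K, with an error uniform in n and small for large K; n tends to
  infinity first and K second. A missing mass \<rho> gives the factor exp(-\<rho> t^2), so the
  Gaussian variance is \<lambda>_0^2 = 2 \<rho>.\<close>

definition L2_sq :: "'a measure \<Rightarrow> ('a \<Rightarrow> real) \<Rightarrow> real" where
  "L2_sq M f = (\<integral>x. (f x)\<^sup>2 \<partial>M)"

lemma L2_norm_eq: "L2_norm M f = sqrt (L2_sq M f)"
  by (simp add: L2_norm_def L2_sq_def)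

lemma L2_sq_nonneg [simp]: "0 \<le> L2_sq M f"
  by (simp add: L2_sq_def)

lemma L2_norm_less_iff: "\<epsilon> > 0 \<Longrightarrow> L2_norm M f < \<epsilon> \<longleftrightarrow> L2_sq M f < \<epsilon>\<^sup>2"
  unfolding L2_norm_eq
  by (metis L2_sq_nonneg less_eq_real_def real_sqrt_abs2 real_sqrt_less_iff abs_of_pos power2_eq_square)

lemma L2_funD: "f \<in> L2_fun M \<Longrightarrow> f \<in> borel_measurable M" "f \<in> L2_fun M \<Longrightarrow> integrable M (\<lambda>x. (f x)\<^sup>2)"
  by (auto simp: L2_fun_def)

lemma L2_fun_mult_integrable:
  assumes "f \<in> L2_fun M" "g \<in> L2_fun M"
  shows "integrable M (\<lambda>x. f x * g x)"
proof (rule Bochner_Integration.integrable_bound)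
  note [measurable] = assms[THEN L2_funD(1)]
  show "integrable M (\<lambda>x. (f x)\<^sup>2 + (g x)\<^sup>2)" using assms by (auto simp: L2_funD)
  show "(\<lambda>x. f x * g x) \<in> borel_measurable M" by measurable
  have "\<bar>a * b\<bar> \<le> a\<^sup>2 + b\<^sup>2" for a b :: real
  proof -
    have "2 * \<bar>a\<bar> * \<bar>b\<bar> \<le> a\<^sup>2 + b\<^sup>2" using sum_squares_bound[of "\<bar>a\<bar>" "\<bar>b\<bar>"] by simp
    moreover have "0 \<le> \<bar>a\<bar> * \<bar>b\<bar>" by simp
    ultimately show ?thesis unfolding abs_mult by linarith
  qed
  then show "AE x in M. norm (f x * g x) \<le> norm ((f x)\<^sup>2 + (g x)\<^sup>2)" by auto
qed

lemma L2_fun_add [intro]: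
  assumes "f \<in> L2_fun M" "g \<in> L2_fun M"
  shows "(\<lambda>x. f x + g x) \<in> L2_fun M"
proof -
  note [measurable] = assms[THEN L2_funD(1)]
  have "integrable M (\<lambda>x. (f x)\<^sup>2 + 2 * (f x * g x) + (g x)\<^sup>2)"
    using assms by (intro Bochner_Integration.integrable_add integrable_mult_right L2_fun_mult_integrable L2_funD)
  then show ?thesis by (simp add: L2_fun_def power2_sum algebra_simps)
qed

lemma L2_fun_cmult [intro]: "f \<in> L2_fun M \<Longrightarrow> (\<lambda>x. c * f x) \<in> L2_fun M"
  by (auto simp: L2_fun_def power_mult_distrib)

lemma L2_fun_zero [simp, intro]: "(\<lambda>x. 0) \<in> L2_fun M"
  by (simp add: L2_fun_def)

lemma L2_fun_diff [intro]: "f \<in> L2_fun M \<Longrightarrow> g \<in> L2_fun M \<Longrightarrow> (\<lambda>x. f x - g x) \<in> L2_fun M"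
  using L2_fun_add[of f M "\<lambda>x. -1 * g x"] L2_fun_cmult[of g M "-1"] by simp

lemma L2_fun_dominated:
  assumes "f \<in> borel_measurable M" "g \<in> L2_fun M" "AE x in M. \<bar>f x\<bar> \<le> \<bar>g x\<bar>"
  shows "f \<in> L2_fun M"
proof -
  have "integrable M (\<lambda>x. (f x)\<^sup>2)"
    using L2_funD(2)[OF assms(2)] by (rule Bochner_Integration.integrable_bound)
      (use assms in \<open>auto simp: abs_le_square_iff\<close>)
  then show ?thesis using assms by (simp add: L2_fun_def)
qed

lemma L2_sq_cmult: "L2_sq M (\<lambda>x. c * f x) = c\<^sup>2 * L2_sq M f"
  by (simp add: L2_sq_def power_mult_distrib)

lemma L2_sq_commute: "L2_sq M (\<lambda>x. f x - g x) = L2_sq M (\<lambda>x. g x - f x)"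
  by (simp add: L2_sq_def power2_commute)

text \<open>
  This weak triangle inequality suffices for all density and continuity arguments below.
\<close>

lemma L2_sq_add_le:
  assumes "f \<in> L2_fun M" "g \<in> L2_fun M"
  shows "L2_sq M (\<lambda>x. f x + g x) \<le> 2 * L2_sq M f + 2 * L2_sq M g"
proof -
  have "L2_sq M (\<lambda>x. f x + g x) \<le> (\<integral>x. 2 * (f x)\<^sup>2 + 2 * (g x)\<^sup>2 \<partial>M)"
    unfolding L2_sq_def
  proof (rule integral_mono)
    show "integrable M (\<lambda>x. (f x + g x)\<^sup>2)" using L2_fun_add[OF assms] by (auto simp: L2_funD)
    show "integrable M (\<lambda>x. 2 * (f x)\<^sup>2 + 2 * (g x)\<^sup>2)" using assms by (auto simp: L2_funD)
    show "(f x + g x)\<^sup>2 \<le> 2 * (f x)\<^sup>2 + 2 * (g x)\<^sup>2" for x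
      using sum_squares_bound[of "f x" "g x"] by (simp add: power2_sum)
  qed
  also have "\<dots> = 2 * L2_sq M f + 2 * L2_sq M g"
    using assms by (simp add: L2_sq_def L2_funD)
  finally show ?thesis .
qed

lemma L2_sq_triangle:
  assumes "f \<in> L2_fun M" "g \<in> L2_fun M" "h \<in> L2_fun M"
  shows "L2_sq M (\<lambda>x. f x - h x) \<le> 2 * L2_sq M (\<lambda>x. f x - g x) + 2 * L2_sq M (\<lambda>x. g x - h x)"
  using L2_sq_add_le[of "\<lambda>x. f x - g x" M "\<lambda>x. g x - h x"] assms by (simp add: L2_fun_diff)

lemma L2_sq_cong_AE:
  assumes "f \<in> borel_measurable M" "g \<in> borel_measurable M" "AE x in M. f x = g x"
  shows "L2_sq M f = L2_sq M g"
  unfolding L2_sq_def using assms by (intro integral_cong_AE) auto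

lemma L2_sq_eq_0_AE:
  assumes "f \<in> L2_fun M" "L2_sq M f = 0"
  shows "AE x in M. f x = 0"
  using assms integral_nonneg_eq_0_iff_AE[of M "\<lambda>x. (f x)\<^sup>2"] by (auto simp: L2_sq_def L2_funD)

lemma L2_sq_small_AE_eq:
  assumes "f \<in> L2_fun M" "g \<in> L2_fun M" "\<And>\<epsilon>. \<epsilon> > 0 \<Longrightarrow> L2_sq M (\<lambda>x. f x - g x) \<le> \<epsilon>"
  shows "AE x in M. f x = g x"
proof -
  have "L2_sq M (\<lambda>x. f x - g x) = 0"
  proof (rule antisym)
    show "L2_sq M (\<lambda>x. f x - g x) \<le> 0" using assms(3) by - (rule field_le_epsilon, simp)
  qed simp
  then have "AE x in M. f x - g x = 0"
    by (intro L2_sq_eq_0_AE L2_fun_diff assms(1,2))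
  then show ?thesis by auto
qed

section \<open>Almost everywhere convergence and completeness\<close>

lemma L2_fast_convergence_AE:
  assumes f: "\<And>n. f n \<in> L2_fun M" and sm: "summable (\<lambda>n. L2_sq M (f n))"
  shows "AE x in M. summable (\<lambda>n. (f n x)\<^sup>2)"
proof -
  note [measurable] = f[THEN L2_funD(1)]
  have "(\<integral>\<^sup>+x. (\<Sum>n. ennreal ((f n x)\<^sup>2)) \<partial>M) = (\<Sum>n. \<integral>\<^sup>+x. ennreal ((f n x)\<^sup>2) \<partial>M)"
    by (rule nn_integral_suminf) measurable
  also have "\<dots> = (\<Sum>n. ennreal (L2_sq M (f n)))"
    using f by (intro suminf_cong) (simp add: L2_sq_def nn_integral_eq_integral L2_funD)
  also have "\<dots> < \<infinity>"
    using sm by (simp add: suminf_ennreal2)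
  finally have "AE x in M. (\<Sum>n. ennreal ((f n x)\<^sup>2)) \<noteq> \<infinity>"
    by (intro nn_integral_PInf_AE) (auto simp: top_unique)
  then show ?thesis
  proof (eventually_elim)
    case (elim x)
    then show ?case by (intro summable_suminf_not_top) auto
  qed
qed

text \<open>A geometric rate makes the whole sequence converge almost everywhere, without passing to
  a subsequence. This is how nonlinear identities, such as the one characterizing the double
  integral, survive L2 limits.\<close>

lemma L2_fast_convergence_AE_0:
  assumes "\<And>n. f n \<in> L2_fun M" "g \<in> L2_fun M" "\<And>n. L2_sq M (\<lambda>x. f n x - g x) \<le> K * (1/2)^n"
  shows "AE x in M. (\<lambda>n. f n x) \<longlonglongrightarrow> g x"
proof -
  have "AE x in M. summable (\<lambda>n. (f n x - g x)\<^sup>2)"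
  proof (rule L2_fast_convergence_AE)
    show "summable (\<lambda>n. L2_sq M (\<lambda>x. f n x - g x))"
      by (rule summable_comparison_test'[of "\<lambda>n. K * (1/2)^n"]) (use assms in auto)
  qed (use assms in auto)
  then show ?thesis
  proof eventually_elim
    case (elim x)
    then have "(\<lambda>n. sqrt ((f n x - g x)\<^sup>2)) \<longlonglongrightarrow> sqrt 0"
      by (intro tendsto_real_sqrt summable_LIMSEQ_zero)
    then have "(\<lambda>n. f n x - g x) \<longlonglongrightarrow> 0" by (simp add: tendsto_rabs_zero_iff)
    then show ?case by (rule LIM_zero_cancel)
  qed
qed

text \<open>Riesz-Fischer for sequences with a prescribed rate. The rate 1/8 of the squared norms
  leaves room for the weight 4^n: increments multiplied by 2^n still have summable squared norms, so
  almost everywhere the increments are O(2^(-n)) and their series converges absolutely.\<close>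

lemma L2_complete:
  fixes y :: "nat \<Rightarrow> 'a \<Rightarrow> real"
  assumes y: "\<And>n. y n \<in> L2_fun M" and K: "K \<ge> 0"
    and c: "\<And>m n. L2_sq M (\<lambda>x. y m x - y n x) \<le> K * ((1/8)^m + (1/8)^n)"
  shows "\<exists>z\<in>L2_fun M. \<forall>n. L2_sq M (\<lambda>x. z x - y n x) \<le> 2 * K * (1/8)^n"
proof -
  note [measurable] = y[THEN L2_funD(1)]
  define d where "d n x = 2^n * (y (Suc n) x - y n x)" for n x
  have "L2_sq M (d n) \<le> (2 * K) * (1/2)^n" for n
  proof -
    have "L2_sq M (d n) = 4^n * L2_sq M (\<lambda>x. y (Suc n) x - y n x)"
      unfolding d_def L2_sq_cmult by (simp add: power2_eq_square flip: power_mult_distrib)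
    also have "\<dots> \<le> 4^n * (K * ((1/8)^(Suc n) + (1/8)^n))"
      using c[of "Suc n" n] by (intro mult_left_mono) auto
    also have "\<dots> \<le> 4^n * (K * (2 * (1/8)^n))"
      using K by (intro mult_left_mono) auto
    also have "\<dots> = (2 * K) * (1/2)^n"
      by (simp add: field_simps flip: power_mult_distrib)
    finally show ?thesis .
  qed
  note dn = this
  have "AE x in M. summable (\<lambda>n. (d n x)\<^sup>2)"
  proof (intro L2_fast_convergence_AE)
    show "summable (\<lambda>n. L2_sq M (d n))"
      by (rule summable_comparison_test'[of "\<lambda>n. (2 * K) * (1/2)^n"]) (use dn in auto)
    show "d n \<in> L2_fun M" for n
      unfolding d_def by (intro L2_fun_cmult L2_fun_diff y)
  qed
  then have conv: "AE x in M. convergent (\<lambda>n. y n x)"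
  proof eventually_elim
    case (elim x)
    then have "Bseq (\<lambda>n. (d n x)\<^sup>2)"
      using summable_LIMSEQ_zero convergentI convergent_imp_Bseq by blast
    then obtain B where B: "B > 0" "\<And>n. \<bar>(d n x)\<^sup>2\<bar> \<le> B" by (auto elim!: BseqE)
    have "\<bar>y (Suc n) x - y n x\<bar> \<le> sqrt B * (1/2)^n" for n
    proof -
      have "sqrt ((d n x)\<^sup>2) \<le> sqrt B" using B(2)[of n] by (intro real_sqrt_le_mono) simp
      then have "2^n * \<bar>y (Suc n) x - y n x\<bar> \<le> sqrt B" by (simp add: d_def abs_mult)
      then show ?thesis by (simp add: field_simps)
    qed
    then have "summable (\<lambda>n. y (Suc n) x - y n x)"
      by - (rule summable_comparison_test'[of "\<lambda>n. sqrt B * (1/2)^n"], auto)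
    then have "(\<lambda>n. (\<Sum>k<n. y (Suc k) x - y k x) + y 0 x) \<longlonglongrightarrow> suminf (\<lambda>n. y (Suc n) x - y n x) + y 0 x"
      by (intro tendsto_add summable_LIMSEQ tendsto_const)
    moreover have "(\<Sum>k<n. y (Suc k) x - y k x) + y 0 x = y n x" for n
      using sum_lessThan_telescope[of "\<lambda>k. y k x" n] by simp
    ultimately show ?case by (simp only: convergentI)
  qed
  \<comment> \<open>On the null set of divergence \<open>lim\<close> takes a default value;
    measurability holds regardless.\<close>
  define z where "z x = lim (\<lambda>n. y n x)" for x
  have [measurable]: "z \<in> borel_measurable M" unfolding z_def by measurable
  have bnd: "integrable M (\<lambda>x. (z x - y n x)\<^sup>2) \<and> L2_sq M (\<lambda>x. z x - y n x) \<le> 2 * K * (1/8)^n" for n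
  proof -
    \<comment> \<open>Fatou's lemma in the first index turns the Cauchy estimate into an estimate
      for the limit.\<close>
    have "(\<integral>\<^sup>+x. ennreal ((z x - y n x)\<^sup>2) \<partial>M) = (\<integral>\<^sup>+x. liminf (\<lambda>m. ennreal ((y (m + n) x - y n x)\<^sup>2)) \<partial>M)"
    proof (rule nn_integral_cong_AE, use conv in eventually_elim)
      case (elim x)
      then have "(\<lambda>m. y (m + n) x) \<longlonglongrightarrow> z x"
        unfolding z_def by (intro LIMSEQ_ignore_initial_segment) (simp add: convergent_LIMSEQ_iff)
      then have "(\<lambda>m. ennreal ((y (m + n) x - y n x)\<^sup>2)) \<longlonglongrightarrow> ennreal ((z x - y n x)\<^sup>2)"
        by (intro tendsto_intros) 
      then show ?case by (rule lim_imp_Liminf[symmetric, rotated]) simp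
    qed
    also have "\<dots> \<le> liminf (\<lambda>m. \<integral>\<^sup>+x. ennreal ((y (m + n) x - y n x)\<^sup>2) \<partial>M)"
      by (rule nn_integral_liminf) measurable
    also have "\<dots> \<le> liminf (\<lambda>m. ennreal (2 * K * (1/8)^n))"
    proof (rule Liminf_mono, rule always_eventually, rule allI)
      fix m
      have "(\<integral>\<^sup>+x. ennreal ((y (m + n) x - y n x)\<^sup>2) \<partial>M) = ennreal (L2_sq M (\<lambda>x. y (m + n) x - y n x))"
        unfolding L2_sq_def using L2_fun_diff[OF y[of "m+n"] y[of n]]
        by (intro nn_integral_eq_integral) (auto simp: L2_funD)
      also have "\<dots> \<le> ennreal (K * ((1/8)^(m+n) + (1/8)^n))" using c by (intro ennreal_leI)
      also have "\<dots> \<le> ennreal (K * (2 * (1/8)^n))"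
        using K by (intro ennreal_leI mult_left_mono) (auto simp: power_add power_le_one mult_left_le_one_le)
      finally show "(\<integral>\<^sup>+x. ennreal ((y (m + n) x - y n x)\<^sup>2) \<partial>M) \<le> ennreal (2 * K * (1/8)^n)"
        by (simp add: mult_ac)
    qed
    also have "\<dots> = ennreal (2 * K * (1/8)^n)" by (simp add: Liminf_const)
    finally have le: "(\<integral>\<^sup>+x. ennreal ((z x - y n x)\<^sup>2) \<partial>M) \<le> ennreal (2 * K * (1/8)^n)" .
    then have int: "integrable M (\<lambda>x. (z x - y n x)\<^sup>2)"
      by (intro integrableI_bounded) (auto intro: le_less_trans)
    then have "ennreal (L2_sq M (\<lambda>x. z x - y n x)) \<le> ennreal (2 * K * (1/8)^n)"
      using le by (simp add: nn_integral_eq_integral L2_sq_def)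
    then show ?thesis using int K by (auto simp: ennreal_le_iff)
  qed
  have "(\<lambda>x. z x - y 0 x) \<in> L2_fun M" using bnd[of 0] by (auto simp: L2_fun_def)
  from L2_fun_add[OF this y[of 0]] have "z \<in> L2_fun M" by simp
  with bnd show ?thesis by auto
qed

text \<open>Lists of coefficient-index pairs may repeat an index, so sums and multiples of
  combinations are concatenation and mapping, with no case distinction on coinciding
  indices.\<close>

definition lincomb :: "('i \<Rightarrow> 'a \<Rightarrow> real) \<Rightarrow> (real \<times> 'i) list \<Rightarrow> 'a \<Rightarrow> real" where
  "lincomb d xs x = (\<Sum>(c, i)\<leftarrow>xs. c * d i x)"

lemma lincomb_Nil [simp]: "lincomb d [] x = 0"
  and lincomb_Cons [simp]: "lincomb d (p # xs) x = fst p * d (snd p) x + lincomb d xs x"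
  and lincomb_append [simp]: "lincomb d (xs @ ys) x = lincomb d xs x + lincomb d ys x"
  by (auto simp: lincomb_def case_prod_beta)

lemma lincomb_scale: "lincomb d (map (\<lambda>(c, i). (a * c, i)) xs) x = a * lincomb d xs x"
  by (induction xs) (auto simp: algebra_simps)

lemma L2_fun_lincomb:
  "(\<And>i. i \<in> I \<Longrightarrow> d i \<in> L2_fun M) \<Longrightarrow> snd ` set xs \<subseteq> I \<Longrightarrow> lincomb d xs \<in> L2_fun M"
proof (induction xs)
  case Nil then show ?case by (simp add: lincomb_def)
next
  case (Cons p xs)
  have "(\<lambda>x. fst p * d (snd p) x + lincomb d xs x) \<in> L2_fun M"
    using Cons.prems by (intro L2_fun_add L2_fun_cmult Cons.IH Cons.prems) auto
  moreover have "lincomb d (p # xs) = (\<lambda>x. fst p * d (snd p) x + lincomb d xs x)" by (rule ext) simp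
  ultimately show ?case by simp
qed

text \<open>Membership in the closed span of the \<open>d i\<close>. As a predicate on single
  functions it can be established by induction over measurable sets and by limits.\<close>

definition L2_dense :: "'a measure \<Rightarrow> ('i \<Rightarrow> 'a \<Rightarrow> real) \<Rightarrow> 'i set \<Rightarrow> ('a \<Rightarrow> real) \<Rightarrow> bool" where
  "L2_dense M d I f \<longleftrightarrow> f \<in> L2_fun M \<and>
     (\<forall>\<epsilon>>0. \<exists>xs. snd ` set xs \<subseteq> I \<and> L2_sq M (\<lambda>x. f x - lincomb d xs x) < \<epsilon>)"

text \<open>Boundedness is required of coefficient lists, which also settles well-definedness: two
  lists with the same combination in the domain have images at distance zero. Values at general
  functions come from approximation and completeness, and linearity and continuity are inherited
  from the approximating combinations.\<close>

theorem L2_extension: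
  fixes d :: "'i \<Rightarrow> 'a \<Rightarrow> real" and w :: "'i \<Rightarrow> 'b \<Rightarrow> real"
  assumes d: "\<And>i. i \<in> I \<Longrightarrow> d i \<in> L2_fun A" and w: "\<And>i. i \<in> I \<Longrightarrow> w i \<in> L2_fun B"
    and C: "C \<ge> 0"
    and bound: "\<And>xs. snd ` set xs \<subseteq> I \<Longrightarrow> L2_sq B (lincomb w xs) \<le> C * L2_sq A (lincomb d xs)"
    and dense: "\<And>f. f \<in> L2_fun A \<Longrightarrow> L2_dense A d I f"
  shows "\<exists>T. continuous_linear_L2 A (L2_fun A) B T \<and>
    (\<forall>xs. snd ` set xs \<subseteq> I \<longrightarrow> (AE \<omega> in B. T (lincomb d xs) \<omega> = lincomb w xs \<omega>))"
proof -
  \<comment> \<open>\<open>G f y\<close> characterizes the value at f without mentioning an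
    approximating sequence, so any \<open>y\<close> picked by \<open>SOME\<close> is consistent with
    every approximation. Two uses of the weak triangle inequality turn \<open>C\<close> into
    \<open>4 * C\<close>.\<close>
  define G where "G f y \<longleftrightarrow> y \<in> L2_fun B \<and> (\<forall>xs. snd ` set xs \<subseteq> I \<longrightarrow>
     L2_sq B (\<lambda>\<omega>. y \<omega> - lincomb w xs \<omega>) \<le> 4 * C * L2_sq A (\<lambda>x. f x - lincomb d xs x))" for f y
  have dl: "lincomb d xs \<in> L2_fun A" and wl: "lincomb w xs \<in> L2_fun B" if "snd ` set xs \<subseteq> I" for xs
    using that d w by (auto intro: L2_fun_lincomb)
  have bound2: "L2_sq B (\<lambda>\<omega>. lincomb w xs \<omega> - lincomb w ys \<omega>) \<le> C * L2_sq A (\<lambda>x. lincomb d xs x - lincomb d ys x)"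
    if "snd ` set xs \<subseteq> I" "snd ` set ys \<subseteq> I" for xs ys
  proof -
    define zs where "zs = xs @ map (\<lambda>(c, i). (-1 * c, i)) ys"
    have "lincomb w zs = (\<lambda>\<omega>. lincomb w xs \<omega> - lincomb w ys \<omega>)"
      "lincomb d zs = (\<lambda>\<omega>. lincomb d xs \<omega> - lincomb d ys \<omega>)"
      unfolding zs_def by (auto simp only: fun_eq_iff lincomb_append lincomb_scale)
    moreover have "snd ` set zs \<subseteq> I" using that by (force simp: zs_def)
    ultimately show ?thesis using bound[of zs] by simp
  qed
  have ex: "\<exists>y. G f y" if f: "f \<in> L2_fun A" for f
  proof -
    have "\<exists>xs. snd ` set xs \<subseteq> I \<and> L2_sq A (\<lambda>x. f x - lincomb d xs x) < (1/8)^n" for n :: nat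
      using dense[OF f] by (auto simp: L2_dense_def)
    then obtain X where X: "\<And>n. snd ` set (X n) \<subseteq> I"
      "\<And>n::nat. L2_sq A (\<lambda>x. f x - lincomb d (X n) x) < (1/8)^n" by metis
    have "L2_sq B (\<lambda>\<omega>. lincomb w (X m) \<omega> - lincomb w (X n) \<omega>) \<le> (2 * C) * ((1/8)^m + (1/8)^n)" for m n
    proof -
      have "L2_sq B (\<lambda>\<omega>. lincomb w (X m) \<omega> - lincomb w (X n) \<omega>) \<le> C * L2_sq A (\<lambda>x. lincomb d (X m) x - lincomb d (X n) x)"
        using X by (intro bound2)
      also have "\<dots> \<le> C * (2 * L2_sq A (\<lambda>x. lincomb d (X m) x - f x) + 2 * L2_sq A (\<lambda>x. f x - lincomb d (X n) x))"
        using C f by (intro mult_left_mono L2_sq_triangle dl X)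
      also have "\<dots> \<le> C * (2 * (1/8)^m + 2 * (1/8)^n)"
        using C X(2)[of m] X(2)[of n] unfolding L2_sq_commute[of A "lincomb d (X m)"]
        by (intro mult_left_mono) auto
      finally show ?thesis by (simp add: algebra_simps)
    qed
    from L2_complete[OF wl[OF X(1)] _ this] C obtain y where y: "y \<in> L2_fun B"
      "\<And>n. L2_sq B (\<lambda>x. y x - lincomb w (X n) x) \<le> 2 * (2 * C) * (1/8)^n" by auto
    have "L2_sq B (\<lambda>\<omega>. y \<omega> - lincomb w xs \<omega>) \<le> 4 * C * L2_sq A (\<lambda>x. f x - lincomb d xs x)"
      if xs: "snd ` set xs \<subseteq> I" for xs
    proof -
      have "L2_sq B (\<lambda>\<omega>. y \<omega> - lincomb w xs \<omega>) \<le> 12 * C * (1/8)^n + 4 * C * L2_sq A (\<lambda>x. f x - lincomb d xs x)" for n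
      proof -
        have "L2_sq B (\<lambda>\<omega>. y \<omega> - lincomb w xs \<omega>) \<le> 2 * L2_sq B (\<lambda>x. y x - lincomb w (X n) x)
           + 2 * L2_sq B (\<lambda>x. lincomb w (X n) x - lincomb w xs x)"
          by (intro L2_sq_triangle y wl X xs)
        also have "\<dots> \<le> 2 * (2 * (2 * C) * (1/8)^n) + 2 * (C * L2_sq A (\<lambda>x. lincomb d (X n) x - lincomb d xs x))"
          by (intro add_mono mult_left_mono y bound2 X xs) auto
        also have "\<dots> \<le> 2 * (2 * (2 * C) * (1/8)^n) + 2 * (C * (2 * L2_sq A (\<lambda>x. lincomb d (X n) x - f x) + 2 * L2_sq A (\<lambda>x. f x - lincomb d xs x)))"
          by (intro add_left_mono mult_left_mono L2_sq_triangle dl X xs f C) auto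
        also have "\<dots> \<le> 2 * (2 * (2 * C) * (1/8)^n) + 2 * (C * (2 * (1/8)^n + 2 * L2_sq A (\<lambda>x. f x - lincomb d xs x)))"
          using X(2)[of n] unfolding L2_sq_commute[of A "lincomb d (X n)"]
          by (intro add_left_mono mult_left_mono add_right_mono C) auto
        finally show ?thesis by (simp add: algebra_simps)
      qed
      \<comment> \<open>The error of the chosen approximations vanishes as n grows; only the term in
        \<open>xs\<close> remains.\<close>
      moreover have "(\<lambda>n. 12 * C * (1/8)^n + 4 * C * L2_sq A (\<lambda>x. f x - lincomb d xs x)) \<longlonglongrightarrow> 12 * C * 0 + 4 * C * L2_sq A (\<lambda>x. f x - lincomb d xs x)"
        by (intro tendsto_intros LIMSEQ_power_zero) auto
      ultimately show ?thesis by (intro LIMSEQ_le_const) auto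
    qed
    with y show ?thesis unfolding G_def by blast
  qed
  define T where "T f = (SOME y. G f y)" for f
  have G: "G f (T f)" if "f \<in> L2_fun A" for f unfolding T_def using ex[OF that] by (rule someI_ex)
  have TL: "T f \<in> L2_fun B" if "f \<in> L2_fun A" for f using G[OF that] by (simp add: G_def)
  have TB: "L2_sq B (\<lambda>\<omega>. T f \<omega> - lincomb w xs \<omega>) \<le> 4 * C * L2_sq A (\<lambda>x. f x - lincomb d xs x)"
    if "f \<in> L2_fun A" "snd ` set xs \<subseteq> I" for f xs using G[OF that(1)] that(2) by (simp add: G_def)
  have approx: "\<exists>xs. snd ` set xs \<subseteq> I \<and> L2_sq A (\<lambda>x. f x - lincomb d xs x) \<le> \<epsilon>"
    if "f \<in> L2_fun A" "\<epsilon> > 0" for f \<epsilon>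
    using dense[OF that(1)] that(2) unfolding L2_dense_def by (meson less_imp_le)
  have cons: "AE \<omega> in B. T (lincomb d xs) \<omega> = lincomb w xs \<omega>" if xs: "snd ` set xs \<subseteq> I" for xs
  proof (rule L2_sq_small_AE_eq)
    show "T (lincomb d xs) \<in> L2_fun B" "lincomb w xs \<in> L2_fun B" by (auto intro!: TL dl wl xs)
    show "L2_sq B (\<lambda>x. T (lincomb d xs) x - lincomb w xs x) \<le> \<epsilon>" if "\<epsilon> > 0" for \<epsilon>
      using TB[OF dl[OF xs] xs] that by (simp add: L2_sq_def)
  qed
  have lin: "AE \<omega> in B. T (\<lambda>x. a * f x + b * g x) \<omega> = a * T f \<omega> + b * T g \<omega>"
    if f: "f \<in> L2_fun A" and g: "g \<in> L2_fun A" for f g a b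
  proof (rule L2_sq_small_AE_eq)
    have fg: "(\<lambda>x. a * f x + b * g x) \<in> L2_fun A" using f g by auto
    show "T (\<lambda>x. a * f x + b * g x) \<in> L2_fun B" using fg by (rule TL)
    show "(\<lambda>\<omega>. a * T f \<omega> + b * T g \<omega>) \<in> L2_fun B" using f g by (auto intro!: TL)
    fix \<epsilon> :: real assume \<epsilon>: "\<epsilon> > 0"
    \<comment> \<open>Each half of the estimate below contributes
      \<open>16 * C * (a\<^sup>2 + b\<^sup>2)\<close>; adding 1 keeps \<open>K\<close>
      positive.\<close>
    define K where "K = 1 + 32 * C * (a\<^sup>2 + b\<^sup>2)"
    have K: "K > 0" using C by (simp add: K_def add_pos_nonneg)
    obtain xs where xs: "snd ` set xs \<subseteq> I" "L2_sq A (\<lambda>x. f x - lincomb d xs x) \<le> \<epsilon> / K"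
      using approx[OF f, of "\<epsilon>/K"] \<epsilon> K by auto
    obtain ys where ys: "snd ` set ys \<subseteq> I" "L2_sq A (\<lambda>x. g x - lincomb d ys x) \<le> \<epsilon> / K"
      using approx[OF g, of "\<epsilon>/K"] \<epsilon> K by auto
    define zs where "zs = map (\<lambda>(c, i). (a * c, i)) xs @ map (\<lambda>(c, i). (b * c, i)) ys"
    have zs: "snd ` set zs \<subseteq> I" using xs ys by (force simp: zs_def)
    have zw: "lincomb w zs x = a * lincomb w xs x + b * lincomb w ys x" for x
      unfolding zs_def by (simp add: lincomb_scale)
    have zd: "lincomb d zs x = a * lincomb d xs x + b * lincomb d ys x" for x
      unfolding zs_def by (simp add: lincomb_scale)
    \<comment> \<open>Stated for an arbitrary measure \<open>Q\<close> because it is applied both in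
      the domain and in the target.\<close>
    have split: "L2_sq Q (\<lambda>x. (a * u x + b * v x) - (a * u' x + b * v' x)) \<le> 2 * a\<^sup>2 * L2_sq Q (\<lambda>x. u x - u' x) + 2 * b\<^sup>2 * L2_sq Q (\<lambda>x. v x - v' x)"
      if "u \<in> L2_fun Q" "v \<in> L2_fun Q" "u' \<in> L2_fun Q" "v' \<in> L2_fun Q" for u v u' v' and Q :: "'c measure"
    proof -
      have "L2_sq Q (\<lambda>x. a * (u x - u' x) + b * (v x - v' x)) \<le> 2 * L2_sq Q (\<lambda>x. a * (u x - u' x)) + 2 * L2_sq Q (\<lambda>x. b * (v x - v' x))"
        using that by (intro L2_sq_add_le) auto
      moreover have "(\<lambda>x. (a * u x + b * v x) - (a * u' x + b * v' x)) = (\<lambda>x. a * (u x - u' x) + b * (v x - v' x))"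
        by (simp add: fun_eq_iff algebra_simps)
      ultimately show ?thesis by (simp only: L2_sq_cmult mult.assoc)
    qed
    have "L2_sq B (\<lambda>\<omega>. T (\<lambda>x. a * f x + b * g x) \<omega> - (a * T f \<omega> + b * T g \<omega>))
      \<le> 2 * L2_sq B (\<lambda>\<omega>. T (\<lambda>x. a * f x + b * g x) \<omega> - lincomb w zs \<omega>) + 2 * L2_sq B (\<lambda>\<omega>. lincomb w zs \<omega> - (a * T f \<omega> + b * T g \<omega>))"
      using f g by (intro L2_sq_triangle TL fg wl zs) (auto intro!: TL)
    also have "\<dots> \<le> 2 * (4 * C * L2_sq A (\<lambda>x. (a * f x + b * g x) - lincomb d zs x)) 
       + 2 * (2 * a\<^sup>2 * L2_sq B (\<lambda>\<omega>. T f \<omega> - lincomb w xs \<omega>) + 2 * b\<^sup>2 * L2_sq B (\<lambda>\<omega>. T g \<omega> - lincomb w ys \<omega>))"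
      unfolding L2_sq_commute[of B "lincomb w zs"] unfolding zw
      by (intro add_mono mult_left_mono TB[OF fg zs, unfolded zw] split TL f g wl xs ys) auto
    also have "\<dots> \<le> 2 * (4 * C * (2 * a\<^sup>2 * L2_sq A (\<lambda>x. f x - lincomb d xs x) + 2 * b\<^sup>2 * L2_sq A (\<lambda>x. g x - lincomb d ys x)))
       + 2 * (2 * a\<^sup>2 * (4 * C * L2_sq A (\<lambda>x. f x - lincomb d xs x)) + 2 * b\<^sup>2 * (4 * C * L2_sq A (\<lambda>x. g x - lincomb d ys x)))"
      unfolding zd using C by (intro add_mono mult_left_mono split f g dl xs ys TB) auto
    also have "\<dots> \<le> 2 * (4 * C * (2 * a\<^sup>2 * (\<epsilon> / K) + 2 * b\<^sup>2 * (\<epsilon>/K)))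
       + 2 * (2 * a\<^sup>2 * (4 * C * (\<epsilon>/K)) + 2 * b\<^sup>2 * (4 * C * (\<epsilon>/K)))"
      using C by (intro add_mono mult_left_mono xs ys) auto
    also have "\<dots> = (32 * C * (a\<^sup>2 + b\<^sup>2)) * (\<epsilon> / K)" by (simp add: algebra_simps)
    also have "\<dots> \<le> K * (\<epsilon> / K)" using K \<epsilon> by (intro mult_right_mono) (auto simp: K_def)
    also have "\<dots> = \<epsilon>" using K by simp
    finally show "L2_sq B (\<lambda>\<omega>. T (\<lambda>x. a * f x + b * g x) \<omega> - (a * T f \<omega> + b * T g \<omega>)) \<le> \<epsilon>" .
  qed
  have cont: "L2_sq B (\<lambda>\<omega>. T g \<omega> - T f \<omega>) \<le> \<epsilon>"
    if f: "f \<in> L2_fun A" and g: "g \<in> L2_fun A" and \<epsilon>: "\<epsilon> > 0" and s: "24 * C * L2_sq A (\<lambda>x. g x - f x) \<le> \<epsilon> / 2" for f g \<epsilon>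
  proof -
    \<comment> \<open>The factor \<open>24 * C\<close> collects \<open>8 * C\<close> from comparing
      f with \<open>xs\<close> directly and \<open>16 * C\<close> from comparing g with
      \<open>xs\<close> through f; the added 1 covers \<open>C = 0\<close>.\<close>
    obtain xs where xs: "snd ` set xs \<subseteq> I" "L2_sq A (\<lambda>x. f x - lincomb d xs x) \<le> \<epsilon> / (2 * (24 * C + 1))"
      using approx[OF f, of "\<epsilon> / (2 * (24 * C + 1))"] \<epsilon> C by auto
    have "L2_sq B (\<lambda>\<omega>. T g \<omega> - T f \<omega>) \<le> 2 * L2_sq B (\<lambda>\<omega>. T g \<omega> - lincomb w xs \<omega>) + 2 * L2_sq B (\<lambda>\<omega>. lincomb w xs \<omega> - T f \<omega>)"
      by (intro L2_sq_triangle TL f g wl xs)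
    also have "\<dots> \<le> 2 * (4 * C * L2_sq A (\<lambda>x. g x - lincomb d xs x)) + 2 * (4 * C * L2_sq A (\<lambda>x. f x - lincomb d xs x))"
      unfolding L2_sq_commute[of B "lincomb w xs"] by (intro add_mono mult_left_mono TB f g xs) auto
    also have "\<dots> \<le> 2 * (4 * C * (2 * L2_sq A (\<lambda>x. g x - f x) + 2 * L2_sq A (\<lambda>x. f x - lincomb d xs x))) + 2 * (4 * C * L2_sq A (\<lambda>x. f x - lincomb d xs x))"
      using C by (intro add_right_mono mult_left_mono L2_sq_triangle f g dl xs) auto
    also have "\<dots> = 16 * C * L2_sq A (\<lambda>x. g x - f x) + 24 * C * L2_sq A (\<lambda>x. f x - lincomb d xs x)" by (simp add: algebra_simps)
    also have "\<dots> \<le> 24 * C * L2_sq A (\<lambda>x. g x - f x) + (24 * C + 1) * (\<epsilon> / (2 * (24 * C + 1)))"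
      using C xs \<epsilon> by (intro add_mono mult_right_mono mult_mono) auto
    also have "(24 * C + 1) * (\<epsilon> / (2 * (24 * C + 1))) = \<epsilon> / 2"
    proof -
      have "k * (\<epsilon> / (2 * k)) = \<epsilon> / 2" if "k \<noteq> 0" for k :: real using that by simp
      then show ?thesis using C by (smt (verit))
    qed
    finally have "L2_sq B (\<lambda>\<omega>. T g \<omega> - T f \<omega>) \<le> 24 * C * L2_sq A (\<lambda>x. g x - f x) + \<epsilon> / 2" .
    also have "\<dots> \<le> \<epsilon>" using s by linarith
    finally show ?thesis .
  qed
  have "continuous_linear_L2 A (L2_fun A) B T"
    unfolding continuous_linear_L2_def
  proof (intro conjI ballI allI impI)
    fix f and \<epsilon> :: real assume f: "f \<in> L2_fun A" and \<epsilon>: "\<epsilon> > (0::real)"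
    \<comment> \<open>Chosen so that
      \<open>(24 * C + 1) * \<delta>\<^sup>2 = \<epsilon>\<^sup>2 / 4\<close>; then
      \<open>cont\<close> yields the bound \<epsilon>^2 / 2, and the remaining half gives
      strictness.\<close>
    define \<delta> where "\<delta> = sqrt (\<epsilon>\<^sup>2 / (4 * (24 * C + 1)))"
    have \<delta>: "\<delta> > 0" "\<delta>\<^sup>2 = \<epsilon>\<^sup>2 / (4 * (24 * C + 1))" using \<epsilon> C by (auto simp: \<delta>_def)
    show "\<exists>\<delta>>0. \<forall>g\<in>L2_fun A. L2_norm A (\<lambda>x. g x - f x) < \<delta> \<longrightarrow> L2_norm B (\<lambda>\<omega>. T g \<omega> - T f \<omega>) < \<epsilon>"
    proof (intro exI[of _ \<delta>] conjI ballI impI \<delta>)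
      fix g assume g: "g \<in> L2_fun A" and "L2_norm A (\<lambda>x. g x - f x) < \<delta>"
      then have "L2_sq A (\<lambda>x. g x - f x) < \<epsilon>\<^sup>2 / (4 * (24 * C + 1))"
        using \<delta> by (simp add: L2_norm_less_iff)
      then have "24 * C * L2_sq A (\<lambda>x. g x - f x) \<le> (24 * C + 1) * (\<epsilon>\<^sup>2 / (4 * (24 * C + 1)))"
        using C by (intro mult_mono) auto
      also have "\<dots> = (\<epsilon>\<^sup>2 / 2) / 2" using C by (simp add: field_simps)
      finally have "L2_sq B (\<lambda>\<omega>. T g \<omega> - T f \<omega>) \<le> \<epsilon>\<^sup>2 / 2"
        using \<epsilon> by (intro cont[OF f g]) auto
      also have "\<dots> < \<epsilon>\<^sup>2" using \<epsilon> by simp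
      finally show "L2_norm B (\<lambda>\<omega>. T g \<omega> - T f \<omega>) < \<epsilon>" using \<epsilon> by (simp add: L2_norm_less_iff)
    qed
  qed (auto intro: TL lin)
  with cons show ?thesis by blast
qed

section \<open>Closed linear spans and density\<close>

lemma L2_dense_fun: "L2_dense M d I f \<Longrightarrow> f \<in> L2_fun M"
  by (simp add: L2_dense_def)

text \<open>Reduces the closure properties below to exhibiting nearby members of the span. With the
  weak triangle inequality two errors of \<epsilon>/5 suffice, as 2/5 + 2/5 < 1.\<close>

lemma L2_dense_limit:
  assumes d: "\<And>i. i \<in> I \<Longrightarrow> d i \<in> L2_fun M" and f: "f \<in> L2_fun M"
    and ex: "\<And>\<epsilon>. \<epsilon> > 0 \<Longrightarrow> \<exists>g. L2_dense M d I g \<and> L2_sq M (\<lambda>x. f x - g x) \<le> \<epsilon>"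
  shows "L2_dense M d I f"
  unfolding L2_dense_def
proof (intro conjI f allI impI)
  fix \<epsilon> :: real assume \<epsilon>: "\<epsilon> > 0"
  then obtain g where g: "L2_dense M d I g" "L2_sq M (\<lambda>x. f x - g x) \<le> \<epsilon> / 5"
    using ex[of "\<epsilon>/5"] by auto
  with \<epsilon> obtain xs where xs: "snd ` set xs \<subseteq> I" "L2_sq M (\<lambda>x. g x - lincomb d xs x) < \<epsilon> / 5"
    unfolding L2_dense_def by (metis divide_pos_pos zero_less_numeral)
  have "L2_sq M (\<lambda>x. f x - lincomb d xs x) \<le> 2 * L2_sq M (\<lambda>x. f x - g x) + 2 * L2_sq M (\<lambda>x. g x - lincomb d xs x)"
    using d xs by (intro L2_sq_triangle f L2_dense_fun[OF g(1)] L2_fun_lincomb)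
  also have "\<dots> < \<epsilon>" using g xs \<epsilon> by linarith
  finally show "\<exists>xs. snd ` set xs \<subseteq> I \<and> L2_sq M (\<lambda>x. f x - lincomb d xs x) < \<epsilon>"
    using xs by blast
qed

lemma L2_dense_lincomb:
  assumes d: "\<And>i. i \<in> I \<Longrightarrow> d i \<in> L2_fun M" and "snd ` set xs \<subseteq> I"
  shows "L2_dense M d I (lincomb d xs)"
  unfolding L2_dense_def
proof (intro conjI allI impI exI[of _ xs])
  show "lincomb d xs \<in> L2_fun M" using assms by (auto intro: L2_fun_lincomb)
qed (use assms in \<open>simp_all add: L2_sq_def\<close>)

lemma L2_dense_add:
  assumes d: "\<And>i. i \<in> I \<Longrightarrow> d i \<in> L2_fun M"
    and fg: "L2_dense M d I f" "L2_dense M d I g"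
  shows "L2_dense M d I (\<lambda>x. f x + g x)"
proof (rule L2_dense_limit[OF d])
  show "(\<lambda>x. f x + g x) \<in> L2_fun M" using fg by (intro L2_fun_add L2_dense_fun)
  fix \<epsilon> :: real assume \<epsilon>: "\<epsilon> > 0"
  obtain xs where xs: "snd ` set xs \<subseteq> I" "L2_sq M (\<lambda>x. f x - lincomb d xs x) < \<epsilon> / 4"
    using fg(1) \<epsilon> unfolding L2_dense_def by (metis divide_pos_pos zero_less_numeral)
  obtain ys where ys: "snd ` set ys \<subseteq> I" "L2_sq M (\<lambda>x. g x - lincomb d ys x) < \<epsilon> / 4"
    using fg(2) \<epsilon> unfolding L2_dense_def by (metis divide_pos_pos zero_less_numeral)
  have "L2_sq M (\<lambda>x. (f x - lincomb d xs x) + (g x - lincomb d ys x)) \<le>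
    2 * L2_sq M (\<lambda>x. f x - lincomb d xs x) + 2 * L2_sq M (\<lambda>x. g x - lincomb d ys x)"
    using d xs ys by (intro L2_sq_add_le L2_fun_diff L2_dense_fun[OF fg(1)] L2_dense_fun[OF fg(2)] L2_fun_lincomb)
  moreover have "(\<lambda>x. (f x - lincomb d xs x) + (g x - lincomb d ys x)) = (\<lambda>x. f x + g x - lincomb d (xs @ ys) x)"
    by (simp add: fun_eq_iff)
  ultimately have "L2_sq M (\<lambda>x. f x + g x - lincomb d (xs @ ys) x) \<le> \<epsilon>" using xs ys by simp
  moreover have "L2_dense M d I (lincomb d (xs @ ys))"
    using xs ys by (intro L2_dense_lincomb d) (auto simp: image_Un)
  ultimately show "\<exists>h. L2_dense M d I h \<and> L2_sq M (\<lambda>x. f x + g x - h x) \<le> \<epsilon>" by blast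
qed

lemma L2_dense_cmult:
  assumes d: "\<And>i. i \<in> I \<Longrightarrow> d i \<in> L2_fun M" and f: "L2_dense M d I f"
  shows "L2_dense M d I (\<lambda>x. c * f x)"
proof (rule L2_dense_limit[OF d])
  show "(\<lambda>x. c * f x) \<in> L2_fun M" using f by (intro L2_fun_cmult L2_dense_fun)
  fix \<epsilon> :: real assume \<epsilon>: "\<epsilon> > 0"
  have pos: "c\<^sup>2 + 1 > 0" by (simp add: add_nonneg_pos)
  then obtain xs where xs: "snd ` set xs \<subseteq> I" "L2_sq M (\<lambda>x. f x - lincomb d xs x) < \<epsilon> / (c\<^sup>2 + 1)"
    using f \<epsilon> unfolding L2_dense_def by (metis divide_pos_pos)
  have "L2_sq M (\<lambda>x. c * f x - lincomb d (map (\<lambda>(a, i). (c * a, i)) xs) x) = c\<^sup>2 * L2_sq M (\<lambda>x. f x - lincomb d xs x)"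
    unfolding lincomb_scale by (simp add: L2_sq_cmult flip: right_diff_distrib)
  also have "\<dots> \<le> (c\<^sup>2 + 1) * (\<epsilon> / (c\<^sup>2 + 1))"
    using xs \<epsilon> by (intro mult_mono) auto
  also have "\<dots> = \<epsilon>" using pos by simp
  finally have "L2_sq M (\<lambda>x. c * f x - lincomb d (map (\<lambda>(a, i). (c * a, i)) xs) x) \<le> \<epsilon>" .
  moreover have "L2_dense M d I (lincomb d (map (\<lambda>(a, i). (c * a, i)) xs))"
    using xs by (intro L2_dense_lincomb d) force+
  ultimately show "\<exists>h. L2_dense M d I h \<and> L2_sq M (\<lambda>x. c * f x - h x) \<le> \<epsilon>" by blast
qed

lemma L2_dense_sum:
  assumes d: "\<And>i. i \<in> I \<Longrightarrow> d i \<in> L2_fun M"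
    and "\<And>j. j \<in> J \<Longrightarrow> L2_dense M d I (f j)"
  shows "L2_dense M d I (\<lambda>x. \<Sum>j\<in>J. f j x)"
proof -
  have "L2_dense M d I (\<lambda>x. 0)"
    using L2_dense_lincomb[of I d M "[]", OF d] by (simp add: lincomb_def[abs_def])
  then show ?thesis using assms(2)
    by (induction J rule: infinite_finite_induct) (auto intro: L2_dense_add[OF d])
qed

lemma L2_sq_dominated_convergence:
  assumes g: "\<And>n. g n \<in> borel_measurable M" and f: "f \<in> borel_measurable M" and h: "h \<in> L2_fun M"
    and le: "\<And>n. AE x in M. \<bar>g n x\<bar> \<le> \<bar>h x\<bar>" and lim: "AE x in M. (\<lambda>n. g n x) \<longlonglongrightarrow> f x"
  shows "f \<in> L2_fun M" "(\<lambda>n. L2_sq M (\<lambda>x. f x - g n x)) \<longlonglongrightarrow> 0"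
proof -
  note [measurable] = g f L2_funD(1)[OF h]
  have fh: "AE x in M. \<bar>f x\<bar> \<le> \<bar>h x\<bar>"
  proof -
    have "AE x in M. \<forall>n. \<bar>g n x\<bar> \<le> \<bar>h x\<bar>" using le by (simp add: AE_all_countable)
    then show ?thesis using lim
  proof eventually_elim
    case (elim x)
    then show ?case by (intro LIMSEQ_le_const2[OF tendsto_rabs]) auto
  qed
  qed
  then show "f \<in> L2_fun M" by (intro L2_fun_dominated[OF f h])
  have "(\<lambda>n. \<integral>x. (f x - g n x)\<^sup>2 \<partial>M) \<longlonglongrightarrow> (\<integral>x. 0 \<partial>M)"
  proof (rule integral_dominated_convergence)
    show "integrable M (\<lambda>x. 4 * (h x)\<^sup>2)" using h by (intro integrable_mult_right L2_funD)
    show "AE x in M. (\<lambda>n. (f x - g n x)\<^sup>2) \<longlonglongrightarrow> 0"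
      using lim
    proof eventually_elim
      case (elim x)
      have "(\<lambda>n. (f x - g n x)\<^sup>2) \<longlonglongrightarrow> (f x - f x)\<^sup>2" by (intro tendsto_intros elim)
      then show ?case by simp
    qed
    show "AE x in M. norm ((f x - g n x)\<^sup>2) \<le> 4 * (h x)\<^sup>2" for n
      using fh le[of n]
    proof eventually_elim
      case (elim x)
      then have "\<bar>f x - g n x\<bar> \<le> \<bar>2 * h x\<bar>" by linarith
      then have "(f x - g n x)\<^sup>2 \<le> (2 * h x)\<^sup>2" by (rule abs_le_square_iff[THEN iffD1])
      then show ?case by (simp add: power_mult_distrib)
    qed
  qed measurable
  then show "(\<lambda>n. L2_sq M (\<lambda>x. f x - g n x)) \<longlonglongrightarrow> 0" by (simp add: L2_sq_def)
qed

lemma L2_dense_dominated: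
  assumes d: "\<And>i. i \<in> I \<Longrightarrow> d i \<in> L2_fun M"
    and g: "\<And>n. L2_dense M d I (g n)" and f: "f \<in> borel_measurable M" and h: "h \<in> L2_fun M"
    and le: "\<And>n. AE x in M. \<bar>g n x\<bar> \<le> \<bar>h x\<bar>" and lim: "AE x in M. (\<lambda>n. g n x) \<longlonglongrightarrow> f x"
  shows "L2_dense M d I f"
proof (rule L2_dense_limit[OF d])
  note conv = L2_sq_dominated_convergence[OF L2_funD(1)[OF L2_dense_fun[OF g]] f h le lim]
  show "f \<in> L2_fun M" by (rule conv(1))
  fix \<epsilon> :: real assume "\<epsilon> > 0"
  with conv(2) have "eventually (\<lambda>n. L2_sq M (\<lambda>x. f x - g n x) < \<epsilon>) sequentially"
    by (rule order_tendstoD)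
  then obtain n where "L2_sq M (\<lambda>x. f x - g n x) < \<epsilon>" by (auto simp: eventually_sequentially)
  with g show "\<exists>g. L2_dense M d I g \<and> L2_sq M (\<lambda>x. f x - g x) \<le> \<epsilon>" by (metis less_imp_le)
qed

text \<open>Indicators are reached by induction over the intersection-stable generator, then simple
  functions, then dominated limits. The measure may be infinite, so the indicator of a complement
  need not be square integrable; every set is therefore first intersected with a member of the
  generator, and the exhausting sets \<open>B n\<close> remove this restriction at the end.\<close>

theorem L2_dense_generated:
  fixes E :: "'a set set" and B :: "nat \<Rightarrow> 'a set"
  assumes d: "\<And>i. i \<in> I \<Longrightarrow> d i \<in> L2_fun M"
    and gen: "sets M = sigma_sets (space M) E" "Int_stable E" "E \<subseteq> Pow (space M)"
    and B: "\<And>n. B n \<in> E" "incseq B" "(\<Union>n. B n) = space M"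
    and E: "\<And>A. A \<in> E \<Longrightarrow> L2_dense M d I (indicator A)"
    and f: "f \<in> L2_fun M"
  shows "L2_dense M d I f"
proof -
  have Es: "A \<in> sets M" if "A \<in> E" for A using that gen(1) by auto
  have *: "L2_dense M d I (indicator (A \<inter> C))" if A: "A \<in> sets M" and C: "C \<in> E" for A C
  proof -
    have "A \<in> sigma_sets (space M) E" using A gen(1) by simp
    with gen(2,3) show ?thesis
    proof (induction rule: sigma_sets_induct_disjoint)
      case (basic A)
      then show ?case using C gen(2) by (intro E) (auto simp: Int_stable_def)
    next
      case empty
      have "L2_dense M d I (\<lambda>x. 0 * indicator C x)" by (intro L2_dense_cmult[OF d] E C)
      then show ?case by simp
    next
      case (compl A)
      have "L2_dense M d I (\<lambda>x. indicator C x + (-1) * indicator (A \<inter> C) x)"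
        by (intro L2_dense_add[OF d] L2_dense_cmult[OF d] E C compl)
      moreover have "(\<lambda>x. indicator C x + (-1) * indicator (A \<inter> C) x) = (indicator ((space M - A) \<inter> C) :: 'a \<Rightarrow> real)"
        using C gen(3) by (auto simp: fun_eq_iff indicator_def)
      ultimately show ?case by simp
    next
      case (union A)
      show ?case
      proof (rule L2_dense_dominated[OF d])
        show "L2_dense M d I (\<lambda>x. \<Sum>i<n. indicator (A i \<inter> C) x)" for n
          by (intro L2_dense_sum[OF d] union)
        have "A i \<in> sets M" for i using union gen(1) by auto
        then show "indicator ((\<Union>i. A i) \<inter> C) \<in> borel_measurable M"
          using Es[OF C] by (intro borel_measurable_indicator) auto
        show "indicator C \<in> L2_fun M" using E[OF C] by (rule L2_dense_fun)
        have eq: "(\<Sum>i<n. indicator (A i \<inter> C) x) = (indicator ((\<Union>i<n. A i) \<inter> C) x :: real)" for n x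
        proof -
          have "disjoint_family_on (\<lambda>i. A i \<inter> C) {..<n}"
            using union(1) by (auto simp: disjoint_family_on_def)
          then have "(\<Sum>i<n. indicator (A i \<inter> C) x) = (indicator (\<Union>i<n. A i \<inter> C) x :: real)"
            by (rule indicator_UN_disjoint[OF finite_lessThan, symmetric])
          then show ?thesis by (simp add: Int_UN_distrib2)
        qed
        show "AE x in M. \<bar>\<Sum>i<n. indicator (A i \<inter> C) x\<bar> \<le> \<bar>indicator C x :: real\<bar>" for n
          unfolding eq by (auto simp: indicator_def)
        have "(\<lambda>n. indicator ((\<Union>i<n. A i) \<inter> C) x) \<longlonglongrightarrow> (indicator ((\<Union>i. A i) \<inter> C) x :: real)" for x
        proof (cases "x \<in> (\<Union>i. A i) \<inter> C")
          case True
          then obtain i where i: "x \<in> A i" by auto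
          have "eventually (\<lambda>n. indicator ((\<Union>i<n. A i) \<inter> C) x = (1::real)) sequentially"
            using eventually_gt_at_top[of i] by eventually_elim (use i True in \<open>auto simp: indicator_def\<close>)
          then show ?thesis using True by (simp add: tendsto_eventually)
        next
          case False
          then show ?thesis by (auto simp: indicator_def)
        qed
        then show "AE x in M. (\<lambda>n. \<Sum>i<n. indicator (A i \<inter> C) x) \<longlonglongrightarrow> (indicator ((\<Union>i. A i) \<inter> C) x :: real)"
          unfolding eq by simp
      qed
    qed
  qed
  from borel_measurable_implies_sequence_metric[OF L2_funD(1)[OF f], of 0] obtain F where
    F: "\<And>i. simple_function M (F i)" "\<And>x. x \<in> space M \<Longrightarrow> (\<lambda>i. F i x) \<longlonglongrightarrow> f x"
      "\<And>i x. x \<in> space M \<Longrightarrow> \<bar>F i x\<bar> \<le> 2 * \<bar>f x\<bar>" unfolding dist_real_def diff_0_right by blast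
  \<comment> \<open>Truncation to \<open>B n\<close> turns each level set into one of the
    intersections already treated, and preserves the domination by \<open>2 * f\<close>.\<close>
  define g where "g n x = (\<Sum>y\<in>F n ` space M. y * indicator ((F n -` {y} \<inter> space M) \<inter> B n) x)" for n x
  have g_eq: "g n x = F n x * indicator (B n) x" if x: "x \<in> space M" for n x
  proof -
    have "g n x = (\<Sum>y\<in>F n ` space M. if y = F n x then F n x * indicator (B n) x else 0)"
      unfolding g_def using x by (intro sum.cong) (auto simp: indicator_def)
    also have "\<dots> = F n x * indicator (B n) x"
      using x F(1)[of n] by (subst sum.delta) (auto simp: simple_function_def)
    finally show ?thesis .
  qed
  show ?thesis
  proof (rule L2_dense_dominated[OF d])
    show "L2_dense M d I (g n)" for n
      unfolding g_def by (intro L2_dense_sum[OF d] L2_dense_cmult[OF d] * B simple_functionD F)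
    show "f \<in> borel_measurable M" using f by (rule L2_funD)
    show "(\<lambda>x. 2 * f x) \<in> L2_fun M" using f by (rule L2_fun_cmult)
    show "AE x in M. \<bar>g n x\<bar> \<le> \<bar>2 * f x\<bar>" for n
      using F(3) by (intro AE_I2) (auto simp: g_eq abs_mult indicator_def)
    show "AE x in M. (\<lambda>n. g n x) \<longlonglongrightarrow> f x"
    proof (rule AE_I2)
      fix x assume x: "x \<in> space M"
      then obtain n0 where n0: "x \<in> B n0" using B(3) by auto
      have "eventually (\<lambda>n. F n x = g n x) sequentially"
        using eventually_ge_at_top[of n0]
      proof eventually_elim
        case (elim n)
        then have "x \<in> B n" using n0 B(2) by (auto simp: incseq_def)
        then show ?case using x by (simp add: g_eq)
      qed
      with F(2)[OF x] show "(\<lambda>n. g n x) \<longlonglongrightarrow> f x" by (rule Lim_transform_eventually)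
    qed
  qed
qed

section \<open>Gaussian quadratic forms\<close>

abbreviation "std_gauss m \<equiv> PiM {..<m} (\<lambda>_::nat. std_normal_distribution)"

lemma prob_space_std_normal: "prob_space std_normal_distribution"
  using real_dist_normal_dist by (simp add: real_distribution_def)

text \<open>Two one-dimensional substitutions replace the planar change of variables. For fixed y
  put u = c x - s y; then s x + c y = (s u + y) / c because c^2 + s^2 = 1. After exchanging the
  integrals, y is substituted for fixed u, and the factor 1/|c| of the first substitution is
  absorbed by the second.\<close>

lemma nn_integral_lborel_rotation:
  fixes c s :: real and h :: "real \<times> real \<Rightarrow> ennreal"
  assumes cs: "c\<^sup>2 + s\<^sup>2 = 1" "c \<noteq> 0" and [measurable]: "h \<in> borel_measurable (borel \<Otimes>\<^sub>M borel)"
  shows "(\<integral>\<^sup>+y. \<integral>\<^sup>+x. h (c * x - s * y, s * x + c * y) \<partial>lborel \<partial>lborel) = (\<integral>\<^sup>+y. \<integral>\<^sup>+x. h (x, y) \<partial>lborel \<partial>lborel)"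
proof -
  have 1: "(\<integral>\<^sup>+x. h (c * x - s * y, s * x + c * y) \<partial>lborel) = ennreal \<bar>1 / c\<bar> * (\<integral>\<^sup>+u. h (u, (s * u + y) / c) \<partial>lborel)" for y
  proof -
    have "(\<integral>\<^sup>+x. h (c * x - s * y, s * x + c * y) \<partial>lborel) = ennreal \<bar>1 / c\<bar> *
       (\<integral>\<^sup>+u. h (c * (s * y / c + 1 / c * u) - s * y, s * (s * y / c + 1 / c * u) + c * y) \<partial>lborel)"
      using cs by (intro nn_integral_real_affine) auto
    also have "(\<lambda>u. h (c * (s * y / c + 1 / c * u) - s * y, s * (s * y / c + 1 / c * u) + c * y)) = (\<lambda>u. h (u, (s * u + y) / c))"
    proof
      fix u
      have "c * (s * y / c + 1 / c * u) - s * y = u" using cs by (simp add: field_simps)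
      moreover have "s * (s * y / c + 1 / c * u) + c * y = (s * u + (c\<^sup>2 + s\<^sup>2) * y) / c"
        using cs(2) by (simp add: field_simps power2_eq_square)
      ultimately show "h (c * (s * y / c + 1 / c * u) - s * y, s * (s * y / c + 1 / c * u) + c * y) = h (u, (s * u + y) / c)"
        using cs(1) by simp
    qed
    finally show ?thesis .
  qed
  have 2: "ennreal \<bar>1 / c\<bar> * (\<integral>\<^sup>+y. h (u, (s * u + y) / c) \<partial>lborel) = (\<integral>\<^sup>+y. h (u, y) \<partial>lborel)" for u
  proof -
    have "(\<integral>\<^sup>+y. h (u, y) \<partial>lborel) = ennreal \<bar>1 / c\<bar> * (\<integral>\<^sup>+y. h (u, s * u / c + 1 / c * y) \<partial>lborel)"
      using cs by (intro nn_integral_real_affine) auto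
    also have "(\<lambda>y. h (u, s * u / c + 1 / c * y)) = (\<lambda>y. h (u, (s * u + y) / c))" by (simp add: add_divide_distrib)
    finally show ?thesis by simp
  qed
  have "(\<integral>\<^sup>+y. \<integral>\<^sup>+x. h (c * x - s * y, s * x + c * y) \<partial>lborel \<partial>lborel)
    = (\<integral>\<^sup>+y. \<integral>\<^sup>+u. ennreal \<bar>1 / c\<bar> * h (u, (s * u + y) / c) \<partial>lborel \<partial>lborel)"
    unfolding 1 by (subst nn_integral_cmult) auto
  also have "\<dots> = (\<integral>\<^sup>+u. \<integral>\<^sup>+y. ennreal \<bar>1 / c\<bar> * h (u, (s * u + y) / c) \<partial>lborel \<partial>lborel)"
    by (rule lborel_pair.Fubini') measurable
  also have "\<dots> = (\<integral>\<^sup>+u. \<integral>\<^sup>+y. h (u, y) \<partial>lborel \<partial>lborel)"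
  proof -
    have "(\<integral>\<^sup>+y. ennreal \<bar>1 / c\<bar> * h (u, (s * u + y) / c) \<partial>lborel) = ennreal \<bar>1 / c\<bar> * (\<integral>\<^sup>+y. h (u, (s * u + y) / c) \<partial>lborel)" for u
      by (rule nn_integral_cmult) measurable
    then show ?thesis by (simp only: 2)
  qed
  also have "\<dots> = (\<integral>\<^sup>+y. \<integral>\<^sup>+x. h (x, y) \<partial>lborel \<partial>lborel)"
    by (rule lborel_pair.Fubini') measurable
  finally show ?thesis .
qed

text \<open>The product density depends only on x^2 + y^2, so it can be carried along with
  \<open>h\<close> into the Lebesgue statement.\<close>

lemma nn_integral_gauss_rotation:
  fixes c s :: real and h :: "real \<times> real \<Rightarrow> ennreal"
  assumes cs: "c\<^sup>2 + s\<^sup>2 = 1" "c \<noteq> 0" and [measurable]: "h \<in> borel_measurable (borel \<Otimes>\<^sub>M borel)"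
  shows "(\<integral>\<^sup>+y. \<integral>\<^sup>+x. h (c * x - s * y, s * x + c * y) \<partial>std_normal_distribution \<partial>std_normal_distribution)
    = (\<integral>\<^sup>+y. \<integral>\<^sup>+x. h (x, y) \<partial>std_normal_distribution \<partial>std_normal_distribution)"
proof -
  let ?\<phi> = std_normal_density
  define k where "k = (\<lambda>(x, y). ennreal (?\<phi> x * ?\<phi> y) * h (x, y))"
  have [measurable]: "k \<in> borel_measurable (borel \<Otimes>\<^sub>M borel)" unfolding k_def by measurable
  have eq: "(\<integral>\<^sup>+y. \<integral>\<^sup>+x. g (x, y) \<partial>std_normal_distribution \<partial>std_normal_distribution)
    = (\<integral>\<^sup>+y. \<integral>\<^sup>+x. ennreal (?\<phi> x * ?\<phi> y) * g (x, y) \<partial>lborel \<partial>lborel)"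
    if [measurable]: "g \<in> borel_measurable (borel \<Otimes>\<^sub>M borel)" for g :: "real \<times> real \<Rightarrow> ennreal"
    by (simp add: nn_integral_density ennreal_mult nn_integral_cmult[symmetric] mult_ac)
  have \<phi>: "?\<phi> x * ?\<phi> y = ?\<phi> (c * x - s * y) * ?\<phi> (s * x + c * y)" for x y
  proof -
    have "(c * x - s * y)\<^sup>2 + (s * x + c * y)\<^sup>2 = (c\<^sup>2 + s\<^sup>2) * (x\<^sup>2 + y\<^sup>2)"
      by (simp add: power2_eq_square algebra_simps)
    then have "(c * x - s * y)\<^sup>2 + (s * x + c * y)\<^sup>2 = x\<^sup>2 + y\<^sup>2" using cs by simp
    moreover have "?\<phi> a * ?\<phi> b = 1 / (2 * pi) * exp (- (a\<^sup>2 + b\<^sup>2) / 2)" for a b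
      by (simp add: std_normal_density_def exp_add[symmetric] add_divide_distrib)
    ultimately show ?thesis by simp
  qed
  have "(\<integral>\<^sup>+y. \<integral>\<^sup>+x. h (c * x - s * y, s * x + c * y) \<partial>std_normal_distribution \<partial>std_normal_distribution)
    = (\<integral>\<^sup>+y. \<integral>\<^sup>+x. k (c * x - s * y, s * x + c * y) \<partial>lborel \<partial>lborel)"
    using eq[of "\<lambda>(x, y). h (c * x - s * y, s * x + c * y)"] by (simp add: k_def \<phi>[symmetric])
  also have "\<dots> = (\<integral>\<^sup>+y. \<integral>\<^sup>+x. k (x, y) \<partial>lborel \<partial>lborel)"
    by (rule nn_integral_lborel_rotation[OF cs]) measurable
  also have "\<dots> = (\<integral>\<^sup>+y. \<integral>\<^sup>+x. h (x, y) \<partial>std_normal_distribution \<partial>std_normal_distribution)"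
    by (subst eq) (auto simp: k_def)
  finally show ?thesis .
qed

definition rot :: "nat \<Rightarrow> nat \<Rightarrow> real \<Rightarrow> real \<Rightarrow> (nat \<Rightarrow> real) \<Rightarrow> nat \<Rightarrow> real" where
  "rot p q c s x = x(p := c * x p - s * x q, q := s * x p + c * x q)"

lemma rot_measurable:
  assumes "p < m" "q < m"
  shows "rot p q c s \<in> measurable (std_gauss m) (std_gauss m)"
proof (rule measurable_PiM_single')
  fix i assume i: "i \<in> {..<m}"
  have [measurable]: "(\<lambda>x. x j) \<in> borel_measurable (std_gauss m)" if "j < m" for j
    using that measurable_component_singleton[of j "{..<m}" "\<lambda>_. std_normal_distribution"] by simp
  have "(\<lambda>x. if i = q then s * x p + c * x q else if i = p then c * x p - s * x q else x i) \<in> borel_measurable (std_gauss m)"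
    using assms i by (cases "i = q"; cases "i = p") simp_all
  then show "(\<lambda>x. rot p q c s x i) \<in> measurable (std_gauss m) std_normal_distribution"
    by (simp add: rot_def fun_upd_def)
next
  show "rot p q c s \<in> space (std_gauss m) \<rightarrow> (\<Pi>\<^sub>E i\<in>{..<m}. space std_normal_distribution)"
    using assms by (auto simp: space_PiM rot_def PiE_def extensional_def)
qed

text \<open>With the other coordinates frozen, this is the planar case for the coordinates p and
  q.\<close>

lemma nn_integral_std_gauss_rot:
  assumes pq: "p < m" "q < m" "p \<noteq> q" and cs: "c\<^sup>2 + s\<^sup>2 = 1" "c \<noteq> 0"
    and f: "f \<in> borel_measurable (std_gauss m)"
  shows "(\<integral>\<^sup>+x. f (rot p q c s x) \<partial>std_gauss m) = (\<integral>\<^sup>+x. f x \<partial>std_gauss m)"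
proof -
  let ?N = "\<lambda>_::nat. std_normal_distribution"
  interpret N: prob_space std_normal_distribution by (rule prob_space_std_normal)
  interpret product_sigma_finite ?N by unfold_locales
  define J where "J = {..<m} - {p, q}"
  have J: "{..<m} = insert p (insert q J)" "finite J" "q \<notin> J" "p \<notin> insert q J" using pq by (auto simp: J_def)
  have ex: "(\<integral>\<^sup>+x. g x \<partial>std_gauss m) = (\<integral>\<^sup>+z. \<integral>\<^sup>+w. \<integral>\<^sup>+y. g (z(q := w, p := y)) \<partial>std_normal_distribution \<partial>std_normal_distribution \<partial>PiM J ?N)"
    if g: "g \<in> borel_measurable (std_gauss m)" for g
  proof -
    note g' = g[unfolded J(1)]
    have [measurable]: "(\<lambda>x. \<integral>\<^sup>+y. g (x(p := y)) \<partial>std_normal_distribution) \<in> borel_measurable (PiM (insert q J) ?N)"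
    proof -
      have [measurable]: "(\<lambda>(x, y). g (x(p := y))) \<in> borel_measurable (PiM (insert q J) ?N \<Otimes>\<^sub>M std_normal_distribution)"
        using measurable_compose[OF measurable_add_dim g'] by (simp add: case_prod_beta')
      show ?thesis by measurable
    qed
    have "integral\<^sup>N (PiM (insert p (insert q J)) ?N) g = (\<integral>\<^sup>+x. \<integral>\<^sup>+y. g (x(p := y)) \<partial>std_normal_distribution \<partial>PiM (insert q J) ?N)"
      using J(2) by (intro product_nn_integral_insert J(4) g') simp
    also have "\<dots> = (\<integral>\<^sup>+z. \<integral>\<^sup>+w. \<integral>\<^sup>+y. g (z(q := w, p := y)) \<partial>std_normal_distribution \<partial>std_normal_distribution \<partial>PiM J ?N)"
      by (intro product_nn_integral_insert J) measurable
    finally show ?thesis unfolding J(1) .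
  qed
  have "(\<integral>\<^sup>+x. f (rot p q c s x) \<partial>std_gauss m) = (\<integral>\<^sup>+z. \<integral>\<^sup>+w. \<integral>\<^sup>+y. f (rot p q c s (z(q := w, p := y))) \<partial>std_normal_distribution \<partial>std_normal_distribution \<partial>PiM J ?N)"
    using measurable_compose[OF rot_measurable[OF pq(1,2)] f] by (rule ex)
  also have "\<dots> = (\<integral>\<^sup>+z. \<integral>\<^sup>+w. \<integral>\<^sup>+y. f (z(q := s * y + c * w, p := c * y - s * w)) \<partial>std_normal_distribution \<partial>std_normal_distribution \<partial>PiM J ?N)"
    using pq by (simp add: rot_def fun_upd_twist)
  also have "\<dots> = (\<integral>\<^sup>+z. \<integral>\<^sup>+w. \<integral>\<^sup>+y. f (z(q := w, p := y)) \<partial>std_normal_distribution \<partial>std_normal_distribution \<partial>PiM J ?N)"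
  proof (rule nn_integral_cong)
    fix z assume z: "z \<in> space (PiM J ?N)"
    \<comment> \<open>The planar lemma asks for Borel measurability in the two free coordinates; the
      Gaussian and the Borel products have the same measurable sets.\<close>
    have z2: "z \<in> space (PiM J (\<lambda>_. borel))" using z by (simp add: space_PiM)
    have "(\<lambda>(y, w). z(q := w, p := y)) \<in> measurable (borel \<Otimes>\<^sub>M borel) (PiM (insert p (insert q J)) (\<lambda>_. borel))"
    proof -
      have "(\<lambda>u. z(q := snd u)) \<in> measurable (borel \<Otimes>\<^sub>M borel) (PiM (insert q J) (\<lambda>_. borel))"
        using z2 by (intro measurable_fun_upd[where J=J]) auto
      then have "(\<lambda>u. (z(q := snd u))(p := fst u)) \<in> measurable (borel \<Otimes>\<^sub>M borel) (PiM (insert p (insert q J)) (\<lambda>_. borel))"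
        by (intro measurable_fun_upd[where J="insert q J" and I="insert p (insert q J)" and f="\<lambda>u. z(q := snd u)"]) auto
      then show ?thesis by (simp add: case_prod_beta')
    qed
    moreover have "f \<in> borel_measurable (PiM (insert p (insert q J)) (\<lambda>_. borel))"
      using f unfolding J(1)[symmetric] by (subst measurable_cong_sets[where M'="std_gauss m" and N'=borel]) (auto intro!: sets_PiM_cong)
    ultimately have "(\<lambda>(y, w). f (z(q := w, p := y))) \<in> borel_measurable (borel \<Otimes>\<^sub>M borel)"
      using measurable_compose by (force simp: case_prod_beta')
    from nn_integral_gauss_rotation[OF cs this]
    show "(\<integral>\<^sup>+w. \<integral>\<^sup>+y. f (z(q := s * y + c * w, p := c * y - s * w)) \<partial>std_normal_distribution \<partial>std_normal_distribution)
       = (\<integral>\<^sup>+w. \<integral>\<^sup>+y. f (z(q := w, p := y)) \<partial>std_normal_distribution \<partial>std_normal_distribution)" by simp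
  qed
  also have "\<dots> = (\<integral>\<^sup>+x. f x \<partial>std_gauss m)" using f by (rule ex[symmetric])
  finally show ?thesis .
qed

lemma distr_std_gauss_rot:
  assumes pq: "p < m" "q < m" "p \<noteq> q" and cs: "c\<^sup>2 + s\<^sup>2 = 1" "c \<noteq> 0"
    and f: "f \<in> borel_measurable (std_gauss m)"
  shows "distr (std_gauss m) borel (\<lambda>x. f (rot p q c s x)) = distr (std_gauss m) borel f"
proof (rule measure_eqI)
  fix A assume "A \<in> sets (distr (std_gauss m) borel (\<lambda>x. f (rot p q c s x)))"
  then have A[measurable]: "A \<in> sets borel" by simp
  note fr = measurable_compose[OF rot_measurable[OF pq(1,2)] f]
  have "emeasure (distr (std_gauss m) borel g) A = (\<integral>\<^sup>+x. indicator A (g x) \<partial>std_gauss m)"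
    if [measurable]: "g \<in> borel_measurable (std_gauss m)" for g
    by (subst nn_integral_distr[of g _ borel "indicator A", symmetric]) auto
  moreover have "(\<integral>\<^sup>+x. indicator A (f (rot p q c s x)) \<partial>std_gauss m) = (\<integral>\<^sup>+x. indicator A (f x) \<partial>std_gauss m)"
    by (rule nn_integral_std_gauss_rot[OF pq cs]) (use f in measurable)
  ultimately show "emeasure (distr (std_gauss m) borel (\<lambda>x. f (rot p q c s x))) A = emeasure (distr (std_gauss m) borel f) A"
    using f fr by simp
qed simp

section \<open>Quadratic forms and Jacobi rotations\<close>

definition qform :: "nat \<Rightarrow> (nat \<Rightarrow> nat \<Rightarrow> real) \<Rightarrow> (nat \<Rightarrow> real) \<Rightarrow> real" where
  "qform m B x = (\<Sum>i<m. \<Sum>j<m. B i j * (x i * x j)) - (\<Sum>i<m. B i i)"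

text \<open>If R denotes the matrix of \<open>rot p q c s\<close>, this is the product B R.\<close>

definition colrot :: "nat \<Rightarrow> nat \<Rightarrow> real \<Rightarrow> real \<Rightarrow> (nat \<Rightarrow> nat \<Rightarrow> real) \<Rightarrow> nat \<Rightarrow> nat \<Rightarrow> real" where
  "colrot p q c s B i j = (if j = p then c * B i p + s * B i q else if j = q then c * B i q - s * B i p else B i j)"

text \<open>The conjugate R^T B R, obtained by rotating the columns of the transpose of B R and
  transposing back. Facts about columns can thus be applied twice.\<close>

definition conjrot :: "nat \<Rightarrow> nat \<Rightarrow> real \<Rightarrow> real \<Rightarrow> (nat \<Rightarrow> nat \<Rightarrow> real) \<Rightarrow> nat \<Rightarrow> nat \<Rightarrow> real" where
  "conjrot p q c s B i j = colrot p q c s (\<lambda>k l. colrot p q c s B l k) j i"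

lemma qform_measurable [measurable]: "qform m B \<in> borel_measurable (std_gauss m)"
proof -
  have [measurable]: "(\<lambda>x. x j) \<in> borel_measurable (std_gauss m)" if "j < m" for j
    using that measurable_component_singleton[of j "{..<m}" "\<lambda>_. std_normal_distribution"] by simp
  show ?thesis unfolding qform_def[abs_def]
    by (intro borel_measurable_diff borel_measurable_sum borel_measurable_times borel_measurable_const) auto
qed

lemma sum_split2:
  fixes p q m :: nat
  assumes "p < m" "q < m" "p \<noteq> q"
  shows "(\<Sum>i<m. f i) = f p + f q + (\<Sum>i\<in>{..<m} - {p, q}. f i :: real)"
proof -
  define K where "K = {..<m} - {p, q}"
  have "{..<m} = insert p (insert q K)" "finite K" "q \<notin> K" "p \<notin> insert q K" using assms by (auto simp: K_def)
  then have "(\<Sum>i<m. f i) = f p + (f q + (\<Sum>i\<in>K. f i))" by simp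
  then show ?thesis by (simp add: K_def)
qed

lemma sum_colrot:
  assumes pq: "p < m" "q < m" "p \<noteq> q"
  shows "(\<Sum>j<m. colrot p q c s B i j * x j) = (\<Sum>j<m. B i j * rot p q c s x j)"
proof -
  have "(\<Sum>j\<in>{..<m} - {p, q}. colrot p q c s B i j * x j) = (\<Sum>j\<in>{..<m} - {p, q}. B i j * rot p q c s x j)"
    by (intro sum.cong) (auto simp: colrot_def rot_def)
  then show ?thesis unfolding sum_split2[OF pq] using pq
    by (simp add: colrot_def rot_def algebra_simps)
qed

lemma sum_colrot_square:
  assumes pq: "p < m" "q < m" "p \<noteq> q" and cs: "c\<^sup>2 + s\<^sup>2 = 1"
  shows "(\<Sum>j<m. (colrot p q c s B i j)\<^sup>2) = (\<Sum>j<m. (B i j)\<^sup>2)"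
proof -
  have "(\<Sum>j\<in>{..<m} - {p, q}. (colrot p q c s B i j)\<^sup>2) = (\<Sum>j\<in>{..<m} - {p, q}. (B i j)\<^sup>2)"
    by (intro sum.cong) (auto simp: colrot_def)
  moreover have "(c * a + s * b)\<^sup>2 + (c * b - s * a)\<^sup>2 = a\<^sup>2 + b\<^sup>2" for a b
  proof -
    have "(c * a + s * b)\<^sup>2 + (c * b - s * a)\<^sup>2 = (c\<^sup>2 + s\<^sup>2) * (a\<^sup>2 + b\<^sup>2)"
      by (simp add: power2_eq_square algebra_simps)
    then show ?thesis using cs by simp
  qed
  ultimately show ?thesis unfolding sum_split2[OF pq] using pq by (simp add: colrot_def)
qed

lemma conjrot_frobenius:
  assumes pq: "p < m" "q < m" "p \<noteq> q" and cs: "c\<^sup>2 + s\<^sup>2 = 1"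
  shows "(\<Sum>i<m. \<Sum>j<m. (conjrot p q c s B i j)\<^sup>2) = (\<Sum>i<m. \<Sum>j<m. (B i j)\<^sup>2)"
proof -
  have "(\<Sum>i<m. \<Sum>j<m. (conjrot p q c s B i j)\<^sup>2) = (\<Sum>j<m. \<Sum>i<m. (conjrot p q c s B i j)\<^sup>2)"
    by (rule sum.swap)
  also have "\<dots> = (\<Sum>j<m. \<Sum>i<m. (colrot p q c s B i j)\<^sup>2)"
    unfolding conjrot_def by (simp add: sum_colrot_square[OF pq cs])
  also have "\<dots> = (\<Sum>i<m. \<Sum>j<m. (colrot p q c s B i j)\<^sup>2)" by (rule sum.swap)
  also have "\<dots> = (\<Sum>i<m. \<Sum>j<m. (B i j)\<^sup>2)" by (simp add: sum_colrot_square[OF pq cs])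
  finally show ?thesis .
qed

lemma conjrot_diag:
  assumes "p \<noteq> q"
  shows "conjrot p q c s B p p = c\<^sup>2 * B p p + c * s * (B p q + B q p) + s\<^sup>2 * B q q"
    and "conjrot p q c s B q q = s\<^sup>2 * B p p - c * s * (B p q + B q p) + c\<^sup>2 * B q q"
    and "i \<noteq> p \<Longrightarrow> i \<noteq> q \<Longrightarrow> conjrot p q c s B i i = B i i"
  using assms by (auto simp: conjrot_def colrot_def power2_eq_square algebra_simps)

lemma conjrot_trace:
  assumes pq: "p < m" "q < m" "p \<noteq> q" and cs: "c\<^sup>2 + s\<^sup>2 = 1"
  shows "(\<Sum>i<m. conjrot p q c s B i i) = (\<Sum>i<m. B i i)"
proof -
  have "(\<Sum>i\<in>{..<m} - {p, q}. conjrot p q c s B i i) = (\<Sum>i\<in>{..<m} - {p, q}. B i i)"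
    by (intro sum.cong) (auto simp: conjrot_diag[OF pq(3)])
  moreover have "conjrot p q c s B p p + conjrot p q c s B q q = (c\<^sup>2 + s\<^sup>2) * (B p p + B q q)"
    unfolding conjrot_diag[OF pq(3)] by (simp add: algebra_simps)
  ultimately show ?thesis unfolding sum_split2[OF pq] using cs by simp
qed

lemma conjrot_sym:
  assumes "\<And>i j. B i j = B j i" "p \<noteq> q"
  shows "conjrot p q c s B i j = conjrot p q c s B j i"
proof -
  have "conjrot p q c s B i j = colrot p q c s (\<lambda>k l. colrot p q c s (\<lambda>a b. B b a) l k) i j"
    using assms(2) by (simp add: conjrot_def colrot_def algebra_simps)
  moreover have "(\<lambda>a b. B b a) = B" using assms(1) by blast
  ultimately show ?thesis by (simp only: conjrot_def)
qed

text \<open>The rotation is moved from the vector to the array, once for each of the two sums. The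
  subtracted trace, which centres the form under the standard Gaussian law, is invariant under the
  conjugation.\<close>

lemma qform_rot:
  assumes pq: "p < m" "q < m" "p \<noteq> q" and cs: "c\<^sup>2 + s\<^sup>2 = 1"
  shows "qform m B (rot p q c s x) = qform m (conjrot p q c s B) x"
proof -
  let ?y = "rot p q c s x"
  have "(\<Sum>i<m. \<Sum>j<m. B i j * (?y i * ?y j)) = (\<Sum>i<m. ?y i * (\<Sum>j<m. B i j * ?y j))"
    by (simp add: sum_distrib_left mult_ac)
  also have "\<dots> = (\<Sum>i<m. ?y i * (\<Sum>j<m. colrot p q c s B i j * x j))"
    by (simp add: sum_colrot[OF pq])
  also have "\<dots> = (\<Sum>i<m. \<Sum>j<m. x j * (colrot p q c s B i j * ?y i))"
    by (simp add: sum_distrib_left mult_ac)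
  also have "\<dots> = (\<Sum>j<m. \<Sum>i<m. x j * (colrot p q c s B i j * ?y i))" by (rule sum.swap)
  also have "\<dots> = (\<Sum>j<m. x j * (\<Sum>i<m. conjrot p q c s B i j * x i))"
    unfolding conjrot_def sum_colrot[OF pq] by (simp add: sum_distrib_left)
  also have "\<dots> = (\<Sum>j<m. \<Sum>i<m. conjrot p q c s B i j * (x i * x j))"
    by (simp add: sum_distrib_left mult_ac)
  also have "\<dots> = (\<Sum>i<m. \<Sum>j<m. conjrot p q c s B i j * (x i * x j))" by (rule sum.swap)
  finally show ?thesis unfolding qform_def conjrot_trace[OF pq cs] by simp
qed

text \<open>A Jacobi rotation annihilates the entry at \<open>(p, q)\<close> and moves its weight to the diagonal.\<close>

lemma jacobi_rotation:
  fixes B :: "nat \<Rightarrow> nat \<Rightarrow> real"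
  assumes pq: "p < m" "q < m" "p \<noteq> q" and sym: "\<And>i j. B i j = B j i" and nz: "B p q \<noteq> 0"
  shows "\<exists>c s. c\<^sup>2 + s\<^sup>2 = 1 \<and> c \<noteq> 0 \<and> (\<Sum>i<m. (B i i)\<^sup>2) < (\<Sum>i<m. (conjrot p q c s B i i)\<^sup>2)"
proof -
  define a b d where "a = B p p" and "b = B p q" and "d = B q q"
  \<comment> \<open>\<open>t\<close> is the tangent of the rotation angle, a root of the quadratic
    in \<open>root\<close>; that equation says that the new entry at (p, q) vanishes. The cosine
    \<open>c\<close> is then positive.\<close>
  define t where "t = (sqrt ((a - d)\<^sup>2 + 4 * b\<^sup>2) - (a - d)) / (2 * b)"
  define c where "c = 1 / sqrt (1 + t\<^sup>2)"
  define s where "s = t * c"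
  have b: "b \<noteq> 0" using nz by (simp add: b_def)
  have pos: "1 + t\<^sup>2 > 0" by (simp add: add_pos_nonneg)
  have c2: "c\<^sup>2 = 1 / (1 + t\<^sup>2)" using pos by (simp add: c_def power_divide)
  have cs: "c\<^sup>2 + s\<^sup>2 = 1"
  proof -
    have "c\<^sup>2 + s\<^sup>2 = (1 + t\<^sup>2) * c\<^sup>2" by (simp add: s_def power_mult_distrib algebra_simps)
    then show ?thesis using pos c2 by simp
  qed
  have c0: "c \<noteq> 0" using pos by (simp add: c_def)
  have root: "b * t\<^sup>2 + (a - d) * t - b = 0"
  proof -
    have "2 * b * t + (a - d) = sqrt ((a - d)\<^sup>2 + 4 * b\<^sup>2)" using b by (simp add: t_def)
    then have "(2 * b * t + (a - d))\<^sup>2 = (a - d)\<^sup>2 + 4 * b\<^sup>2" by simp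
    then have "4 * b * (b * t\<^sup>2 + (a - d) * t - b) = 0"
      by (simp add: power2_eq_square algebra_simps)
    then show ?thesis using b by simp
  qed
  \<comment> \<open>Entries of the rotated 2 x 2 block. The identity below is the invariance of its
    Frobenius norm, so b' = 0 leaves the gain 2 b^2 on the diagonal.\<close>
  define a' d' b' where "a' = c\<^sup>2 * a + 2 * c * s * b + s\<^sup>2 * d"
    and "d' = s\<^sup>2 * a - 2 * c * s * b + c\<^sup>2 * d" and "b' = (c\<^sup>2 - s\<^sup>2) * b - c * s * (a - d)"
  have "b' = - (c\<^sup>2 * (b * t\<^sup>2 + (a - d) * t - b))"
    by (simp add: b'_def s_def power2_eq_square algebra_simps)
  then have b'0: "b' = 0" using root by simp
  have "a'\<^sup>2 + d'\<^sup>2 + 2 * b'\<^sup>2 = (c\<^sup>2 + s\<^sup>2)\<^sup>2 * (a\<^sup>2 + d\<^sup>2 + 2 * b\<^sup>2)"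
    unfolding a'_def d'_def b'_def by algebra
  then have ad: "a'\<^sup>2 + d'\<^sup>2 = a\<^sup>2 + d\<^sup>2 + 2 * b\<^sup>2" using cs b'0 by simp
  have "(\<Sum>i\<in>{..<m} - {p, q}. (conjrot p q c s B i i)\<^sup>2) = (\<Sum>i\<in>{..<m} - {p, q}. (B i i)\<^sup>2)"
    by (intro sum.cong) (auto simp: conjrot_diag[OF pq(3)])
  moreover have "conjrot p q c s B p p = a'" "conjrot p q c s B q q = d'"
    using sym[of q p] by (simp_all add: conjrot_diag[OF pq(3)] a'_def d'_def a_def b_def d_def algebra_simps)
  ultimately have "(\<Sum>i<m. (conjrot p q c s B i i)\<^sup>2) = (\<Sum>i<m. (B i i)\<^sup>2) + 2 * b\<^sup>2"
    unfolding sum_split2[OF pq] using ad by (simp add: a_def d_def)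
  then show ?thesis using b cs c0 by (intro exI[of _ c] exI[of _ s]) auto
qed

section \<open>Compactness and continuity of laws\<close>

lemma countable_diagonal_subsequence:
  fixes X :: "nat \<Rightarrow> 'k::countable \<Rightarrow> real"
  assumes b: "\<And>n k. \<bar>X n k\<bar> \<le> b k"
  shows "\<exists>r l. strict_mono (r :: nat \<Rightarrow> nat) \<and> (\<forall>k. (\<lambda>n. X (r n) k) \<longlonglongrightarrow> l k)"
proof -
  let ?P = "\<lambda>j (s::nat\<Rightarrow>nat). convergent (\<lambda>n. X (s n) (from_nat j))"
  interpret subseqs ?P
  proof
    fix j :: nat and s :: "nat \<Rightarrow> nat" assume "strict_mono s"
    let ?k = "from_nat j :: 'k"
    have "X (s n) ?k \<in> {- b ?k .. b ?k}" for n using b[of "s n" ?k] by (auto simp: abs_le_iff)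
    then obtain l r where "strict_mono r" "((\<lambda>n. X (s n) ?k) \<circ> r) \<longlonglongrightarrow> l"
      using seq_compactE[OF compact_imp_seq_compact[OF compact_Icc[of "- b ?k" "b ?k"]], of "\<lambda>n. X (s n) ?k"] by metis
    then show "\<exists>r. strict_mono r \<and> convergent (\<lambda>n. X ((s \<circ> r) n) ?k)"
      by (intro exI[of _ r] conjI convergentI[of _ l]) (simp_all add: o_def)
  qed
  have "convergent (\<lambda>n. X (diagseq n) k)" for k
  proof -
    \<comment> \<open>The diagonal sequence is a subsequence of the selection for index j only from
      position j + 1 on; the shift is undone by \<open>LIMSEQ_offset\<close>.\<close>
    have "?P (to_nat k) (diagseq \<circ> (+) (Suc (to_nat k)))"
    proof (rule diagseq_holds)
      fix r s :: "nat \<Rightarrow> nat" and n assume "strict_mono r" "?P n s"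
      then show "?P n (s \<circ> r)"
        using convergent_subseq_convergent[of "\<lambda>i. X (s i) (from_nat n)" r] by (simp add: o_def)
    qed
    then obtain l where "(\<lambda>n. X (diagseq (n + Suc (to_nat k))) k) \<longlonglongrightarrow> l"
      by (auto simp: convergent_def o_def add.commute)
    then show ?thesis by (intro convergentI) (rule LIMSEQ_offset)
  qed
  then have "\<forall>k. \<exists>l. (\<lambda>n. X (diagseq n) k) \<longlonglongrightarrow> l" by (simp add: convergent_def)
  then obtain l where "\<forall>k. (\<lambda>n. X (diagseq n) k) \<longlonglongrightarrow> l k" by metis
  with subseq_diagseq show ?thesis by blast
qed

lemma (in prob_space) char_distr:
  "X \<in> borel_measurable M \<Longrightarrow> char (distr M borel X) t = (\<integral>\<omega>. iexp (t * X \<omega>) \<partial>M)"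
  unfolding char_def by (subst integral_distr) auto

text \<open>Dominated convergence with integrands of modulus 1. The frequency is allowed to move
  with n, which is what the tightness argument requires.\<close>

lemma (in prob_space) char_distr_tendsto_AE:
  assumes [measurable]: "\<And>n. X n \<in> borel_measurable M" "Y \<in> borel_measurable M"
    and lim: "AE \<omega> in M. (\<lambda>n. X n \<omega>) \<longlonglongrightarrow> Y \<omega>" and t: "t \<longlonglongrightarrow> s"
  shows "(\<lambda>n. char (distr M borel (X n)) (t n)) \<longlonglongrightarrow> char (distr M borel Y) s"
proof -
  have "(\<lambda>n. \<integral>\<omega>. iexp (t n * X n \<omega>) \<partial>M) \<longlonglongrightarrow> (\<integral>\<omega>. iexp (s * Y \<omega>) \<partial>M)"
  proof (rule integral_dominated_convergence[where w = "\<lambda>_. 1"])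
    show "AE \<omega> in M. (\<lambda>n. iexp (t n * X n \<omega>)) \<longlonglongrightarrow> iexp (s * Y \<omega>)"
      using lim by eventually_elim (intro tendsto_intros t)
  qed auto
  then show ?thesis by (simp add: char_distr)
qed

lemma prob_space_std_gauss: "prob_space (std_gauss m)"
  by (intro prob_space_PiM prob_space_std_normal)

lemma std_gauss_component: "j < m \<Longrightarrow> (\<lambda>x. x j) \<in> borel_measurable (std_gauss m)"
  using measurable_component_singleton[of j "{..<m}" "\<lambda>_. std_normal_distribution"] by simp

lemma qform_tendsto:
  assumes "\<And>i j. i < m \<Longrightarrow> j < m \<Longrightarrow> (\<lambda>n. C n i j) \<longlonglongrightarrow> B i j"
  shows "(\<lambda>n. qform m (C n) x) \<longlonglongrightarrow> qform m B x"
  unfolding qform_def using assms by (intro tendsto_intros) auto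

text \<open>Convergence of coefficients gives pointwise convergence of the forms and hence of their
  characteristic functions. This makes the feasible set of the extremal argument below
  closed.\<close>

lemma law_qform_closed:
  assumes "\<And>i j. i < m \<Longrightarrow> j < m \<Longrightarrow> (\<lambda>n. C n i j) \<longlonglongrightarrow> B i j"
    and "\<And>n. distr (std_gauss m) borel (qform m (C n)) = L"
  shows "distr (std_gauss m) borel (qform m B) = L"
proof -
  interpret prob_space "std_gauss m" by (rule prob_space_std_gauss)
  have rd: "real_distribution (distr (std_gauss m) borel (qform m A))" for A
    by (intro real_distribution_distr) measurable
  have "char (distr (std_gauss m) borel (qform m B)) t = char L t" for t
  proof -
    have "(\<lambda>n. char (distr (std_gauss m) borel (qform m (C n))) t) \<longlonglongrightarrow> char (distr (std_gauss m) borel (qform m B)) t"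
      using assms(1) by (intro char_distr_tendsto_AE qform_measurable AE_I2 qform_tendsto tendsto_const)
    then show ?thesis unfolding assms(2) by (simp add: LIMSEQ_const_iff)
  qed
  moreover have "real_distribution L" using rd[of "C 0"] assms(2) by simp
  ultimately show ?thesis using rd by (intro Levy_uniqueness) auto
qed

text \<open>
  Among the symmetric coefficient arrays with the same law and the same Frobenius norm, which form a
  compact set, one maximizes the sum of the squared diagonal entries. It is diagonal, since a
  Jacobi rotation would otherwise increase that sum.
\<close>

theorem qform_diagonalize:
  fixes B :: "nat \<Rightarrow> nat \<Rightarrow> real"
  assumes sym: "\<And>i j. B i j = B j i"
  shows "\<exists>d. distr (std_gauss m) borel (qform m B) = distr (std_gauss m) borel (\<lambda>x. \<Sum>i<m. d i * ((x i)\<^sup>2 - 1)) \<and>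
    (\<Sum>i<m. (d i)\<^sup>2) = (\<Sum>i<m. \<Sum>j<m. (B i j)\<^sup>2)"
proof -
  define law where "law C = distr (std_gauss m) borel (qform m C)" for C
  define frob where "frob C = (\<Sum>i<m. \<Sum>j<m. (C i j)\<^sup>2)" for C :: "nat \<Rightarrow> nat \<Rightarrow> real"
  define D where "D C = (\<Sum>i<m. (C i i)\<^sup>2)" for C :: "nat \<Rightarrow> nat \<Rightarrow> real"
  define S where "S = {C. (\<forall>i j. C i j = C j i) \<and> law C = law B \<and> frob C = frob B}"
  have BS: "B \<in> S" using sym by (auto simp: S_def)
  have entry: "(C i j)\<^sup>2 \<le> frob C" if "i < m" "j < m" for C i j
  proof -
    have "(C i j)\<^sup>2 \<le> (\<Sum>j<m. (C i j)\<^sup>2)" using that by (intro member_le_sum) auto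
    also have "\<dots> \<le> frob C" unfolding frob_def using that by (intro member_le_sum) (auto intro: sum_nonneg)
    finally show ?thesis .
  qed
  have DF: "D C \<le> frob C" for C
    unfolding D_def frob_def by (intro sum_mono member_le_sum) auto
  have bdd: "bdd_above (D ` S)" 
  proof (rule bdd_aboveI)
    fix y assume "y \<in> D ` S"
    then obtain C where "y = D C" "frob C = frob B" by (auto simp: S_def)
    then show "y \<le> frob B" using DF[of C] by simp
  qed
  define s where "s = Sup (D ` S)"
  have "\<exists>C\<in>S. s - 1 / real (Suc n) < D C" for n
  proof -
    have "s - 1 / real (Suc n) < s" by simp
    moreover have "D ` S \<noteq> {}" using BS by auto
    ultimately have "\<exists>y\<in>D ` S. s - 1 / real (Suc n) < y" unfolding s_def by (intro less_cSupD) auto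
    then show ?thesis by blast
  qed
  then obtain Cn where Cn: "\<And>n. Cn n \<in> S" "\<And>n. s - 1 / real (Suc n) < D (Cn n)" by metis
  \<comment> \<open>Entries outside the m x m block are not controlled by the Frobenius norm and are
    set to 0. The limit is then symmetric for all indices, as membership in \<open>S\<close>
    demands.\<close>
  define X where "X n = (\<lambda>(i, j). if i < m \<and> j < m then Cn n i j else 0)" for n
  have "\<bar>X n k\<bar> \<le> sqrt (frob B)" for n k
  proof (cases k)
    case (Pair i j)
    have "frob (Cn n) = frob B" using Cn(1) by (auto simp: S_def)
    then have "i < m \<Longrightarrow> j < m \<Longrightarrow> \<bar>Cn n i j\<bar> \<le> sqrt (frob B)"
      using entry[of i j "Cn n"] real_le_rsqrt[of "\<bar>Cn n i j\<bar>"] by simp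
    moreover have "0 \<le> frob B" by (simp add: frob_def sum_nonneg)
    ultimately show ?thesis using Pair by (simp add: X_def)
  qed
  from countable_diagonal_subsequence[of X, OF this] obtain r l where
    r: "strict_mono (r :: nat \<Rightarrow> nat)" and l: "\<And>k. (\<lambda>n. X (r n) k) \<longlonglongrightarrow> l k" by blast
  define C where "C i j = l (i, j)" for i j
  have lim: "(\<lambda>n. Cn (r n) i j) \<longlonglongrightarrow> C i j" if "i < m" "j < m" for i j
    using l[of "(i, j)"] that by (simp add: X_def C_def)
  have symC: "C i j = C j i" for i j
  proof -
    have "X n (i, j) = X n (j, i)" for n using Cn(1)[of n] by (auto simp: X_def S_def)
    then have "(\<lambda>n. X (r n) (i, j)) \<longlonglongrightarrow> l (j, i)" using l[of "(j, i)"] by simp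
    then show ?thesis unfolding C_def using l[of "(i, j)"] by (rule LIMSEQ_unique[rotated])
  qed
  have lawC: "law C = law B"
  proof -
    have "distr (std_gauss m) borel (qform m (Cn (r n))) = law B" for n
      using Cn(1)[of "r n"] unfolding S_def law_def by blast
    then show ?thesis unfolding law_def[of C] by (intro law_qform_closed[OF lim])
  qed
  have frobC: "frob C = frob B"
  proof -
    have "(\<lambda>n. frob (Cn (r n))) \<longlonglongrightarrow> frob C" unfolding frob_def by (intro tendsto_intros lim) auto
    moreover have "frob (Cn (r n)) = frob B" for n using Cn(1) by (auto simp: S_def)
    ultimately show ?thesis by (simp add: LIMSEQ_const_iff)
  qed
  have sD: "s \<le> D C"
  proof -
    have "(\<lambda>n. D (Cn (r n))) \<longlonglongrightarrow> D C" unfolding D_def by (intro tendsto_intros lim) auto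
    moreover have "(\<lambda>n. s - 1 / real (Suc (r n))) \<longlonglongrightarrow> s - 0"
      using LIMSEQ_subseq_LIMSEQ[OF lim_inverse_n'[THEN LIMSEQ_Suc] r] by (intro tendsto_diff tendsto_const) (simp add: o_def inverse_eq_divide)
    moreover have "\<exists>N. \<forall>n\<ge>N. s - 1 / real (Suc (r n)) \<le> D (Cn (r n))" using Cn(2) less_imp_le by blast
    ultimately have "s - 0 \<le> D C" by (intro LIMSEQ_le)
    then show ?thesis by simp
  qed
  have off: "C p q = 0" if pq: "p < m" "q < m" "p \<noteq> q" for p q
  proof (rule ccontr)
    assume nz: "C p q \<noteq> 0"
    from jacobi_rotation[OF pq symC nz] obtain c s' where cs: "c\<^sup>2 + s'\<^sup>2 = 1" "c \<noteq> 0"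
      and less: "D C < D (conjrot p q c s' C)" unfolding D_def by blast
    have "law (conjrot p q c s' C) = law C"
      using distr_std_gauss_rot[OF pq cs qform_measurable, of C] unfolding law_def qform_rot[OF pq cs(1)] .
    then have "conjrot p q c s' C \<in> S"
      using lawC frobC conjrot_frobenius[OF pq cs(1), of C] conjrot_sym[OF symC pq(3)]
      by (auto simp: S_def frob_def)
    then have "D (conjrot p q c s' C) \<le> s" unfolding s_def by (intro cSup_upper bdd) auto
    with less sD show False by simp
  qed
  have diag: "(\<Sum>j<m. C i j * g j) = C i i * g i" if "i < m" for i g
  proof -
    have "(\<Sum>j<m. C i j * g j) = (\<Sum>j<m. if j = i then C i i * g i else 0)"
      using off[OF that] by (intro sum.cong) auto
    then show ?thesis using that by simp
  qed
  have "qform m C = (\<lambda>x. \<Sum>i<m. C i i * ((x i)\<^sup>2 - 1))"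
  proof
    fix x
    have "(\<Sum>i<m. \<Sum>j<m. C i j * (x i * x j)) = (\<Sum>i<m. C i i * (x i)\<^sup>2)"
      using diag by (intro sum.cong) (auto simp: power2_eq_square)
    then show "qform m C x = (\<Sum>i<m. C i i * ((x i)\<^sup>2 - 1))"
      by (simp add: qform_def sum_subtractf right_diff_distrib)
  qed
  moreover have "(\<Sum>i<m. (C i i)\<^sup>2) = frob C"
    unfolding frob_def using diag[of _ "C _"] by (intro sum.cong) (auto simp: power2_eq_square)
  ultimately show ?thesis using lawC frobC unfolding law_def frob_def
    by (intro exI[of _ "\<lambda>i. C i i"]) auto
qed

section \<open>The characteristic function of a centred squared Gaussian variable\<close>

definition psi :: "real \<Rightarrow> complex" where
  "psi = char (distr std_normal_distribution borel (\<lambda>x. x\<^sup>2 - 1))"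

lemma psi_eq: "psi u = (\<integral>x. iexp (u * (x\<^sup>2 - 1)) \<partial>std_normal_distribution)"
  unfolding psi_def using prob_space_std_normal by (intro prob_space.char_distr) auto

lemma std_normal_moments:
  "integrable std_normal_distribution (\<lambda>x. x\<^sup>2 - 1)" "(\<integral>x. x\<^sup>2 - 1 \<partial>std_normal_distribution) = 0"
  "integrable std_normal_distribution (\<lambda>x. (x\<^sup>2 - 1)\<^sup>2)" "(\<integral>x. (x\<^sup>2 - 1)\<^sup>2 \<partial>std_normal_distribution) = 2"
  "integrable std_normal_distribution (\<lambda>x. \<bar>x\<^sup>2 - 1\<bar> ^ 3)"
proof -
  interpret prob_space std_normal_distribution by (rule prob_space_std_normal)
  note I = integrable_std_normal_distribution_moment
  have m2: "(\<integral>x. x\<^sup>2 \<partial>std_normal_distribution) = 1"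
    using std_normal_distribution_even_moments(1)[of 1] by simp
  have m4: "(\<integral>x. x ^ 4 \<partial>std_normal_distribution) = 3"
    using std_normal_distribution_even_moments(1)[of 2] by (simp add: fact_numeral)
  show i1: "integrable std_normal_distribution (\<lambda>x. x\<^sup>2 - 1)"
    by (intro Bochner_Integration.integrable_diff I) simp
  show "(\<integral>x. x\<^sup>2 - 1 \<partial>std_normal_distribution) = 0"
    using I[of 2] m2 prob_space by (subst Bochner_Integration.integral_diff) auto
  have eq: "(\<lambda>x. (x\<^sup>2 - 1)\<^sup>2) = (\<lambda>x. (x ^ 4 - 2 * x\<^sup>2) + 1 :: real)"
    by (simp add: fun_eq_iff power2_eq_square power4_eq_xxxx algebra_simps)
  show "integrable std_normal_distribution (\<lambda>x. (x\<^sup>2 - 1)\<^sup>2)"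
    unfolding eq by (intro Bochner_Integration.integrable_add Bochner_Integration.integrable_diff integrable_mult_right I) simp
  have "(\<integral>x. (x\<^sup>2 - 1)\<^sup>2 \<partial>std_normal_distribution) = (\<integral>x. x ^ 4 - 2 * x\<^sup>2 \<partial>std_normal_distribution) + (\<integral>x. 1 \<partial>std_normal_distribution)"
    unfolding eq by (intro Bochner_Integration.integral_add Bochner_Integration.integrable_diff integrable_mult_right I) simp
  also have "(\<integral>x. x ^ 4 - 2 * x\<^sup>2 \<partial>std_normal_distribution) = (\<integral>x. x ^ 4 \<partial>std_normal_distribution) - (\<integral>x. 2 * x\<^sup>2 \<partial>std_normal_distribution)"
    by (intro Bochner_Integration.integral_diff integrable_mult_right I)
  finally show "(\<integral>x. (x\<^sup>2 - 1)\<^sup>2 \<partial>std_normal_distribution) = 2" using m2 m4 prob_space by simp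
  have "integrable std_normal_distribution (\<lambda>x. x ^ 6 + 3 * x ^ 4 + 3 * x\<^sup>2 + 1 :: real)"
    by (intro Bochner_Integration.integrable_add integrable_mult_right I) simp
  then show "integrable std_normal_distribution (\<lambda>x. \<bar>x\<^sup>2 - 1\<bar> ^ 3)"
  proof (rule Bochner_Integration.integrable_bound)
    show "AE x in std_normal_distribution. norm (\<bar>x\<^sup>2 - 1\<bar> ^ 3) \<le> norm (x ^ 6 + 3 * x ^ 4 + 3 * x\<^sup>2 + 1)"
    proof (rule AE_I2)
      fix x :: real
      have "\<bar>x\<^sup>2 - 1\<bar> \<le> x\<^sup>2 + 1" by (smt (verit) zero_le_power2)
      then have "\<bar>x\<^sup>2 - 1\<bar> ^ 3 \<le> (x\<^sup>2 + 1) ^ 3" by (intro power_mono) auto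
      also have "\<dots> = x ^ 6 + 3 * x ^ 4 + 3 * x\<^sup>2 + 1" by algebra
      finally show "norm (\<bar>x\<^sup>2 - 1\<bar> ^ 3) \<le> norm (x ^ 6 + 3 * x ^ 4 + 3 * x\<^sup>2 + 1)"
        by (simp add: power_abs)
    qed
  qed measurable
qed

text \<open>Taylor expansion for mean 0 and variance 2, hence quadratic term u^2; the third absolute
  moment controls the remainder.\<close>

lemma psi_approx: "\<exists>K\<ge>0. \<forall>u. cmod (psi u - (1 - complex_of_real (u\<^sup>2))) \<le> K * \<bar>u\<bar> ^ 3"
proof -
  interpret prob_space std_normal_distribution by (rule prob_space_std_normal)
  define K where "K = expectation (\<lambda>x. \<bar>x\<^sup>2 - 1\<bar> ^ 3) / 6"
  have K: "K \<ge> 0" by (simp add: K_def)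
  have "cmod (psi u - (1 - complex_of_real (u\<^sup>2))) \<le> K * \<bar>u\<bar> ^ 3" for u
  proof -
    have "variance (\<lambda>x. x\<^sup>2 - 1) = 2" using std_normal_moments(2,4) by simp
    then have "cmod (psi u - (1 - u\<^sup>2 * 2 / 2)) \<le> (u\<^sup>2 / 6) * expectation (\<lambda>x. min (6 * (x\<^sup>2 - 1)\<^sup>2) (\<bar>u\<bar> * \<bar>x\<^sup>2 - 1\<bar> ^ 3))"
      unfolding psi_def using std_normal_moments by (intro char_approx3') auto
    also have "\<dots> \<le> (u\<^sup>2 / 6) * expectation (\<lambda>x. \<bar>u\<bar> * \<bar>x\<^sup>2 - 1\<bar> ^ 3)"
    proof (intro mult_left_mono integral_mono)
      show "integrable std_normal_distribution (\<lambda>x. \<bar>u\<bar> * \<bar>x\<^sup>2 - 1\<bar> ^ 3)"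
        by (intro integrable_mult_right std_normal_moments)
      show "integrable std_normal_distribution (\<lambda>x. min (6 * (x\<^sup>2 - 1)\<^sup>2) (\<bar>u\<bar> * \<bar>x\<^sup>2 - 1\<bar> ^ 3))"
        by (intro Bochner_Integration.integrable_min integrable_mult_right std_normal_moments)
    qed auto
    also have "\<dots> = K * \<bar>u\<bar> ^ 3" by (simp add: K_def power3_eq_cube power2_eq_square abs_mult[symmetric])
    finally show ?thesis by simp
  qed
  with K show ?thesis by blast
qed

lemma psi_0 [simp]: "psi 0 = 1"
proof -
  interpret prob_space std_normal_distribution by (rule prob_space_std_normal)
  show ?thesis using prob_space by (simp add: psi_eq)
qed

lemma cmod_psi_le_1: "cmod (psi u) \<le> 1"
  unfolding psi_def
  by (intro real_distribution.cmod_char_le_1 prob_space.real_distribution_distr prob_space_std_normal) simp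

lemma char_diag_law:
  "char (distr (std_gauss m) borel (\<lambda>x. \<Sum>i<m. d i * ((x i)\<^sup>2 - 1))) t = (\<Prod>i<m. psi (t * d i))"
proof -
  interpret N: prob_space std_normal_distribution by (rule prob_space_std_normal)
  interpret product_sigma_finite "\<lambda>_::nat. std_normal_distribution" by unfold_locales
  interpret G: prob_space "std_gauss m" by (rule prob_space_std_gauss)
  have "(\<lambda>x. \<Sum>i<m. d i * ((x i)\<^sup>2 - 1)) \<in> borel_measurable (std_gauss m)"
    by (intro borel_measurable_sum borel_measurable_times borel_measurable_diff borel_measurable_power std_gauss_component) auto
  then have "char (distr (std_gauss m) borel (\<lambda>x. \<Sum>i<m. d i * ((x i)\<^sup>2 - 1))) t = (\<integral>x. iexp (t * (\<Sum>i<m. d i * ((x i)\<^sup>2 - 1))) \<partial>std_gauss m)"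
    by (rule G.char_distr)
  also have "\<dots> = (\<integral>x. (\<Prod>i<m. iexp (t * d i * ((x i)\<^sup>2 - 1))) \<partial>std_gauss m)"
    by (simp add: exp_sum[symmetric] sum_distrib_left mult_ac)
  also have "\<dots> = (\<Prod>i<m. \<integral>x. iexp (t * d i * (x\<^sup>2 - 1)) \<partial>std_normal_distribution)"
    by (rule product_integral_prod) (auto intro!: N.integrable_const_bound[where B=1])
  finally show ?thesis by (simp add: psi_eq)
qed

lemma diag_law_second_moment:
  "integrable (std_gauss m) (\<lambda>x. (\<Sum>i<m. d i * ((x i)\<^sup>2 - 1))\<^sup>2)"
  "(\<integral>x. (\<Sum>i<m. d i * ((x i)\<^sup>2 - 1))\<^sup>2 \<partial>std_gauss m) = 2 * (\<Sum>i<m. (d i)\<^sup>2)"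
proof -
  interpret N: prob_space std_normal_distribution by (rule prob_space_std_normal)
  interpret product_sigma_finite "\<lambda>_::nat. std_normal_distribution" by unfold_locales
  define z where "z x = x\<^sup>2 - 1" for x :: real
  \<comment> \<open>Each z(x_i) z(x_j) becomes a product over all coordinates with factors z^2, z or
    1, so that its integral factors for i = j and i \<noteq> j alike.\<close>
  define g where "g i j k = (\<lambda>x. (if k = i then z x else 1) * (if k = j then z x else 1))" for i j k :: nat
  have gi: "integrable std_normal_distribution (g i j k)" for i j k
    using std_normal_moments by (cases "k = i"; cases "k = j") (auto simp: g_def z_def power2_eq_square)
  have gint: "integral\<^sup>L std_normal_distribution (g i j k) = (if k = i \<and> k = j then 2 else if k = i \<or> k = j then 0 else 1)" for i j k
    using std_normal_moments(2,4) N.prob_space by (cases "k = i"; cases "k = j") (auto simp: g_def z_def power2_eq_square)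
  have gprod: "(\<Prod>k<m. g i j k (x k)) = z (x i) * z (x j)" if "i < m" "j < m" for i j x
    using that by (simp add: g_def prod.distrib)
  have ij: "integrable (std_gauss m) (\<lambda>x. z (x i) * z (x j)) \<and> (\<integral>x. z (x i) * z (x j) \<partial>std_gauss m) = (if i = j then 2 else 0)"
    if "i < m" "j < m" for i j
  proof
    show "integrable (std_gauss m) (\<lambda>x. z (x i) * z (x j))"
      using product_integrable_prod[of "{..<m}" "g i j"] gi gprod[OF that] by simp
    have "(\<integral>x. z (x i) * z (x j) \<partial>std_gauss m) = (\<Prod>k<m. integral\<^sup>L std_normal_distribution (g i j k))"
      using product_integral_prod[of "{..<m}" "g i j"] gi gprod[OF that] by simp
    also have "\<dots> = (if i = j then 2 else 0)"
    proof (cases "i = j")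
      case True
      then have "(\<Prod>k<m. integral\<^sup>L std_normal_distribution (g i j k)) = (\<Prod>k<m. if k = i then 2 else 1)"
        by (intro prod.cong refl) (simp add: gint)
      then show ?thesis using that True by simp
    next
      case False
      then have "integral\<^sup>L std_normal_distribution (g i j i) = 0" by (simp add: gint)
      then show ?thesis using False that by (auto intro!: prod_zero)
    qed
    finally show "(\<integral>x. z (x i) * z (x j) \<partial>std_gauss m) = (if i = j then 2 else 0)" .
  qed
  have eq: "(\<Sum>i<m. d i * ((x i)\<^sup>2 - 1))\<^sup>2 = (\<Sum>i<m. \<Sum>j<m. (d i * d j) * (z (x i) * z (x j)))" for x
    by (simp add: power2_eq_square[of "sum _ _"] sum_product z_def mult_ac)
  show "integrable (std_gauss m) (\<lambda>x. (\<Sum>i<m. d i * ((x i)\<^sup>2 - 1))\<^sup>2)"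
    unfolding eq using ij by (intro Bochner_Integration.integrable_sum integrable_mult_right) auto
  have "(\<integral>x. (\<Sum>i<m. d i * ((x i)\<^sup>2 - 1))\<^sup>2 \<partial>std_gauss m) = (\<Sum>i<m. \<Sum>j<m. (d i * d j) * (\<integral>x. z (x i) * z (x j) \<partial>std_gauss m))"
  proof -
    have "(\<integral>x. (\<Sum>i<m. \<Sum>j<m. (d i * d j) * (z (x i) * z (x j))) \<partial>std_gauss m) = (\<Sum>i<m. \<integral>x. (\<Sum>j<m. (d i * d j) * (z (x i) * z (x j))) \<partial>std_gauss m)"
      using ij by (intro Bochner_Integration.integral_sum Bochner_Integration.integrable_sum integrable_mult_right) auto
    also have "\<dots> = (\<Sum>i<m. \<Sum>j<m. \<integral>x. (d i * d j) * (z (x i) * z (x j)) \<partial>std_gauss m)"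
      using ij by (intro sum.cong refl Bochner_Integration.integral_sum integrable_mult_right) auto
    finally show ?thesis unfolding eq by simp
  qed
  also have "\<dots> = (\<Sum>i<m. \<Sum>j<m. if j = i then 2 * (d i)\<^sup>2 else 0)"
    using ij by (intro sum.cong) (auto simp: power2_eq_square)
  also have "\<dots> = 2 * (\<Sum>i<m. (d i)\<^sup>2)" by (simp add: sum_distrib_left)
  finally show "(\<integral>x. (\<Sum>i<m. d i * ((x i)\<^sup>2 - 1))\<^sup>2 \<partial>std_gauss m) = 2 * (\<Sum>i<m. (d i)\<^sup>2)" .
qed

section \<open>Limits of characteristic functions of quadratic forms\<close>

text \<open>Both functions equal 1 - u^2 up to O(|u|^3) near 0. For |u| > 1 the trivial bound 2 is
  absorbed by 2 |u|^3, whence the constant \<open>K + 2\<close>.\<close>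

lemma psi_exp_approx: "\<exists>K\<ge>0. \<forall>u. cmod (psi u - complex_of_real (exp (- u\<^sup>2))) \<le> K * \<bar>u\<bar> ^ 3"
proof -
  from psi_approx obtain K where K: "K \<ge> 0" "\<And>u. cmod (psi u - (1 - complex_of_real (u\<^sup>2))) \<le> K * \<bar>u\<bar> ^ 3" by blast
  have e: "\<bar>exp (- x) - (1 - x)\<bar> \<le> x\<^sup>2" if "x \<ge> 0" for x :: real
  proof -
    have "1 - x \<le> exp (- x)" using exp_ge_add_one_self[of "- x"] by simp
    moreover have "exp (- x) \<le> 1 / (1 + x)"
      using exp_ge_add_one_self[of x] that by (simp add: exp_minus field_simps)
    moreover have "1 / (1 + x) - (1 - x) \<le> x\<^sup>2"
    proof -
      have "1 / (1 + x) - (1 - x) = x\<^sup>2 / (1 + x)" using that by (simp add: field_simps power2_eq_square)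
      also have "\<dots> \<le> x\<^sup>2" using that by (simp add: divide_le_eq mult_le_cancel_left1)
      finally show ?thesis .
    qed
    ultimately show ?thesis by linarith
  qed
  have "cmod (psi u - complex_of_real (exp (- u\<^sup>2))) \<le> (K + 2) * \<bar>u\<bar> ^ 3" for u
  proof (cases "\<bar>u\<bar> \<le> 1")
    case True
    have "cmod (psi u - complex_of_real (exp (- u\<^sup>2))) \<le> cmod (psi u - (1 - complex_of_real (u\<^sup>2))) + cmod (complex_of_real ((1 - u\<^sup>2) - exp (- u\<^sup>2)))"
      by (rule order_trans[OF _ norm_triangle_ineq]) simp
    also have "\<dots> \<le> K * \<bar>u\<bar> ^ 3 + (u\<^sup>2)\<^sup>2"
      using K(2)[of u] e[of "u\<^sup>2"] unfolding norm_of_real by (intro add_mono) (auto simp: abs_minus_commute)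
    also have "(u\<^sup>2)\<^sup>2 = \<bar>u\<bar> ^ 3 * \<bar>u\<bar>" by (simp add: power2_eq_square power3_eq_cube flip: abs_mult)
    also have "\<bar>u\<bar> ^ 3 * \<bar>u\<bar> \<le> 2 * \<bar>u\<bar> ^ 3" using True mult_left_le[of "\<bar>u\<bar>" "\<bar>u\<bar> ^ 3"] by (smt (verit) zero_le_power abs_ge_zero)
    finally show ?thesis by (simp add: algebra_simps)
  next
    case False
    then have "1 \<le> \<bar>u\<bar> ^ 3" by (intro one_le_power) simp
    have "cmod (psi u - complex_of_real (exp (- u\<^sup>2))) \<le> cmod (psi u) + cmod (complex_of_real (exp (- u\<^sup>2)))"
      by (rule norm_triangle_ineq4)
    also have "\<dots> \<le> 1 + 1" by (intro add_mono cmod_psi_le_1) simp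
    also have "\<dots> \<le> (K + 2) * 1" using K by simp
    also have "\<dots> \<le> (K + 2) * \<bar>u\<bar> ^ 3" using K \<open>1 \<le> \<bar>u\<bar> ^ 3\<close> by (intro mult_left_mono) auto
    finally show ?thesis .
  qed
  with K(1) show ?thesis by (intro exI[of _ "K + 2"]) auto
qed

lemma psi_decay: "\<exists>s>0. \<forall>u. \<bar>u\<bar> \<le> s \<longrightarrow> cmod (psi u) \<le> exp (- u\<^sup>2 / 2)"
proof -
  from psi_approx obtain K where K: "K \<ge> 0" "\<And>u. cmod (psi u - (1 - complex_of_real (u\<^sup>2))) \<le> K * \<bar>u\<bar> ^ 3" by blast
  \<comment> \<open>Makes the cubic error K |u|^3 at most u^2 / 2, half of the quadratic
    gain.\<close>
  define s where "s = min 1 (1 / (2 * (K + 1)))"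
  have s: "s > 0" "s \<le> 1" "K * s \<le> 1 / 2"
  proof -
    show "s > 0" "s \<le> 1" using K by (auto simp: s_def)
    have "K * s \<le> (K + 1) * (1 / (2 * (K + 1)))" using K \<open>s > 0\<close> by (intro mult_mono) (auto simp: s_def)
    also have "\<dots> = 1 / 2" using K by simp
    finally show "K * s \<le> 1 / 2" .
  qed
  have "cmod (psi u) \<le> exp (- u\<^sup>2 / 2)" if u: "\<bar>u\<bar> \<le> s" for u
  proof -
    have u1: "u\<^sup>2 \<le> 1" using u s abs_le_square_iff[of u 1] by simp
    have "cmod (psi u) \<le> cmod (psi u - (1 - complex_of_real (u\<^sup>2))) + cmod (complex_of_real (1 - u\<^sup>2))"
      by (rule order_trans[OF _ norm_triangle_ineq]) simp
    also have "\<dots> \<le> K * \<bar>u\<bar> ^ 3 + (1 - u\<^sup>2)"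
      using K(2)[of u] u1 unfolding norm_of_real by (intro add_mono) auto
    also have "K * \<bar>u\<bar> ^ 3 = (K * \<bar>u\<bar>) * u\<^sup>2" by (simp add: power3_eq_cube power2_eq_square)
    also have "\<dots> \<le> (K * s) * u\<^sup>2" using u K by (intro mult_right_mono mult_left_mono) auto
    also have "\<dots> \<le> (1 / 2) * u\<^sup>2" using s by (intro mult_right_mono) auto
    finally have "cmod (psi u) \<le> 1 + (- u\<^sup>2 / 2)" by simp
    also have "\<dots> \<le> exp (- u\<^sup>2 / 2)" by (rule exp_ge_add_one_self)
    finally show ?thesis .
  qed
  with s show ?thesis by blast
qed

text \<open>The characteristic function and the sum of squares are symmetric in the coefficients, so
  sorting by modulus is harmless. Padding by zeros lets arrays of different lengths be compared
  index by index; it adds only factors \<open>psi 0 = 1\<close>.\<close>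

lemma sorted_rearrangement:
  fixes d :: "nat \<Rightarrow> real"
  shows "\<exists>e. (\<forall>i\<ge>m. e i = 0) \<and> (\<forall>i j. i \<le> j \<longrightarrow> \<bar>e j\<bar> \<le> \<bar>e i\<bar>) \<and>
    (\<forall>g :: real \<Rightarrow> complex. (\<Prod>i<m. g (e i)) = (\<Prod>i<m. g (d i))) \<and> (\<Sum>i<m. (e i)\<^sup>2) = (\<Sum>i<m. (d i)\<^sup>2)"
proof -
  define xs where "xs = sort_key (\<lambda>x. - \<bar>x\<bar>) (map d [0..<m])"
  define e where "e i = (if i < m then xs ! i else 0)" for i
  have len: "length xs = m" by (simp add: xs_def)
  have mset: "mset xs = mset (map d [0..<m])" by (simp add: xs_def)
  have "sorted (map (\<lambda>x. - \<bar>x\<bar>) xs)" by (simp add: xs_def)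
  then have srt: "\<bar>xs ! j\<bar> \<le> \<bar>xs ! i\<bar>" if "i \<le> j" "j < m" for i j
    using that len sorted_nth_mono[of "map (\<lambda>x. - \<bar>x\<bar>) xs" i j] by simp
  have pr: "(\<Prod>i<m. g (e i)) = (\<Prod>i<m. g (d i))" for g :: "real \<Rightarrow> complex"
  proof -
    have "(\<Prod>i<m. g (e i)) = prod_list (map g xs)"
      using len by (subst prod.list_conv_set_nth) (auto intro!: prod.cong simp: e_def atLeast0LessThan)
    also have "\<dots> = prod_mset (image_mset g (mset xs))" by (simp add: prod_mset_prod_list[symmetric])
    also have "\<dots> = prod_list (map g (map d [0..<m]))" unfolding mset by (simp add: prod_mset_prod_list[symmetric] multiset.map_comp)
    also have "\<dots> = (\<Prod>i<m. g (d i))" by (subst prod.list_conv_set_nth) (auto intro!: prod.cong simp: atLeast0LessThan)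
    finally show ?thesis .
  qed
  have "(\<Sum>i<m. (e i)\<^sup>2) = sum_list (map (\<lambda>x. x\<^sup>2) xs)"
    using len by (subst sum.list_conv_set_nth) (auto intro!: sum.cong simp: e_def atLeast0LessThan)
  also have "\<dots> = sum_mset (image_mset (\<lambda>x. x\<^sup>2) (mset xs))" by (simp add: sum_mset_sum_list[symmetric])
  also have "\<dots> = sum_list (map (\<lambda>x. x\<^sup>2) (map d [0..<m]))" unfolding mset by (simp add: sum_mset_sum_list[symmetric] multiset.map_comp)
  also have "\<dots> = (\<Sum>i<m. (d i)\<^sup>2)" by (subst sum.list_conv_set_nth) (auto intro!: sum.cong simp: atLeast0LessThan)
  finally have sq: "(\<Sum>i<m. (e i)\<^sup>2) = (\<Sum>i<m. (d i)\<^sup>2)" .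
  show ?thesis
  proof (intro exI[of _ e] conjI allI impI)
    fix i j :: nat assume "i \<le> j"
    then show "\<bar>e j\<bar> \<le> \<bar>e i\<bar>" using srt[of i j] by (auto simp: e_def)
  qed (use pr sq in \<open>auto simp: e_def\<close>)
qed

text \<open>If the sums of squares were unbounded, a rescaling with frequencies tending to 0 would
  contradict the hypothesis. That hypothesis is tightness in the form in which it is used:
  convergence to 1 at vanishing frequencies, along any indices tending to infinity.\<close>

lemma square_sum_bounded_of_tight:
  fixes m :: "nat \<Rightarrow> nat" and d :: "nat \<Rightarrow> nat \<Rightarrow> real"
  assumes tight: "\<And>r t. filterlim r at_top sequentially \<Longrightarrow> t \<longlonglongrightarrow> 0 \<Longrightarrow>
    (\<lambda>n. \<Prod>i<m (r n). psi (t n * d (r n) i)) \<longlonglongrightarrow> 1"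
  shows "\<exists>B>0. \<forall>n. (\<Sum>i<m n. (d n i)\<^sup>2) \<le> B"
proof (rule ccontr)
  define V where "V n = (\<Sum>i<m n. (d n i)\<^sup>2)" for n
  assume "\<not> ?thesis"
  then have unb: "\<exists>n. V n > B" if "B > 0" for B using that unfolding V_def by (meson not_le)
  have "\<exists>n\<ge>k. V n > real (Suc k)" for k
  proof (rule ccontr)
    assume *: "\<not> ?thesis"
    \<comment> \<open>Exceeding the sum of the first k values forces the index to be at least
      k.\<close>
    obtain n where n: "V n > real (Suc k) + (\<Sum>j<k. V j)"
      using unb[of "real (Suc k) + (\<Sum>j<k. V j)"] by (auto simp: V_def sum_nonneg add_pos_nonneg)
    have "n < k" using * n by (smt (verit) V_def not_le sum_nonneg zero_le_power2)
    then have "V n \<le> (\<Sum>j<k. V j)" by (intro member_le_sum) (auto simp: V_def sum_nonneg)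
    with n show False by simp
  qed
  then obtain r where r: "\<And>k. r k \<ge> k" "\<And>k. V (r k) > real (Suc k)" by metis
  from psi_decay obtain s where s: "s > 0" "\<And>u. \<bar>u\<bar> \<le> s \<Longrightarrow> cmod (psi u) \<le> exp (- u\<^sup>2 / 2)" by blast
  \<comment> \<open>At this scale the total variance is \<open>s\<^sup>2\<close>, so the characteristic functions stay away from \<open>1\<close>.\<close>
  define t where "t k = s / sqrt (V (r k))" for k
  have Vpos: "V (r k) > 0" for k using r(2)[of k] by linarith
  have "filterlim r at_top sequentially"
    using r(1) by (intro filterlim_at_top_mono[OF filterlim_ident]) auto
  moreover have "t \<longlonglongrightarrow> 0"
  proof (rule tendsto_sandwich[of "\<lambda>_. 0" _ _ "\<lambda>k. s / sqrt (real (Suc k))"])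
    show "\<forall>\<^sub>F k in sequentially. 0 \<le> t k" 
    proof (rule always_eventually, rule allI)
      show "0 \<le> t k" for k using s(1) Vpos[of k] by (simp add: t_def)
    qed
    show "\<forall>\<^sub>F k in sequentially. t k \<le> s / sqrt (real (Suc k))"
    proof (rule always_eventually, rule allI)
      fix k
      show "t k \<le> s / sqrt (real (Suc k))"
        unfolding t_def using s r(2)[of k] by (intro divide_left_mono real_sqrt_le_mono mult_pos_pos) auto
    qed
    show "(\<lambda>k. s / sqrt (real (Suc k))) \<longlonglongrightarrow> 0"
      by (intro real_tendsto_divide_at_top[OF tendsto_const] filterlim_compose[OF sqrt_at_top] filterlim_compose[OF filterlim_real_sequentially filterlim_Suc])
  qed simp
  ultimately have lim: "(\<lambda>n. \<Prod>i<m (r n). psi (t n * d (r n) i)) \<longlonglongrightarrow> 1" by (rule tight)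
  have "cmod (\<Prod>i<m (r n). psi (t n * d (r n) i)) \<le> exp (- s\<^sup>2 / 2)" for n
  proof -
    \<comment> \<open>No single coefficient exceeds the square root of the total, so all arguments
      lie in the range of the decay bound.\<close>
    have small: "\<bar>t n * d (r n) i\<bar> \<le> s" if "i < m (r n)" for i
    proof -
      have "(d (r n) i)\<^sup>2 \<le> V (r n)" unfolding V_def using that by (intro member_le_sum) auto
      then have "\<bar>d (r n) i\<bar> \<le> sqrt (V (r n))" using real_sqrt_le_mono by fastforce
      then show ?thesis using s Vpos[of n] by (simp add: t_def abs_mult field_simps)
    qed
    have "cmod (\<Prod>i<m (r n). psi (t n * d (r n) i)) = (\<Prod>i<m (r n). cmod (psi (t n * d (r n) i)))"
      by (rule prod_norm[symmetric])
    also have "\<dots> \<le> (\<Prod>i<m (r n). exp (- (t n * d (r n) i)\<^sup>2 / 2))"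
      using small s(2) by (intro prod_mono) auto
    also have "\<dots> = exp (- ((t n)\<^sup>2 * V (r n)) / 2)"
      by (simp add: exp_sum[symmetric] V_def sum_distrib_left power_mult_distrib sum_divide_distrib sum_negf)
    also have "(t n)\<^sup>2 * V (r n) = s\<^sup>2" using Vpos[of n] by (simp add: t_def power_divide)
    finally show ?thesis .
  qed
  then have "cmod 1 \<le> exp (- s\<^sup>2 / 2)"
    by (intro LIMSEQ_le_const2[OF tendsto_norm[OF lim]]) auto
  with s(1) show False by simp
qed

text \<open>For fixed K the first K factors converge termwise, while the tail is replaced by the
  Gaussian factor with the same sum of squares, at an error \<open>\<epsilon> t K\<close> that does
  not depend on n. Letting n and then K tend to infinity identifies the limit.\<close>

theorem quadratic_char_limit:
  fixes m :: "nat \<Rightarrow> nat" and d :: "nat \<Rightarrow> nat \<Rightarrow> real" and \<phi> :: "real \<Rightarrow> complex"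
  assumes conv: "\<And>t. (\<lambda>n. \<Prod>i<m n. psi (t * d n i)) \<longlonglongrightarrow> \<phi> t"
    and tight: "\<And>r t. filterlim r at_top sequentially \<Longrightarrow> t \<longlonglongrightarrow> 0 \<Longrightarrow>
      (\<lambda>n. \<Prod>i<m (r n). psi (t n * d (r n) i)) \<longlonglongrightarrow> 1"
  shows "\<exists>\<rho>\<ge>0. \<exists>\<mu>. summable (\<lambda>k. (\<mu> k)\<^sup>2) \<and>
    (\<forall>t. (\<lambda>K. (\<Prod>k<K. psi (t * \<mu> k)) * complex_of_real (exp (- \<rho> * t\<^sup>2))) \<longlonglongrightarrow> \<phi> t)"
proof -
  from square_sum_bounded_of_tight[of d m] tight obtain B where
    B: "B > 0" "\<And>n. (\<Sum>i<m n. (d n i)\<^sup>2) \<le> B" by blast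
  have "\<exists>e. (\<forall>i\<ge>m n. e i = 0) \<and> (\<forall>i j. i \<le> j \<longrightarrow> \<bar>e j\<bar> \<le> \<bar>e i\<bar>) \<and>
    (\<forall>g :: real \<Rightarrow> complex. (\<Prod>i<m n. g (e i)) = (\<Prod>i<m n. g (d n i))) \<and> (\<Sum>i<m n. (e i)\<^sup>2) = (\<Sum>i<m n. (d n i)\<^sup>2)" for n
    by (rule sorted_rearrangement)
  then obtain e where e0: "\<And>n i. i \<ge> m n \<Longrightarrow> e n i = 0" and mono: "\<And>n i j. i \<le> j \<Longrightarrow> \<bar>e n j\<bar> \<le> \<bar>e n i\<bar>"
    and pr: "\<And>n (g :: real \<Rightarrow> complex). (\<Prod>i<m n. g (e n i)) = (\<Prod>i<m n. g (d n i))"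
    and sq: "\<And>n. (\<Sum>i<m n. (e n i)\<^sup>2) = (\<Sum>i<m n. (d n i)\<^sup>2)" by metis
  define V where "V n = (\<Sum>i<m n. (e n i)\<^sup>2)" for n
  have V0: "V n \<ge> 0" and VB: "V n \<le> B" for n using B(2) sq by (auto simp: V_def sum_nonneg)
  have Vext: "V n = (\<Sum>i<N. (e n i)\<^sup>2)" if "m n \<le> N" for n N
    unfolding V_def using that e0 by (intro sum.mono_neutral_left) auto
  have part: "(\<Sum>i<K. (e n i)\<^sup>2) \<le> V n" for n K
    using Vext[of n "max (m n) K"] sum_mono2[of "{..<max (m n) K}" "{..<K}" "\<lambda>i. (e n i)\<^sup>2"] by auto
  \<comment> \<open>In decreasing order, k + 1 copies of the square at index k are dominated by the
    sum of squares.\<close>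
  have dec: "real (Suc k) * (e n k)\<^sup>2 \<le> B" for n k
  proof -
    have "real (Suc k) * (e n k)\<^sup>2 = (\<Sum>i<Suc k. (e n k)\<^sup>2)" by simp
    also have "\<dots> \<le> (\<Sum>i<Suc k. (e n i)\<^sup>2)" by (intro sum_mono) (auto simp: abs_le_square_iff[symmetric] mono)
    also have "\<dots> \<le> B" using part VB order_trans by blast
    finally show ?thesis .
  qed
  have ebd: "\<bar>e n k\<bar> \<le> sqrt (B / real (Suc k))" for n k
  proof -
    have "(e n k)\<^sup>2 \<le> B / real (Suc k)" using dec[of k n] by (simp add: field_simps)
    then have "sqrt ((e n k)\<^sup>2) \<le> sqrt (B / real (Suc k))" by (intro real_sqrt_le_mono)
    then show ?thesis by simp
  qed
  \<comment> \<open>Index 0 carries the sum of squares and index k + 1 the coefficient k, so that a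
    single extraction handles both.\<close>
  define X where "X n = (\<lambda>j. case j of 0 \<Rightarrow> V n | Suc k \<Rightarrow> e n k)" for n
  have "\<bar>X n j\<bar> \<le> (case j of 0 \<Rightarrow> B | Suc k \<Rightarrow> sqrt (B / real (Suc k)))" for n j
    using V0 VB ebd by (auto simp: X_def split: nat.split)
  from countable_diagonal_subsequence[of X, OF this] obtain r l where
    r: "strict_mono (r :: nat \<Rightarrow> nat)" and l: "\<And>j. (\<lambda>n. X (r n) j) \<longlonglongrightarrow> l j" by blast
  define v \<mu> where "v = l 0" and "\<mu> k = l (Suc k)" for k
  have limV: "(\<lambda>n. V (r n)) \<longlonglongrightarrow> v" using l[of 0] by (simp add: X_def v_def)
  have lime: "(\<lambda>n. e (r n) k) \<longlonglongrightarrow> \<mu> k" for k using l[of "Suc k"] by (simp add: X_def \<mu>_def)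
  have mupart: "(\<Sum>k<K. (\<mu> k)\<^sup>2) \<le> v" for K
  proof (rule LIMSEQ_le)
    show "(\<lambda>n. \<Sum>k<K. (e (r n) k)\<^sup>2) \<longlonglongrightarrow> (\<Sum>k<K. (\<mu> k)\<^sup>2)" by (intro tendsto_intros lime)
    show "(\<lambda>n. V (r n)) \<longlonglongrightarrow> v" by (rule limV)
  qed (use part in auto)
  have summ: "summable (\<lambda>k. (\<mu> k)\<^sup>2)" using mupart by (intro summableI_nonneg_bounded) auto
  \<comment> \<open>The lost mass is nonnegative by \<open>mupart\<close>, a Fatou inequality for
    the squared coefficients.\<close>
  define \<rho> where "\<rho> = v - (\<Sum>k. (\<mu> k)\<^sup>2)"
  have \<rho>: "\<rho> \<ge> 0" using suminf_le_const[OF summ mupart] by (simp add: \<rho>_def)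
  from psi_exp_approx obtain C where C: "C \<ge> 0" "\<And>u. cmod (psi u - complex_of_real (exp (- u\<^sup>2))) \<le> C * \<bar>u\<bar> ^ 3" by blast
  \<comment> \<open>Total cubic error of the tail: one power of each coefficient is bounded by the
    decay at K, and the remaining squares sum to at most \<open>B\<close>.\<close>
  define \<epsilon> where "\<epsilon> t K = C * \<bar>t\<bar> ^ 3 * sqrt (B / real (Suc K)) * B" for t :: real and K
  have fin: "cmod ((\<Prod>i<m n. psi (t * d n i)) - (\<Prod>i<K. psi (t * e n i)) * complex_of_real (exp (- (t\<^sup>2 * (V n - (\<Sum>i<K. (e n i)\<^sup>2))))))
     \<le> \<epsilon> t K" for n t K
  proof -
    define N where "N = max (m n) K"
    \<comment> \<open>Hybrid product with exact factors below K and Gaussian ones from K on. All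
      factors have modulus at most 1, so the two products differ by at most the sum of the
      differences of their factors.\<close>
    define w where "w i = (if i < K then psi (t * e n i) else complex_of_real (exp (- (t * e n i)\<^sup>2)))" for i
    have un: "{..<N} = {..<K} \<union> {K..<N}" by (auto simp: N_def)
    have P: "(\<Prod>i<m n. psi (t * d n i)) = (\<Prod>i<N. psi (t * e n i))"
    proof -
      have "(\<Prod>i<m n. psi (t * d n i)) = (\<Prod>i<m n. psi (t * e n i))" using pr[of "\<lambda>x. psi (t * x)" n] by simp
      also have "\<dots> = (\<Prod>i<N. psi (t * e n i))" using e0 by (intro prod.mono_neutral_left) (auto simp: N_def)
      finally show ?thesis .
    qed
    have "V n = (\<Sum>i<K. (e n i)\<^sup>2) + (\<Sum>i=K..<N. (e n i)\<^sup>2)"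
      unfolding Vext[of n N, unfolded N_def[symmetric], OF max.cobounded1[of "m n" K, folded N_def]] un by (intro sum.union_disjoint) auto
    then have tail: "V n - (\<Sum>i<K. (e n i)\<^sup>2) = (\<Sum>i=K..<N. (e n i)\<^sup>2)" by simp
    have W: "(\<Prod>i<N. w i) = (\<Prod>i<K. psi (t * e n i)) * complex_of_real (exp (- (t\<^sup>2 * (V n - (\<Sum>i<K. (e n i)\<^sup>2)))))"
    proof -
      have "(\<Prod>i<N. w i) = (\<Prod>i<K. w i) * (\<Prod>i=K..<N. w i)" unfolding un by (intro prod.union_disjoint) auto
      also have "(\<Prod>i=K..<N. w i) = complex_of_real (\<Prod>i=K..<N. exp (- (t * e n i)\<^sup>2))" by (simp add: w_def)
      also have "(\<Prod>i=K..<N. exp (- (t * e n i)\<^sup>2)) = exp (- (t\<^sup>2 * (\<Sum>i=K..<N. (e n i)\<^sup>2)))"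
        by (simp add: exp_sum[symmetric] sum_distrib_left power_mult_distrib sum_negf)
      finally show ?thesis unfolding tail by (simp add: w_def)
    qed
    have "cmod ((\<Prod>i<N. psi (t * e n i)) - (\<Prod>i<N. w i)) \<le> (\<Sum>i<N. cmod (psi (t * e n i) - w i))"
      by (intro norm_prod_diff) (auto simp: w_def cmod_psi_le_1)
    also have "\<dots> \<le> (\<Sum>i<N. C * \<bar>t\<bar> ^ 3 * sqrt (B / real (Suc K)) * (e n i)\<^sup>2)"
    proof (rule sum_mono)
      fix i
      show "cmod (psi (t * e n i) - w i) \<le> C * \<bar>t\<bar> ^ 3 * sqrt (B / real (Suc K)) * (e n i)\<^sup>2"
      proof (cases "i < K")
        case True
        then show ?thesis using C B by (simp add: w_def)
      next
        case False
        then have le: "\<bar>e n i\<bar> \<le> sqrt (B / real (Suc K))" using mono[of K i n] ebd[of n K] by simp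
        have "cmod (psi (t * e n i) - w i) \<le> C * \<bar>t * e n i\<bar> ^ 3" using False C(2) by (simp add: w_def)
        also have "\<bar>t * e n i\<bar> ^ 3 = \<bar>t\<bar> ^ 3 * (\<bar>e n i\<bar> * \<bar>e n i\<bar>\<^sup>2)"
          by (simp only: abs_mult power3_eq_cube power2_eq_square mult_ac)
        also have "C * (\<bar>t\<bar> ^ 3 * (\<bar>e n i\<bar> * \<bar>e n i\<bar>\<^sup>2)) = C * \<bar>t\<bar> ^ 3 * \<bar>e n i\<bar> * (e n i)\<^sup>2" by simp
        also have "\<dots> \<le> C * \<bar>t\<bar> ^ 3 * sqrt (B / real (Suc K)) * (e n i)\<^sup>2"
          using C le by (intro mult_right_mono mult_left_mono) auto
        finally show ?thesis .
      qed
    qed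
    also have "\<dots> = C * \<bar>t\<bar> ^ 3 * sqrt (B / real (Suc K)) * (\<Sum>i<N. (e n i)\<^sup>2)" by (simp add: sum_distrib_left)
    also have "\<dots> \<le> \<epsilon> t K" unfolding \<epsilon>_def using part[where K=N and n=n] VB[of n] C B by (intro mult_left_mono) auto
    finally show ?thesis unfolding P W .
  qed
  have lim1: "cmod (\<phi> t - (\<Prod>i<K. psi (t * \<mu> i)) * complex_of_real (exp (- (t\<^sup>2 * (v - (\<Sum>i<K. (\<mu> i)\<^sup>2)))))) \<le> \<epsilon> t K" for t K
  proof (rule LIMSEQ_le_const2)
    have psi_lim: "(\<lambda>n. psi (t * e (r n) i)) \<longlonglongrightarrow> psi (t * \<mu> i)" for i
    proof -
      have "isCont psi (t * \<mu> i)" unfolding psi_def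
        by (intro real_distribution.isCont_char prob_space.real_distribution_distr prob_space_std_normal) simp
      then show ?thesis by (rule isCont_tendsto_compose) (intro tendsto_intros lime)
    qed
    show "(\<lambda>n. cmod ((\<Prod>i<m (r n). psi (t * d (r n) i)) - (\<Prod>i<K. psi (t * e (r n) i)) * complex_of_real (exp (- (t\<^sup>2 * (V (r n) - (\<Sum>i<K. (e (r n) i)\<^sup>2)))))))
      \<longlonglongrightarrow> cmod (\<phi> t - (\<Prod>i<K. psi (t * \<mu> i)) * complex_of_real (exp (- (t\<^sup>2 * (v - (\<Sum>i<K. (\<mu> i)\<^sup>2))))))"
      using LIMSEQ_subseq_LIMSEQ[OF conv r, unfolded o_def]
      by (intro tendsto_norm tendsto_diff tendsto_mult tendsto_prod psi_lim tendsto_of_real tendsto_exp tendsto_minus tendsto_sum tendsto_power tendsto_const lime limV)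
  qed (use fin in auto)
  have "(\<lambda>K. (\<Prod>k<K. psi (t * \<mu> k)) * complex_of_real (exp (- \<rho> * t\<^sup>2))) \<longlonglongrightarrow> \<phi> t" for t
  proof -
    define a where "a K = (\<Prod>i<K. psi (t * \<mu> i)) * complex_of_real (exp (- (t\<^sup>2 * (v - (\<Sum>i<K. (\<mu> i)\<^sup>2)))))" for K
    \<comment> \<open>Correction factor that replaces the tail mass in the exponent of
      \<open>a K\<close> by its limit \<rho>; it tends to 1.\<close>
    define b where "b K = exp (t\<^sup>2 * (v - (\<Sum>i<K. (\<mu> i)\<^sup>2)) - \<rho> * t\<^sup>2)" for K
    have "(\<lambda>K. \<epsilon> t K) \<longlonglongrightarrow> C * \<bar>t\<bar> ^ 3 * sqrt 0 * B"
      unfolding \<epsilon>_def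
      by (intro tendsto_intros real_tendsto_divide_at_top[OF tendsto_const] filterlim_compose[OF filterlim_real_sequentially filterlim_Suc])
    then have "(\<lambda>K. \<epsilon> t K) \<longlonglongrightarrow> 0" by simp
    moreover have "\<forall>\<^sub>F K in sequentially. norm (\<phi> t - a K) \<le> \<epsilon> t K"
      using lim1[of t] by (simp add: a_def)
    ultimately have "(\<lambda>K. \<phi> t - a K) \<longlonglongrightarrow> 0" by (rule Lim_null_comparison[rotated])
    then have "(\<lambda>K. \<phi> t - (\<phi> t - a K)) \<longlonglongrightarrow> \<phi> t - 0" by (intro tendsto_intros)
    then have la: "a \<longlonglongrightarrow> \<phi> t" by simp
    have "b \<longlonglongrightarrow> exp (t\<^sup>2 * (v - (\<Sum>k. (\<mu> k)\<^sup>2)) - \<rho> * t\<^sup>2)"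
      unfolding b_def by (intro tendsto_intros summable_LIMSEQ summ)
    then have lb: "b \<longlonglongrightarrow> 1" by (simp add: \<rho>_def mult.commute)
    have "(\<lambda>K. a K * complex_of_real (b K)) \<longlonglongrightarrow> \<phi> t * complex_of_real 1" by (intro tendsto_intros la lb)
    moreover have "a K * complex_of_real (b K) = (\<Prod>k<K. psi (t * \<mu> k)) * complex_of_real (exp (- \<rho> * t\<^sup>2))" for K
      unfolding a_def b_def mult.assoc of_real_mult[symmetric] exp_add[symmetric] by simp
    ultimately show ?thesis by simp
  qed
  with \<rho> summ show ?thesis by blast
qed

section \<open>The half line and the quadrant\<close>

lemma space_half_line [simp]: "space half_line = {0..}"
  by (simp add: half_line_def space_restrict_space)

lemma sigma_finite_half_line: "sigma_finite_measure half_line"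
  unfolding half_line_def by (intro sigma_finite_measure_restrict_space) (auto intro: lborel.sigma_finite_measure_axioms)

lemma space_quadrant [simp]: "space quadrant = {0..} \<times> {0..}"
  by (simp add: quadrant_def space_pair_measure)

lemma pair_sigma_finite_half_line: "pair_sigma_finite half_line half_line"
  using sigma_finite_half_line by (simp add: pair_sigma_finite_def)

text \<open>Trace on the half line of the generator \<open>{..a}\<close> of the Borel sets; negative
  endpoints contribute the empty set.\<close>

lemma sets_half_line: "sets half_line = sigma_sets {0..} (range (\<lambda>t. {0..t}))"
proof -
  have "sets half_line = (\<inter>) {0..} ` sets (borel :: real measure)"
    by (simp add: half_line_def sets_restrict_space)
  also have "sets (borel :: real measure) = sigma_sets UNIV (range (\<lambda>a. {..a}))"
    by (subst borel_eq_atMost) simp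
  also have "(\<inter>) {0..} ` sigma_sets UNIV (range (\<lambda>a. {..a})) = sigma_sets {0..} ((\<inter>) {0..} ` range (\<lambda>a::real. {..a}))"
  proof (rule sigma_sets_Int)
    have "{0::real..} \<in> sets borel" by simp
    then show "{0::real..} \<in> sigma_sets UNIV (range (\<lambda>a. {..a}))" by (subst (asm) borel_eq_atMost) simp
  qed simp
  also have "(\<inter>) {0..} ` range (\<lambda>a::real. {..a}) = range (\<lambda>t. {0..t})"
    unfolding image_image by (intro image_cong) auto
  finally show ?thesis .
qed

lemma emeasure_half_line_Icc: "emeasure half_line {0..t} = ennreal t"
proof (cases "t \<ge> 0")
  case True
  then show ?thesis unfolding half_line_def by (subst emeasure_restrict_space) auto
next
  case False
  then show ?thesis by (simp add: ennreal_neg)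
qed

lemma Icc_half_line [measurable]: "{0..t} \<in> sets half_line"
  unfolding sets_half_line by auto

text \<open>The kernel whose Wiener integral is \<open>W t\<close>. The Gram matrix of these
  functions, min s t, is the covariance of Brownian motion.\<close>

definition time_ind :: "real \<Rightarrow> real \<Rightarrow> real" where
  "time_ind t = indicator {0..t}"

lemma integral_time_ind:
  "integrable half_line (\<lambda>x. time_ind s x * time_ind t x)"
  "0 \<le> s \<Longrightarrow> 0 \<le> t \<Longrightarrow> (\<integral>x. time_ind s x * time_ind t x \<partial>half_line) = min s t"
proof -
  have eq: "(\<lambda>x. time_ind s x * time_ind t x) = indicator {0..min s t}"
    by (auto simp: time_ind_def fun_eq_iff indicator_def)
  show "integrable half_line (\<lambda>x. time_ind s x * time_ind t x)"
    unfolding eq by (simp add: emeasure_half_line_Icc)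
  show "0 \<le> s \<Longrightarrow> 0 \<le> t \<Longrightarrow> (\<integral>x. time_ind s x * time_ind t x \<partial>half_line) = min s t"
    unfolding eq by (simp add: measure_def emeasure_half_line_Icc)
qed

lemma time_ind_L2: "time_ind t \<in> L2_fun half_line"
  using integral_time_ind(1)[of t t] unfolding L2_fun_def
  by (auto simp: power2_eq_square time_ind_def)

lemma tensor_L2:
  assumes "g \<in> L2_fun half_line" "h \<in> L2_fun half_line"
  shows "(\<lambda>(x, y). g x * h y) \<in> L2_fun quadrant"
    and "L2_sq quadrant (\<lambda>(x, y). g x * h y) = L2_sq half_line g * L2_sq half_line h"
proof -
  interpret pair_sigma_finite half_line half_line by (rule pair_sigma_finite_half_line)
  note [measurable] = assms[THEN L2_funD(1)]
  note I = assms[THEN L2_funD(2)]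
  have int: "integrable quadrant (\<lambda>(x, y). (g x)\<^sup>2 * (h y)\<^sup>2)"
    unfolding quadrant_def
  proof (rule Fubini_integrable)
    show "integrable half_line (\<lambda>x. \<integral>y. norm (case (x, y) of (x, y) \<Rightarrow> (g x)\<^sup>2 * (h y)\<^sup>2) \<partial>half_line)"
      using I by (simp add: abs_mult)
    show "AE x in half_line. integrable half_line (\<lambda>y. case (x, y) of (x, y) \<Rightarrow> (g x)\<^sup>2 * (h y)\<^sup>2)"
      using I by simp
  qed measurable
  then show "(\<lambda>(x, y). g x * h y) \<in> L2_fun quadrant"
    by (auto simp: L2_fun_def power_mult_distrib case_prod_beta' quadrant_def)
  have "L2_sq quadrant (\<lambda>(x, y). g x * h y) = integral\<^sup>L quadrant (\<lambda>(x, y). (g x)\<^sup>2 * (h y)\<^sup>2)"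
    by (simp add: L2_sq_def power_mult_distrib case_prod_beta')
  also have "\<dots> = (\<integral>x. (\<integral>y. (g x)\<^sup>2 * (h y)\<^sup>2 \<partial>half_line) \<partial>half_line)"
    using integral_fst[of "\<lambda>x y. (g x)\<^sup>2 * (h y)\<^sup>2"] int by (simp add: quadrant_def)
  also have "\<dots> = L2_sq half_line g * L2_sq half_line h" by (simp add: L2_sq_def)
  finally show "L2_sq quadrant (\<lambda>(x, y). g x * h y) = L2_sq half_line g * L2_sq half_line h" .
qed

definition rect_ind :: "real \<times> real \<Rightarrow> real \<times> real \<Rightarrow> real" where
  "rect_ind p = (\<lambda>(x, y). time_ind (fst p) x * time_ind (snd p) y)"

lemma rect_ind_L2: "rect_ind p \<in> L2_fun quadrant"
  unfolding rect_ind_def by (rule tensor_L2(1)[OF time_ind_L2 time_ind_L2])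

lemma integral_rect_ind:
  assumes "0 \<le> fst p" "0 \<le> snd p" "0 \<le> fst q" "0 \<le> snd q"
  shows "(\<integral>z. rect_ind p z * rect_ind q z \<partial>quadrant) = min (fst p) (fst q) * min (snd p) (snd q)"
proof -
  interpret pair_sigma_finite half_line half_line by (rule pair_sigma_finite_half_line)
  have eq: "rect_ind p z * rect_ind q z = (case z of (x, y) \<Rightarrow> (time_ind (fst p) x * time_ind (fst q) x) * (time_ind (snd p) y * time_ind (snd q) y))" for z
    by (simp add: rect_ind_def case_prod_beta')
  have "integrable quadrant (\<lambda>z. rect_ind p z * rect_ind q z)"
    by (intro L2_fun_mult_integrable rect_ind_L2)
  then have "(\<integral>z. rect_ind p z * rect_ind q z \<partial>quadrant) =
    (\<integral>x. (\<integral>y. (time_ind (fst p) x * time_ind (fst q) x) * (time_ind (snd p) y * time_ind (snd q) y) \<partial>half_line) \<partial>half_line)"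
    unfolding eq quadrant_def by (subst integral_fst) (simp_all add: case_prod_beta')
  then show ?thesis using assms by (simp add: integral_time_ind)
qed

section \<open>Dense families of indicators\<close>

lemma L2_dense_half_line:
  assumes "f \<in> L2_fun half_line" shows "L2_dense half_line time_ind {0..} f"
proof (rule L2_dense_generated[where E="range (\<lambda>t. {0..t})" and B="\<lambda>n. {0..real n}"])
  show "sets half_line = sigma_sets (space half_line) (range (\<lambda>t. {0..t}))" by (simp add: sets_half_line)
  show "Int_stable (range (\<lambda>t. {0..t::real}))"
    unfolding Int_stable_def by (auto simp: image_iff intro: exI[of _ "min _ _"])
  show "(\<Union>n. {0..real n}) = space half_line" by (auto intro: real_arch_simple)
  fix A :: "real set" assume "A \<in> range (\<lambda>t. {0..t})"
  then obtain t where A: "A = {0..t}" by auto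
  show "L2_dense half_line time_ind {0..} (indicator A)"
  proof (cases "t \<ge> 0")
    case True
    have "L2_dense half_line time_ind {0..} (lincomb time_ind [(1, t)])"
      using True by (intro L2_dense_lincomb time_ind_L2) auto
    then show ?thesis by (simp add: A lincomb_def[abs_def] time_ind_def)
  next
    case False
    have "L2_dense half_line time_ind {0..} (lincomb time_ind [])"
      by (intro L2_dense_lincomb time_ind_L2) auto
    moreover have "indicator A = (\<lambda>x. 0::real)" using False by (auto simp: A fun_eq_iff)
    ultimately show ?thesis by (simp add: lincomb_def[abs_def])
  qed
qed (use assms in \<open>auto simp: time_ind_L2 incseq_def\<close>)

abbreviation nonneg_pairs :: "(real \<times> real) set" where
  "nonneg_pairs \<equiv> {0..} \<times> {0..}"

lemma L2_dense_quadrant: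
  assumes "f \<in> L2_fun quadrant" shows "L2_dense quadrant rect_ind nonneg_pairs f"
proof (rule L2_dense_generated[where E="{a \<times> b |a b. a \<in> range (\<lambda>t. {0..t}) \<and> b \<in> range (\<lambda>t. {0..t})}"
      and B="\<lambda>n. {0..real n} \<times> {0..real n}"])
  let ?E = "range (\<lambda>t. {0..t::real})"
  let ?C = "range (\<lambda>n. {0..real n})"
  have "sets quadrant = sets (sigma (space half_line \<times> space half_line) {a \<times> b | a b. a \<in> ?E \<and> b \<in> ?E})"
    unfolding quadrant_def
  proof (rule sets_pair_eq[where Ca="?C" and Cb="?C"])
    show "\<Union> ?C = space half_line" "\<Union> ?C = space half_line" by (auto intro: real_arch_simple)
  qed (auto simp: sets_half_line)
  also have "\<dots> = sigma_sets (space half_line \<times> space half_line) {a \<times> b | a b. a \<in> ?E \<and> b \<in> ?E}"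
    by (rule sets_measure_of) auto
  finally show "sets quadrant = sigma_sets (space quadrant) {a \<times> b | a b. a \<in> ?E \<and> b \<in> ?E}" by simp
  show "Int_stable {a \<times> b | a b. a \<in> ?E \<and> b \<in> ?E}"
  proof (rule Int_stableI)
    fix A B assume "A \<in> {a \<times> b | a b. a \<in> ?E \<and> b \<in> ?E}" "B \<in> {a \<times> b | a b. a \<in> ?E \<and> b \<in> ?E}"
    then obtain s t s' t' where "A = {0..s} \<times> {0..t}" "B = {0..s'} \<times> {0..t'}" by auto
    then have "A \<inter> B = {0..min s s'} \<times> {0..min t t'}" by auto
    then show "A \<inter> B \<in> {a \<times> b | a b. a \<in> ?E \<and> b \<in> ?E}" by blast
  qed
  show "(\<Union>n. {0..real n} \<times> {0..real n}) = space quadrant"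
  proof safe
    fix x y assume "(x, y) \<in> space quadrant"
    moreover obtain n where "max x y \<le> real n" using real_arch_simple by blast
    ultimately show "(x, y) \<in> (\<Union>n. {0..real n} \<times> {0..real n})" by (intro UN_I[of n]) auto
  qed auto
  show "incseq (\<lambda>n. {0..real n} \<times> {0..real n})" by (auto simp: incseq_def)
  fix A :: "(real \<times> real) set" assume "A \<in> {a \<times> b | a b. a \<in> ?E \<and> b \<in> ?E}"
  then obtain s t where A: "A = {0..s} \<times> {0..t}" by auto
  have ind: "indicator A = rect_ind (s, t)"
    by (auto simp: A rect_ind_def time_ind_def fun_eq_iff indicator_def)
  show "L2_dense quadrant rect_ind nonneg_pairs (indicator A)"
  proof (cases "s \<ge> 0 \<and> t \<ge> 0")
    case True
    have "L2_dense quadrant rect_ind nonneg_pairs (lincomb rect_ind [(1, (s, t))])"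
      using True by (intro L2_dense_lincomb rect_ind_L2) auto
    then show ?thesis by (simp add: ind lincomb_def[abs_def])
  next
    case False
    have "L2_dense quadrant rect_ind nonneg_pairs (lincomb rect_ind [])"
      by (intro L2_dense_lincomb rect_ind_L2) auto
    moreover have "indicator A = (\<lambda>x. 0::real)" using False by (auto simp: A fun_eq_iff)
    ultimately show ?thesis by (simp add: lincomb_def[abs_def])
  qed
qed (use assms in \<open>auto simp: rect_ind_L2\<close>)

section \<open>Gram matrices of linear combinations\<close>

lemma integral_lincomb_mult:
  assumes "\<And>i. i \<in> I \<Longrightarrow> d i \<in> L2_fun M" "g \<in> L2_fun M" "snd ` set xs \<subseteq> I"
  shows "(\<integral>x. lincomb d xs x * g x \<partial>M) = (\<Sum>(c, i)\<leftarrow>xs. c * (\<integral>x. d i x * g x \<partial>M))"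
  using assms(3)
proof (induction xs)
  case (Cons p xs)
  have "(\<integral>x. lincomb d (p # xs) x * g x \<partial>M) = (\<integral>x. fst p * (d (snd p) x * g x) + lincomb d xs x * g x \<partial>M)"
    by (simp add: algebra_simps)
  also have "\<dots> = fst p * (\<integral>x. d (snd p) x * g x \<partial>M) + (\<integral>x. lincomb d xs x * g x \<partial>M)"
  proof -
    have "lincomb d xs \<in> L2_fun M" "d (snd p) \<in> L2_fun M"
      using Cons.prems assms(1) by (auto intro!: L2_fun_lincomb[where I=I])
    then show ?thesis using assms(2)
      by (subst Bochner_Integration.integral_add) (simp_all add: L2_fun_mult_integrable)
  qed
  finally show ?case using Cons by (simp add: case_prod_beta)
qed simp

lemma mean_square_le: "((x + y) / 2)\<^sup>2 \<le> (x\<^sup>2 + y\<^sup>2) / (2::real)"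
  using sum_squares_bound[of x y] by (simp add: power2_eq_square field_simps)

lemma sum_list_pair_cong:
  "(\<And>p. p \<in> set xs \<Longrightarrow> g (snd p) = h (snd p)) \<Longrightarrow>
    (\<Sum>(c, i)\<leftarrow>xs. c * g i) = (\<Sum>(c, i)\<leftarrow>xs. c * h i :: real)"
  by (intro arg_cong[where f=sum_list] map_cong) (auto simp: case_prod_beta)

lemma L2_sq_lincomb:
  assumes d: "\<And>i. i \<in> I \<Longrightarrow> d i \<in> L2_fun M" and xs: "snd ` set xs \<subseteq> I"
  shows "L2_sq M (lincomb d xs) = (\<Sum>(c, i)\<leftarrow>xs. c * (\<Sum>(c', j)\<leftarrow>xs. c' * (\<integral>x. d j x * d i x \<partial>M)))"
proof -
  have dl: "lincomb d xs \<in> L2_fun M" using assms by (auto intro!: L2_fun_lincomb[where I=I])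
  have "L2_sq M (lincomb d xs) = (\<integral>x. lincomb d xs x * lincomb d xs x \<partial>M)"
    by (simp add: L2_sq_def power2_eq_square)
  also have "\<dots> = (\<Sum>(c, i)\<leftarrow>xs. c * (\<integral>x. d i x * lincomb d xs x \<partial>M))"
    by (rule integral_lincomb_mult[OF d dl xs])
  also have "\<dots> = (\<Sum>(c, i)\<leftarrow>xs. c * (\<Sum>(c', j)\<leftarrow>xs. c' * (\<integral>x. d j x * d i x \<partial>M)))"
  proof (rule sum_list_pair_cong)
    fix p assume "p \<in> set xs"
    then have "snd p \<in> I" using xs by auto
    then have "(\<integral>x. lincomb d xs x * d (snd p) x \<partial>M) = (\<Sum>(c', j)\<leftarrow>xs. c' * (\<integral>x. d j x * d (snd p) x \<partial>M))"
      by (intro integral_lincomb_mult[OF d _ xs] d)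
    then show "(\<integral>x. d (snd p) x * lincomb d xs x \<partial>M) = (\<Sum>(c', j)\<leftarrow>xs. c' * (\<integral>x. d j x * d (snd p) x \<partial>M))"
      by (simp add: mult.commute[of "lincomb d xs _"])
  qed
  finally show ?thesis .
qed

text \<open>Both norms are the same quadratic form in the coefficients, given by the common Gram
  matrix. The lemma is applied to Brownian values against indicators, and to coefficient arrays
  against rectangles.\<close>

lemma L2_sq_lincomb_isometry:
  assumes "\<And>i. i \<in> I \<Longrightarrow> d i \<in> L2_fun M" "\<And>i. i \<in> I \<Longrightarrow> e i \<in> L2_fun N" and xs: "snd ` set xs \<subseteq> I"
    and gram: "\<And>i j. i \<in> I \<Longrightarrow> j \<in> I \<Longrightarrow> (\<integral>x. d i x * d j x \<partial>M) = (\<integral>x. e i x * e j x \<partial>N)"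
  shows "L2_sq M (lincomb d xs) = L2_sq N (lincomb e xs)"
proof -
  have "L2_sq M (lincomb d xs) = (\<Sum>(c, i)\<leftarrow>xs. c * (\<Sum>(c', j)\<leftarrow>xs. c' * (\<integral>x. d j x * d i x \<partial>M)))"
    using assms by (intro L2_sq_lincomb)
  also have "\<dots> = (\<Sum>(c, i)\<leftarrow>xs. c * (\<Sum>(c', j)\<leftarrow>xs. c' * (\<integral>x. e j x * e i x \<partial>N)))"
    using xs gram by (intro sum_list_pair_cong) blast
  also have "\<dots> = L2_sq N (lincomb e xs)"
    using assms by (intro L2_sq_lincomb[symmetric])
  finally show ?thesis .
qed

section \<open>Wiener integrals\<close>

lemma lincomb_measurable:
  "(\<And>i. i \<in> I \<Longrightarrow> d i \<in> borel_measurable N) \<Longrightarrow> snd ` set xs \<subseteq> I \<Longrightarrow> lincomb d xs \<in> borel_measurable N"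
proof (induction xs)
  case Nil then show ?case by (simp add: lincomb_def[abs_def])
next
  case (Cons p xs)
  have "(\<lambda>x. fst p * d (snd p) x + lincomb d xs x) \<in> borel_measurable N"
    using Cons by (intro borel_measurable_add borel_measurable_times borel_measurable_const) auto
  moreover have "lincomb d (p # xs) = (\<lambda>x. fst p * d (snd p) x + lincomb d xs x)" by (rule ext) simp
  ultimately show ?case by simp
qed

locale brownian =
  fixes M :: "'w measure" and W :: "real \<Rightarrow> 'w \<Rightarrow> real"
  assumes bm: "standard_brownian_motion M W"
begin

sublocale prob_space M using bm by (simp add: standard_brownian_motion_def)

lemma W_measurable: "0 \<le> t \<Longrightarrow> W t \<in> borel_measurable M"
  using bm by (simp add: standard_brownian_motion_def)

lemma W_0: "AE \<omega> in M. W 0 \<omega> = 0"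
  using bm by (simp add: standard_brownian_motion_def)

lemma W_increment: "0 \<le> s \<Longrightarrow> s \<le> t \<Longrightarrow> distr M borel (\<lambda>\<omega>. W t \<omega> - W s \<omega>) = normal_law 0 (t - s)"
  using bm by (simp add: standard_brownian_motion_def)

lemma W_indep: "0 \<le> t 0 \<Longrightarrow> mono_on {..n} t \<Longrightarrow>
    indep_vars (\<lambda>_. borel) (\<lambda>i \<omega>. W (t (Suc i)) \<omega> - W (t i) \<omega>) {..<n::nat}"
  using bm by (simp add: standard_brownian_motion_def)

lemma std_increment:
  assumes "0 \<le> s" "s < t"
  shows "distr M borel (\<lambda>\<omega>. (W t \<omega> - W s \<omega>) / sqrt (t - s)) = std_normal_distribution"
proof -
  have [measurable]: "W s \<in> borel_measurable M" "W t \<in> borel_measurable M" using assms by (auto intro: W_measurable)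
  have "distr M lborel (\<lambda>\<omega>. W t \<omega> - W s \<omega>) = distr M borel (\<lambda>\<omega>. W t \<omega> - W s \<omega>)"
    by (rule distr_cong) auto
  then have "distributed M lborel (\<lambda>\<omega>. W t \<omega> - W s \<omega>) (normal_density 0 (sqrt (t - s)))"
    using assms W_increment[of s t] by (simp add: distributed_def normal_law_def)
  then have "distributed M lborel (\<lambda>\<omega>. (W t \<omega> - W s \<omega> - 0) / sqrt (t - s)) std_normal_density"
    using assms by (subst normal_standard_normal_convert[symmetric]) auto
  then have "distr M lborel (\<lambda>\<omega>. (W t \<omega> - W s \<omega>) / sqrt (t - s)) = std_normal_distribution"
    by (simp add: distributed_def)
  moreover have "distr M lborel (\<lambda>\<omega>. (W t \<omega> - W s \<omega>) / sqrt (t - s)) = distr M borel (\<lambda>\<omega>. (W t \<omega> - W s \<omega>) / sqrt (t - s))"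
    by (rule distr_cong) auto
  ultimately show ?thesis by simp
qed

lemma increment_L2:
  assumes "0 \<le> s" "s \<le> t"
  shows "(\<lambda>\<omega>. W t \<omega> - W s \<omega>) \<in> L2_fun M" "L2_sq M (\<lambda>\<omega>. W t \<omega> - W s \<omega>) = t - s"
proof -
  have [measurable]: "W s \<in> borel_measurable M" "W t \<in> borel_measurable M" using assms by (auto intro: W_measurable)
  define \<xi> where "\<xi> \<omega> = (W t \<omega> - W s \<omega>) / sqrt (t - s)" for \<omega>
  have [measurable]: "\<xi> \<in> borel_measurable M" unfolding \<xi>_def by measurable
  have *: "(\<lambda>\<omega>. W t \<omega> - W s \<omega>) \<in> L2_fun M \<and> L2_sq M (\<lambda>\<omega>. W t \<omega> - W s \<omega>) = t - s"
  proof (cases "s < t")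
    case True
    have law: "distr M borel \<xi> = std_normal_distribution" using std_increment[OF assms(1) True] by (simp add: \<xi>_def[abs_def])
    have "integrable (distr M borel \<xi>) (\<lambda>x. x\<^sup>2)" unfolding law by (rule integrable_std_normal_distribution_moment)
    then have i: "integrable M (\<lambda>\<omega>. (\<xi> \<omega>)\<^sup>2)" by (subst (asm) integrable_distr_eq) auto
    have "integral\<^sup>L (distr M borel \<xi>) (\<lambda>x. x\<^sup>2) = 1"
      unfolding law using std_normal_distribution_even_moments(1)[of 1] by simp
    then have e: "(\<integral>\<omega>. (\<xi> \<omega>)\<^sup>2 \<partial>M) = 1" by (subst (asm) integral_distr) auto
    have W: "(\<lambda>\<omega>. W t \<omega> - W s \<omega>) = (\<lambda>\<omega>. sqrt (t - s) * \<xi> \<omega>)" using True by (simp add: \<xi>_def)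
    show ?thesis unfolding W L2_sq_cmult using i e True by (auto simp: L2_fun_def L2_sq_def power_mult_distrib)
  next
    case False
    then have "s = t" using assms by simp
    then show ?thesis by (simp add: L2_sq_def)
  qed
  show "(\<lambda>\<omega>. W t \<omega> - W s \<omega>) \<in> L2_fun M" "L2_sq M (\<lambda>\<omega>. W t \<omega> - W s \<omega>) = t - s" using * by auto
qed

lemma W_L2: assumes "0 \<le> t" shows "W t \<in> L2_fun M" "L2_sq M (W t) = t"
proof -
  have ae: "AE \<omega> in M. W t \<omega> - W 0 \<omega> = W t \<omega>" using W_0 by auto
  note i = increment_L2[of 0 t]
  show "W t \<in> L2_fun M"
    by (rule L2_fun_dominated[OF W_measurable[OF assms] i(1)]) (use ae assms in auto)
  then show "L2_sq M (W t) = t"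
    using i assms L2_sq_cong_AE[OF _ _ ae] by (auto simp: L2_funD)
qed

text \<open>Expanding E (W_t - W_s)^2 = t - s yields the covariance from variances alone.\<close>

lemma W_covariance:
  assumes "0 \<le> s" "0 \<le> t" shows "(\<integral>\<omega>. W s \<omega> * W t \<omega> \<partial>M) = min s t"
proof -
  have *: "(\<integral>\<omega>. W s \<omega> * W t \<omega> \<partial>M) = s" if "0 \<le> s" "s \<le> t" for s t
  proof -
    have t: "0 \<le> t" using that by simp
    have "t - s = (\<integral>\<omega>. (W t \<omega>)\<^sup>2 + (W s \<omega>)\<^sup>2 - 2 * (W s \<omega> * W t \<omega>) \<partial>M)"
      using increment_L2(2)[OF that] by (simp add: L2_sq_def power2_diff mult_ac)
    also have "\<dots> = L2_sq M (W t) + L2_sq M (W s) - 2 * (\<integral>\<omega>. W s \<omega> * W t \<omega> \<partial>M)"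
      using that t by (simp add: L2_sq_def W_L2 L2_funD L2_fun_mult_integrable)
    finally show ?thesis using W_L2(2)[OF that(1)] W_L2(2)[OF t] by simp
  qed
  show ?thesis
  proof (cases "s \<le> t")
    case True then show ?thesis using *[of s t] assms by simp
  next
    case False then show ?thesis using *[of t s] assms by (simp add: mult.commute)
  qed
qed

text \<open>The variables W_t and the indicators of [0, t] have the same Gram matrix, so the
  extension theorem applies with constant 1.\<close>

lemma wiener_integral_exists: "\<exists>J. is_wiener_integral M W J"
proof -
  have "\<exists>J. continuous_linear_L2 half_line (L2_fun half_line) M J \<and>
    (\<forall>xs. snd ` set xs \<subseteq> {0..} \<longrightarrow> (AE \<omega> in M. J (lincomb time_ind xs) \<omega> = lincomb W xs \<omega>))"
  proof (rule L2_extension[where C=1])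
    fix xs :: "(real \<times> real) list" assume xs: "snd ` set xs \<subseteq> {0..}"
    have "L2_sq M (lincomb W xs) = L2_sq half_line (lincomb time_ind xs)"
      by (rule L2_sq_lincomb_isometry[OF _ _ xs]) (auto simp: W_L2 time_ind_L2 W_covariance integral_time_ind)
    then show "L2_sq M (lincomb W xs) \<le> 1 * L2_sq half_line (lincomb time_ind xs)" by simp
  qed (auto simp: W_L2 time_ind_L2 L2_dense_half_line)
  then obtain J where J: "continuous_linear_L2 half_line (L2_fun half_line) M J"
    "\<And>xs. snd ` set xs \<subseteq> {0..} \<Longrightarrow> AE \<omega> in M. J (lincomb time_ind xs) \<omega> = lincomb W xs \<omega>" by blast
  have "AE \<omega> in M. J (indicator {s<..t}) \<omega> = W t \<omega> - W s \<omega>" if "0 \<le> s" "s \<le> t" for s t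
  proof -
    have "lincomb time_ind [(1, t), (-1, s)] = indicator {s<..t}"
      using that by (auto simp: fun_eq_iff time_ind_def indicator_def)
    then show ?thesis using J(2)[of "[(1, t), (-1, s)]"] that by simp
  qed
  with J(1) show ?thesis unfolding is_wiener_integral_def by blast
qed

lemma wiener_integral: "is_wiener_integral M W (wiener_integral M W)"
  unfolding wiener_integral_def using wiener_integral_exists by (rule someI_ex)

end

section \<open>Continuous linear maps between L2 spaces\<close>

lemma continuous_linear_L2_linear:
  "continuous_linear_L2 A V B T \<Longrightarrow> f \<in> V \<Longrightarrow> g \<in> V \<Longrightarrow>
    AE \<omega> in B. T (\<lambda>x. a * f x + b * g x) \<omega> = a * T f \<omega> + b * T g \<omega>"
  by (simp add: continuous_linear_L2_def)

text \<open>Linearity holds almost everywhere for each pair of functions, so a finite list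
  accumulates finitely many null sets. The subspace \<open>V\<close> is arbitrary in order to cover
  both integrals, the one on all of L2 and the one on symmetric kernels.\<close>

lemma continuous_linear_L2_lincomb:
  assumes T: "continuous_linear_L2 A V B T" and V0: "(\<lambda>x. 0) \<in> V"
    and V: "\<And>f g a b. f \<in> V \<Longrightarrow> g \<in> V \<Longrightarrow> (\<lambda>x. a * f x + b * g x) \<in> V"
    and d: "\<And>i. i \<in> I \<Longrightarrow> d i \<in> V" and xs: "snd ` set xs \<subseteq> I"
  shows "lincomb d xs \<in> V \<and> (AE \<omega> in B. T (lincomb d xs) \<omega> = lincomb (\<lambda>i. T (d i)) xs \<omega>)"
  using xs
proof (induction xs)
  case Nil
  show ?case using V0 continuous_linear_L2_linear[OF T V0 V0, of 0 0] by (simp add: lincomb_def[abs_def])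
next
  case (Cons p xs)
  then have IH: "lincomb d xs \<in> V" "AE \<omega> in B. T (lincomb d xs) \<omega> = lincomb (\<lambda>i. T (d i)) xs \<omega>" and p: "d (snd p) \<in> V"
    using d by auto
  have eq: "lincomb d (p # xs) = (\<lambda>x. fst p * d (snd p) x + 1 * lincomb d xs x)" by (simp add: fun_eq_iff)
  have "AE \<omega> in B. T (\<lambda>x. fst p * d (snd p) x + 1 * lincomb d xs x) \<omega> = fst p * T (d (snd p)) \<omega> + 1 * T (lincomb d xs) \<omega>"
    by (rule continuous_linear_L2_linear[OF T p IH(1)])
  then have "AE \<omega> in B. T (lincomb d (p # xs)) \<omega> = lincomb (\<lambda>i. T (d i)) (p # xs) \<omega>"
    unfolding eq using IH(2) by eventually_elim simp
  moreover have "lincomb d (p # xs) \<in> V" unfolding eq using p IH(1) by (rule V)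
  ultimately show ?case by (intro conjI)
qed

lemma continuous_linear_L2_fun: "continuous_linear_L2 A V B T \<Longrightarrow> f \<in> V \<Longrightarrow> T f \<in> L2_fun B"
  by (simp add: continuous_linear_L2_def)

lemma continuous_linear_L2_cont:
  assumes "continuous_linear_L2 A V B T" "f \<in> V" "\<epsilon> > 0"
  shows "\<exists>\<delta>>0. \<forall>g\<in>V. L2_sq A (\<lambda>x. f x - g x) < \<delta> \<longrightarrow> L2_sq B (\<lambda>\<omega>. T f \<omega> - T g \<omega>) < \<epsilon>"
proof -
  have "sqrt \<epsilon> > 0" using assms by simp
  then obtain \<delta> where \<delta>: "\<delta> > 0" "\<And>g. g \<in> V \<Longrightarrow> L2_norm A (\<lambda>x. g x - f x) < \<delta> \<Longrightarrow> L2_norm B (\<lambda>\<omega>. T g \<omega> - T f \<omega>) < sqrt \<epsilon>"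
    using assms unfolding continuous_linear_L2_def by meson
  have "L2_sq B (\<lambda>\<omega>. T f \<omega> - T g \<omega>) < \<epsilon>" if "g \<in> V" "L2_sq A (\<lambda>x. f x - g x) < \<delta>\<^sup>2" for g
  proof -
    have "L2_norm A (\<lambda>x. g x - f x) < \<delta>" using that \<delta>(1) by (simp add: L2_norm_less_iff L2_sq_commute[of A g])
    then have "L2_norm B (\<lambda>\<omega>. T g \<omega> - T f \<omega>) < sqrt \<epsilon>" using that \<delta> by blast
    then show ?thesis using \<open>sqrt \<epsilon> > 0\<close> by (simp add: L2_norm_less_iff L2_sq_commute[of B "T f"])
  qed
  with \<delta>(1) show ?thesis by (intro exI[of _ "\<delta>\<^sup>2"]) auto
qed

text \<open>Functions at distance 0 lie within every \<delta>, so continuity brings their images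
  within every \<epsilon>.\<close>

lemma continuous_linear_L2_cong:
  assumes "continuous_linear_L2 A V B T" "V \<subseteq> L2_fun A" "f \<in> V" "g \<in> V" "AE x in A. f x = g x"
  shows "AE \<omega> in B. T f \<omega> = T g \<omega>"
proof (rule L2_sq_small_AE_eq)
  show "T f \<in> L2_fun B" "T g \<in> L2_fun B" using assms by (auto intro: continuous_linear_L2_fun)
  have m: "f \<in> borel_measurable A" "g \<in> borel_measurable A" using assms by (auto dest: L2_funD(1))
  have "L2_sq A (\<lambda>x. f x - g x) = L2_sq A (\<lambda>x. 0)"
    using assms(5) m by (intro L2_sq_cong_AE) auto
  then have z: "L2_sq A (\<lambda>x. f x - g x) = 0" by (simp add: L2_sq_def)
  fix \<epsilon> :: real assume "\<epsilon> > 0"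
  from continuous_linear_L2_cont[OF assms(1,3) this] z assms(4)
  show "L2_sq B (\<lambda>\<omega>. T f \<omega> - T g \<omega>) \<le> \<epsilon>" by (metis less_imp_le)
qed

section \<open>Finite-dimensional reduction of Brownian motion\<close>

context brownian
begin

text \<open>The normalized increments between consecutive points of \<open>T\<close> are independent
  standard Gaussian variables, and W_t is the sum of the increments to the left of t. The vectors
  \<open>b t\<close> have the same Gram matrix as the indicators of [0, t], which later makes the
  passage from kernels to arrays isometric.\<close>

lemma partition_representation:
  assumes T: "finite T" "T \<subseteq> {0..}" "0 \<in> T" "1 \<in> T"
  shows "\<exists>m \<xi> b. distr M (std_gauss m) (\<lambda>\<omega>. \<lambda>i\<in>{..<m}. \<xi> i \<omega>) = std_gauss m \<and>
    (\<forall>i<m. \<xi> i \<in> borel_measurable M) \<and>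
    (\<forall>t\<in>T. AE \<omega> in M. W t \<omega> = (\<Sum>i<m. b t i * \<xi> i \<omega>)) \<and>
    (\<forall>s\<in>T. \<forall>t\<in>T. min s t = (\<Sum>i<m. b s i * b t i))"
proof -
  define ts where "ts = sorted_list_of_set T"
  have ts: "set ts = T" "sorted_wrt (<) ts" using T by (auto simp: ts_def)
  \<comment> \<open>Since 0 and 1 lie in \<open>T\<close> there is at least one interval: the
    characterization of independence by product laws is applied to a nonempty index set.\<close>
  have "card T \<ge> card {0, 1::real}" using T by (intro card_mono) auto
  then have len: "length ts \<ge> 2" using T by (simp add: ts_def)
  define m where "m = length ts - 1"
  have m: "length ts = Suc m" "m > 0" using len by (auto simp: m_def)
  define \<tau> where "\<tau> i = ts ! i" for i
  have less: "\<tau> i < \<tau> j" if "i < j" "j \<le> m" for i j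
    using ts(2) that m unfolding \<tau>_def by (auto simp: sorted_wrt_iff_nth_less)
  have inT: "\<tau> i \<in> T" if "i \<le> m" for i using that m ts(1) unfolding \<tau>_def by (metis nth_mem le_imp_less_Suc)
  have nonneg: "0 \<le> \<tau> i" if "i \<le> m" for i using inT[OF that] T by auto
  have \<tau>0: "\<tau> 0 = 0"
  proof -
    obtain j where j: "j \<le> m" "\<tau> j = 0" using T(3) ts(1) m unfolding \<tau>_def by (metis in_set_conv_nth less_Suc_eq_le)
    show ?thesis using less[of 0 j] j nonneg[of 0] by (cases "j = 0") auto
  qed
  define \<Delta> where "\<Delta> i = \<tau> (Suc i) - \<tau> i" for i
  have \<Delta>: "\<Delta> i > 0" if "i < m" for i using less[of i "Suc i"] that by (simp add: \<Delta>_def)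
  define \<xi> where "\<xi> i \<omega> = (W (\<tau> (Suc i)) \<omega> - W (\<tau> i) \<omega>) / sqrt (\<Delta> i)" for i \<omega>
  \<comment> \<open>Interval i contributes to W_t exactly when it lies to the left of t.\<close>
  define b where "b t i = (if \<tau> (Suc i) \<le> t then sqrt (\<Delta> i) else 0)" for t i
  have meas: "\<xi> i \<in> borel_measurable M" if "i < m" for i
    unfolding \<xi>_def using that nonneg[of i] nonneg[of "Suc i"]
    by (intro borel_measurable_divide borel_measurable_diff W_measurable) auto
  have mono: "mono_on {..m} \<tau>"
    using less by (intro mono_onI) (metis atMost_iff le_less order_refl)
  have "indep_vars (\<lambda>_. borel) (\<lambda>i \<omega>. W (\<tau> (Suc i)) \<omega> - W (\<tau> i) \<omega>) {..<m}"
    using mono nonneg[of 0] by (intro W_indep) auto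
  from indep_vars_compose2[OF this, of "\<lambda>i x. x / sqrt (\<Delta> i)" "\<lambda>_. borel"]
  have "indep_vars (\<lambda>_. borel) \<xi> {..<m}" unfolding \<xi>_def by simp
  then have "distr M (PiM {..<m} (\<lambda>_. borel)) (\<lambda>\<omega>. \<lambda>i\<in>{..<m}. \<xi> i \<omega>) = PiM {..<m} (\<lambda>i. distr M borel (\<xi> i))"
    using m meas by (subst (asm) indep_vars_iff_distr_eq_PiM') auto
  also have "\<dots> = std_gauss m"
    unfolding \<xi>_def \<Delta>_def using less nonneg by (intro PiM_cong refl std_increment) auto
  also have "distr M (PiM {..<m} (\<lambda>_. borel)) (\<lambda>\<omega>. \<lambda>i\<in>{..<m}. \<xi> i \<omega>) = distr M (std_gauss m) (\<lambda>\<omega>. \<lambda>i\<in>{..<m}. \<xi> i \<omega>)"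
    by (intro distr_cong sets_PiM_cong) auto
  finally have law: "distr M (std_gauss m) (\<lambda>\<omega>. \<lambda>i\<in>{..<m}. \<xi> i \<omega>) = std_gauss m" .
  have le_iff: "\<tau> i \<le> \<tau> j \<longleftrightarrow> i \<le> j" if "i \<le> m" "j \<le> m" for i j
    using less[of i j] less[of j i] that by (cases i j rule: linorder_cases) auto
  have idx: "\<exists>k\<le>m. t = \<tau> k" if "t \<in> T" for t
    using that ts(1) m unfolding \<tau>_def by (metis in_set_conv_nth less_Suc_eq_le)
  have sum_b: "(\<Sum>i<m. b (\<tau> k) i * g i) = (\<Sum>i<k. sqrt (\<Delta> i) * g i)" if "k \<le> m" for k g
  proof -
    have "(\<Sum>i<m. b (\<tau> k) i * g i) = (\<Sum>i<m. if i < k then sqrt (\<Delta> i) * g i else 0)"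
      using that le_iff by (intro sum.cong) (auto simp: b_def Suc_le_eq)
    also have "\<dots> = (\<Sum>i\<in>{..<m} \<inter> {i. i < k}. sqrt (\<Delta> i) * g i)"
      by (subst sum.inter_restrict) auto
    also have "{..<m} \<inter> {i. i < k} = {..<k}" using that by auto
    finally show ?thesis .
  qed
  have W: "AE \<omega> in M. W t \<omega> = (\<Sum>i<m. b t i * \<xi> i \<omega>)" if "t \<in> T" for t
  proof -
    from idx[OF that] obtain k where k: "k \<le> m" "t = \<tau> k" by auto
    have "(\<Sum>i<m. b t i * \<xi> i \<omega>) = W t \<omega> - W 0 \<omega>" for \<omega>
    proof -
      have "(\<Sum>i<m. b t i * \<xi> i \<omega>) = (\<Sum>i<k. W (\<tau> (Suc i)) \<omega> - W (\<tau> i) \<omega>)"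
        unfolding k(2) sum_b[OF k(1)]
      proof (intro sum.cong refl)
        fix i assume "i \<in> {..<k}"
        then have "sqrt (\<Delta> i) \<noteq> 0" using \<Delta>[of i] k(1) by simp
        then show "sqrt (\<Delta> i) * \<xi> i \<omega> = W (\<tau> (Suc i)) \<omega> - W (\<tau> i) \<omega>" by (simp add: \<xi>_def)
      qed
      also have "\<dots> = W (\<tau> k) \<omega> - W (\<tau> 0) \<omega>" by (rule sum_lessThan_telescope)
      finally show ?thesis by (simp add: k \<tau>0)
    qed
    then show ?thesis using W_0 by auto
  qed
  have cov: "min s t = (\<Sum>i<m. b s i * b t i)" if "s \<in> T" "t \<in> T" for s t
  proof -
    have *: "(\<Sum>i<m. b (\<tau> k) i * b (\<tau> l) i) = \<tau> k" if "k \<le> l" "l \<le> m" for k l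
    proof -
      have "(\<Sum>i<m. b (\<tau> k) i * b (\<tau> l) i) = (\<Sum>i<k. sqrt (\<Delta> i) * b (\<tau> l) i)"
        using that by (intro sum_b) auto
      also have "\<dots> = (\<Sum>i<k. \<tau> (Suc i) - \<tau> i)"
      proof (intro sum.cong refl)
        fix i assume i: "i \<in> {..<k}"
        have "\<Delta> i > 0" using \<Delta>[of i] i that by auto
        moreover have "\<tau> (Suc i) \<le> \<tau> l" using le_iff[of "Suc i" l] i that by auto
        ultimately show "sqrt (\<Delta> i) * b (\<tau> l) i = \<tau> (Suc i) - \<tau> i" by (simp add: b_def) (simp add: \<Delta>_def)
      qed
      also have "\<dots> = \<tau> k - \<tau> 0" by (rule sum_lessThan_telescope)
      finally show ?thesis by (simp add: \<tau>0)
    qed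
    from idx[OF that(1)] idx[OF that(2)] obtain k l where kl: "k \<le> m" "s = \<tau> k" "l \<le> m" "t = \<tau> l" by blast
    show ?thesis
    proof (cases "k \<le> l")
      case True
      then show ?thesis using *[of k l] le_iff[of k l] kl by simp
    next
      case False
      then show ?thesis using *[of l k] le_iff[of l k] kl by (simp add: mult.commute)
    qed
  qed
  show ?thesis using law meas W cov by blast
qed

text \<open>The double Wiener integral of the symmetrized indicator of [0, s] \<times> [0, t]; the
  subtracted minimum is the mean of the product.\<close>

definition WW :: "real \<times> real \<Rightarrow> 'w \<Rightarrow> real" where
  "WW p \<omega> = W (fst p) \<omega> * W (snd p) \<omega> - min (fst p) (snd p)"

lemma WW_measurable: "p \<in> nonneg_pairs \<Longrightarrow> WW p \<in> borel_measurable M"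
  unfolding WW_def by (intro borel_measurable_diff borel_measurable_times W_measurable) auto

text \<open>The combination is a quadratic form in normalized increments whose array
  \<open>A\<close> has the same norm as the kernel. Rectangles are not symmetric, so
  \<open>A\<close> is replaced by its symmetric part \<open>B\<close>, which defines the same form
  but may have a smaller norm: hence the inequality in the conclusion.\<close>

theorem double_integral_law:
  assumes xs: "snd ` set xs \<subseteq> nonneg_pairs"
  shows "\<exists>m e. distr M borel (lincomb WW xs) = distr (std_gauss m) borel (\<lambda>x. \<Sum>i<m. e i * ((x i)\<^sup>2 - 1)) \<and>
    (\<Sum>i<m. (e i)\<^sup>2) \<le> L2_sq quadrant (lincomb rect_ind xs)"
proof -
  define T where "T = {0, 1} \<union> (fst \<circ> snd) ` set xs \<union> (snd \<circ> snd) ` set xs"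
  have T: "finite T" "T \<subseteq> {0..}" "0 \<in> T" "1 \<in> T" using xs by (auto simp: T_def)
  from partition_representation[OF T] obtain m \<xi> b where
    law: "distr M (std_gauss m) (\<lambda>\<omega>. \<lambda>i\<in>{..<m}. \<xi> i \<omega>) = std_gauss m"
    and meas: "\<And>i. i < m \<Longrightarrow> \<xi> i \<in> borel_measurable M"
    and W: "\<And>t. t \<in> T \<Longrightarrow> AE \<omega> in M. W t \<omega> = (\<Sum>i<m. b t i * \<xi> i \<omega>)"
    and cov: "\<And>s t. s \<in> T \<Longrightarrow> t \<in> T \<Longrightarrow> min s t = (\<Sum>i<m. b s i * b t i)" by blast
  define \<beta> where "\<beta> p = (\<lambda>(k, l). b (fst p) k * b (snd p) l)" for p :: "real \<times> real"
  define A where "A k l = lincomb \<beta> xs (k, l)" for k l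
  define B where "B k l = (A k l + A l k) / 2" for k l
  have TT: "fst p \<in> T \<and> snd p \<in> T" if "p \<in> snd ` set xs" for p using that by (force simp: T_def)
  define \<Xi> where "\<Xi> \<omega> = (\<lambda>i\<in>{..<m}. \<xi> i \<omega>)" for \<omega>
  \<comment> \<open>Linearity in the array reduces the claim to rank-one arrays, whose form is a
    product of two linear forms minus the inner product of their coefficient vectors.\<close>
  have qf: "qform m (\<lambda>k l. lincomb \<beta> ys (k, l)) x = lincomb (\<lambda>p x. (\<Sum>i<m. b (fst p) i * x i) * (\<Sum>i<m. b (snd p) i * x i) - (\<Sum>i<m. b (fst p) i * b (snd p) i)) ys x" for ys x
  proof (induction ys)
    case Nil then show ?case by (simp add: qform_def)
  next
    case (Cons p ys)
    have "qform m (\<lambda>k l. lincomb \<beta> (p # ys) (k, l)) x = fst p * qform m (\<lambda>k l. \<beta> (snd p) (k, l)) x + qform m (\<lambda>k l. lincomb \<beta> ys (k, l)) x"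
      by (simp add: qform_def sum.distrib sum_distrib_left algebra_simps)
    also have "qform m (\<lambda>k l. \<beta> (snd p) (k, l)) x = (\<Sum>i<m. b (fst (snd p)) i * x i) * (\<Sum>i<m. b (snd (snd p)) i * x i) - (\<Sum>i<m. b (fst (snd p)) i * b (snd (snd p)) i)"
      by (simp add: qform_def \<beta>_def sum_product mult_ac)
    finally show ?case using Cons by simp
  qed
  have "AE \<omega> in M. \<forall>t\<in>T. W t \<omega> = (\<Sum>i<m. b t i * \<xi> i \<omega>)"
    using T(1) W by (subst AE_finite_all) auto
  then have ae: "AE \<omega> in M. lincomb WW xs \<omega> = qform m A (\<Xi> \<omega>)"
  proof eventually_elim
    case (elim \<omega>)
    have "lincomb WW xs \<omega> = lincomb (\<lambda>p x. (\<Sum>i<m. b (fst p) i * x i) * (\<Sum>i<m. b (snd p) i * x i) - (\<Sum>i<m. b (fst p) i * b (snd p) i)) xs (\<Xi> \<omega>)"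
      unfolding lincomb_def
    proof (rule sum_list_pair_cong)
      fix q assume "q \<in> set xs"
      then have "fst (snd q) \<in> T" "snd (snd q) \<in> T" using TT[of "snd q"] by auto
      moreover have "(\<Sum>i<m. c i * \<Xi> \<omega> i) = (\<Sum>i<m. c i * \<xi> i \<omega>)" for c by (simp add: \<Xi>_def)
      ultimately show "WW (snd q) \<omega> = (\<Sum>i<m. b (fst (snd q)) i * \<Xi> \<omega> i) * (\<Sum>i<m. b (snd (snd q)) i * \<Xi> \<omega> i) - (\<Sum>i<m. b (fst (snd q)) i * b (snd (snd q)) i)"
        using elim cov by (simp add: WW_def)
    qed
    moreover have "A = (\<lambda>k l. lincomb \<beta> xs (k, l))" by (intro ext) (simp add: A_def)
    ultimately show ?case using qf[of xs "\<Xi> \<omega>"] by simp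
  qed
  have \<Xi>m: "\<Xi> \<in> measurable M (std_gauss m)"
    unfolding \<Xi>_def by (intro measurable_restrict) (use meas in auto)
  have qAB: "qform m A = qform m B"
  proof
    fix x
    have "(\<Sum>i<m. \<Sum>j<m. A j i * (x i * x j)) = (\<Sum>i<m. \<Sum>j<m. A i j * (x i * x j))"
      by (subst sum.swap) (simp add: mult_ac)
    moreover have "(\<Sum>i<m. \<Sum>j<m. B i j * (x i * x j)) = ((\<Sum>i<m. \<Sum>j<m. A i j * (x i * x j)) + (\<Sum>i<m. \<Sum>j<m. A j i * (x i * x j))) / 2"
      by (simp add: B_def sum.distrib[symmetric] sum_divide_distrib algebra_simps add_divide_distrib)
    ultimately show "qform m A x = qform m B x" by (simp add: qform_def B_def)
  qed
  have d1: "distr M borel (lincomb WW xs) = distr (std_gauss m) borel (qform m B)"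
  proof -
    have "distr M borel (lincomb WW xs) = distr M borel (\<lambda>\<omega>. qform m A (\<Xi> \<omega>))"
      using ae \<Xi>m xs by (intro distr_cong_AE lincomb_measurable[where I=nonneg_pairs] WW_measurable measurable_compose[OF \<Xi>m qform_measurable]) auto
    also have "\<dots> = distr (distr M (std_gauss m) \<Xi>) borel (qform m A)"
      using \<Xi>m by (subst distr_distr) (auto simp: o_def)
    also have "distr M (std_gauss m) \<Xi> = std_gauss m" using law by (simp add: \<Xi>_def[abs_def])
    finally show ?thesis by (simp add: qAB)
  qed
  have "B i j = B j i" for i j by (simp add: B_def add.commute)
  from qform_diagonalize[of B m, OF this] obtain e where
    e: "distr (std_gauss m) borel (qform m B) = distr (std_gauss m) borel (\<lambda>x. \<Sum>i<m. e i * ((x i)\<^sup>2 - 1))"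
    "(\<Sum>i<m. (e i)\<^sup>2) = (\<Sum>i<m. \<Sum>j<m. (B i j)\<^sup>2)" by blast
  \<comment> \<open>Arrays are viewed as functions on a finite counting space, so that the isometry
    lemma applies to them.\<close>
  let ?C = "count_space ({..<m} \<times> {..<m})"
  have frob: "(\<Sum>i<m. \<Sum>j<m. (A i j)\<^sup>2) = L2_sq quadrant (lincomb rect_ind xs)"
  proof -
    have "(\<Sum>i<m. \<Sum>j<m. (A i j)\<^sup>2) = L2_sq ?C (lincomb \<beta> xs)"
      by (simp add: L2_sq_def lebesgue_integral_count_space_finite A_def sum.cartesian_product)
    also have "\<dots> = L2_sq quadrant (lincomb rect_ind xs)"
    proof (rule L2_sq_lincomb_isometry[where I="snd ` set xs"])
      fix p q assume p: "p \<in> snd ` set xs" and q: "q \<in> snd ` set xs"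
      have "(\<integral>z. \<beta> p z * \<beta> q z \<partial>?C) = (\<Sum>k<m. \<Sum>l<m. (b (fst p) k * b (fst q) k) * (b (snd p) l * b (snd q) l))"
        by (simp add: lebesgue_integral_count_space_finite \<beta>_def sum.cartesian_product case_prod_beta mult_ac)
      also have "\<dots> = min (fst p) (fst q) * min (snd p) (snd q)"
        using TT[OF p] TT[OF q] by (simp add: cov sum_product)
      also have "\<dots> = (\<integral>z. rect_ind p z * rect_ind q z \<partial>quadrant)"
        using p q xs by (subst integral_rect_ind) auto
      finally show "(\<integral>z. \<beta> p z * \<beta> q z \<partial>?C) = (\<integral>z. rect_ind p z * rect_ind q z \<partial>quadrant)" .
      show "\<beta> p \<in> L2_fun ?C" by (simp add: L2_fun_def integrable_count_space)
      show "rect_ind p \<in> L2_fun quadrant" by (rule rect_ind_L2)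
    qed simp
    finally show ?thesis .
  qed
  have "(\<Sum>i<m. \<Sum>j<m. (B i j)\<^sup>2) \<le> (\<Sum>i<m. \<Sum>j<m. ((A i j)\<^sup>2 + (A j i)\<^sup>2) / 2)"
  proof (intro sum_mono)
    fix i j
    show "(B i j)\<^sup>2 \<le> ((A i j)\<^sup>2 + (A j i)\<^sup>2) / 2" unfolding B_def by (rule mean_square_le)
  qed
  also have "\<dots> = ((\<Sum>i<m. \<Sum>j<m. (A i j)\<^sup>2) + (\<Sum>i<m. \<Sum>j<m. (A j i)\<^sup>2)) / 2"
    by (simp add: sum.distrib sum_divide_distrib add_divide_distrib)
  also have "(\<Sum>i<m. \<Sum>j<m. (A j i)\<^sup>2) = (\<Sum>i<m. \<Sum>j<m. (A i j)\<^sup>2)" by (rule sum.swap)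
  finally have "(\<Sum>i<m. (e i)\<^sup>2) \<le> L2_sq quadrant (lincomb rect_ind xs)" using e(2) frob by simp
  with d1 e(1) show ?thesis by (intro exI[of _ m] exI[of _ e]) simp
qed

text \<open>Moments are read off the diagonalized law; the factor 2 is the variance of \<xi>^2 - 1
  for a standard Gaussian \<xi>.\<close>

lemma double_integral_bound:
  assumes xs: "snd ` set xs \<subseteq> nonneg_pairs"
  shows "lincomb WW xs \<in> L2_fun M" "L2_sq M (lincomb WW xs) \<le> 2 * L2_sq quadrant (lincomb rect_ind xs)"
proof -
  from double_integral_law[OF xs] obtain m e where
    law: "distr M borel (lincomb WW xs) = distr (std_gauss m) borel (\<lambda>x. \<Sum>i<m. e i * ((x i)\<^sup>2 - 1))"
    and le: "(\<Sum>i<m. (e i)\<^sup>2) \<le> L2_sq quadrant (lincomb rect_ind xs)" by blast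
  have X: "lincomb WW xs \<in> borel_measurable M" using WW_measurable xs by (rule lincomb_measurable)
  have Y: "(\<lambda>x. \<Sum>i<m. e i * ((x i)\<^sup>2 - 1)) \<in> borel_measurable (std_gauss m)"
    by (intro borel_measurable_sum borel_measurable_times borel_measurable_diff borel_measurable_power std_gauss_component) auto
  have "integrable (distr (std_gauss m) borel (\<lambda>x. \<Sum>i<m. e i * ((x i)\<^sup>2 - 1))) (\<lambda>y. y\<^sup>2)"
    using Y diag_law_second_moment(1) by (subst integrable_distr_eq) auto
  then have "integrable M (\<lambda>\<omega>. (lincomb WW xs \<omega>)\<^sup>2)"
    unfolding law[symmetric] using X by (subst (asm) integrable_distr_eq) auto
  then show "lincomb WW xs \<in> L2_fun M" using X by (simp add: L2_fun_def)
  have "L2_sq M (lincomb WW xs) = integral\<^sup>L (distr M borel (lincomb WW xs)) (\<lambda>y. y\<^sup>2)"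
    using X by (subst integral_distr) (auto simp: L2_sq_def)
  also have "\<dots> = 2 * (\<Sum>i<m. (e i)\<^sup>2)"
    unfolding law using Y by (subst integral_distr) (auto simp: diag_law_second_moment(2))
  finally show "L2_sq M (lincomb WW xs) \<le> 2 * L2_sq quadrant (lincomb rect_ind xs)" using le by simp
qed

end

section \<open>Tensor products and symmetric kernels\<close>

lemma AE_lincomb_cong:
  assumes "\<And>i. i \<in> I \<Longrightarrow> AE \<omega> in N. d i \<omega> = e i \<omega>" "snd ` set xs \<subseteq> I"
  shows "AE \<omega> in N. lincomb d xs \<omega> = lincomb e xs \<omega>"
  using assms(2)
proof (induction xs)
  case (Cons p xs)
  then have "AE \<omega> in N. lincomb d xs \<omega> = lincomb e xs \<omega>" by simp
  moreover have "AE \<omega> in N. d (snd p) \<omega> = e (snd p) \<omega>" using Cons.prems by (intro assms(1)) auto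
  ultimately show ?case by eventually_elim simp
qed simp

definition tensor_list :: "(real \<times> 'i) list \<Rightarrow> (real \<times> 'i) list \<Rightarrow> (real \<times> ('i \<times> 'i)) list" where
  "tensor_list xs ys = concat (map (\<lambda>(c, s). map (\<lambda>(c', t). (c * c', (s, t))) ys) xs)"

lemma tensor_list_subset:
  "snd ` set xs \<subseteq> I \<Longrightarrow> snd ` set ys \<subseteq> I \<Longrightarrow> snd ` set (tensor_list xs ys) \<subseteq> I \<times> I"
  by (force simp: tensor_list_def)

lemma lincomb_tensor_list:
  "lincomb D (tensor_list xs ys) z = (\<Sum>(c, s)\<leftarrow>xs. c * (\<Sum>(c', t)\<leftarrow>ys. c' * D (s, t) z))"
proof (induction xs)
  case Nil then show ?case by (simp add: tensor_list_def)
next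
  case (Cons p xs)
  have "lincomb D (map (\<lambda>(c', t). (c * c', (s, t))) ys) z = c * (\<Sum>q\<leftarrow>ys. fst q * D (s, snd q) z)" for c s
    by (induction ys) (auto simp: algebra_simps)
  with Cons show ?case by (simp add: tensor_list_def case_prod_beta)
qed

lemma sum_list_tensor:
  "(\<Sum>(c, s)\<leftarrow>xs. c * (\<Sum>(c', t)\<leftarrow>ys. c' * (u s * v t))) = (\<Sum>(c, s)\<leftarrow>xs. c * u s) * (\<Sum>(c', t)\<leftarrow>ys. c' * v t :: real)"
proof (induction xs)
  case (Cons p xs)
  have "(\<Sum>q\<leftarrow>ys. fst q * (u s * v (snd q))) = u s * (\<Sum>q\<leftarrow>ys. fst q * v (snd q))" for s
    by (induction ys) (auto simp: algebra_simps)
  with Cons show ?case by (simp add: case_prod_beta algebra_simps)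
qed simp

lemma sum_list_tensor_diff:
  "(\<Sum>(c, s)\<leftarrow>xs. c * (\<Sum>(c', t)\<leftarrow>ys. c' * (D s t - E s t))) =
   (\<Sum>(c, s)\<leftarrow>xs. c * (\<Sum>(c', t)\<leftarrow>ys. c' * D s t)) - (\<Sum>(c, s)\<leftarrow>xs. c * (\<Sum>(c', t)\<leftarrow>ys. c' * E s t :: real))"
  unfolding case_prod_beta right_diff_distrib sum_list_subtractf by (rule refl)

text \<open>Factorization f^2 - g^2 = (f - g)(f + g), followed by 2 |u v| \<le> k u^2 + v^2 / k. The
  free weight k takes the place of the Cauchy-Schwarz inequality.\<close>

lemma L2_sq_diff_le:
  assumes f: "f \<in> L2_fun M" and g: "g \<in> L2_fun M" and k: "k > 0"
  shows "\<bar>L2_sq M f - L2_sq M g\<bar> \<le> (k * L2_sq M (\<lambda>x. f x - g x) + L2_sq M (\<lambda>x. f x + g x) / k) / 2"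
proof -
  define u where "u x = f x - g x" for x
  define v where "v x = f x + g x" for x
  have u: "u \<in> L2_fun M" and v: "v \<in> L2_fun M" unfolding u_def[abs_def] v_def[abs_def] using f g by auto
  have "L2_sq M f - L2_sq M g = (\<integral>x. (f x)\<^sup>2 - (g x)\<^sup>2 \<partial>M)"
    unfolding L2_sq_def using f g by (subst Bochner_Integration.integral_diff) (auto simp: L2_funD)
  also have "(\<lambda>x. (f x)\<^sup>2 - (g x)\<^sup>2) = (\<lambda>x. u x * v x)"
    by (simp add: u_def v_def power2_eq_square algebra_simps)
  finally have "\<bar>L2_sq M f - L2_sq M g\<bar> \<le> (\<integral>x. \<bar>u x * v x\<bar> \<partial>M)" by (simp add: integral_abs_bound)
  also have "\<dots> \<le> (\<integral>x. (k * (u x)\<^sup>2 + (v x)\<^sup>2 / k) / 2 \<partial>M)"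
  proof (rule integral_mono)
    show "integrable M (\<lambda>x. \<bar>u x * v x\<bar>)" by (intro integrable_abs L2_fun_mult_integrable u v)
    show "integrable M (\<lambda>x. (k * (u x)\<^sup>2 + (v x)\<^sup>2 / k) / 2)"
      by (intro integrable_divide Bochner_Integration.integrable_add integrable_mult_right L2_funD u v)
    fix x
    have "2 * (sqrt k * \<bar>u x\<bar>) * (\<bar>v x\<bar> / sqrt k) \<le> (sqrt k * \<bar>u x\<bar>)\<^sup>2 + (\<bar>v x\<bar> / sqrt k)\<^sup>2"
      by (rule sum_squares_bound)
    then show "\<bar>u x * v x\<bar> \<le> (k * (u x)\<^sup>2 + (v x)\<^sup>2 / k) / 2"
      using k by (simp add: power_mult_distrib power_divide abs_mult)
  qed
  also have "\<dots> = (k * L2_sq M u + L2_sq M v / k) / 2"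
    unfolding L2_sq_def using u v by (simp add: L2_funD)
  finally show ?thesis by (simp add: u_def[abs_def] v_def[abs_def])
qed

lemma L2_sq_tendsto:
  assumes f: "f \<in> L2_fun M" and g: "\<And>n. g n \<in> L2_fun M" and le: "\<And>n. L2_sq M (\<lambda>x. f x - g n x) \<le> (1/4)^n"
  shows "(\<lambda>n. L2_sq M (g n)) \<longlonglongrightarrow> L2_sq M f"
proof -
  have bound: "\<bar>L2_sq M f - L2_sq M (g n)\<bar> \<le> (1 + 2 * L2_sq M (\<lambda>x. 2 * f x) + 2) * (1/2)^n" for n
  proof -
    have "L2_sq M (\<lambda>x. f x + g n x) \<le> 2 * L2_sq M (\<lambda>x. 2 * f x) + 2 * L2_sq M (\<lambda>x. g n x - f x)"
      using L2_sq_add_le[of "\<lambda>x. 2 * f x" M "\<lambda>x. g n x - f x"] f g by (simp add: L2_fun_cmult L2_fun_diff)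
    also have "L2_sq M (\<lambda>x. g n x - f x) \<le> 1"
      using le[of n] power_le_one[of "1/4::real" n] by (simp add: L2_sq_commute[of M "g n"])
    finally have s: "L2_sq M (\<lambda>x. f x + g n x) \<le> 2 * L2_sq M (\<lambda>x. 2 * f x) + 2" by simp
    \<comment> \<open>The weight 2^n balances a squared distance of order 4^(-n) against a bounded
      second term.\<close>
    have "\<bar>L2_sq M f - L2_sq M (g n)\<bar> \<le> (2^n * L2_sq M (\<lambda>x. f x - g n x) + L2_sq M (\<lambda>x. f x + g n x) / 2^n) / 2"
      by (intro L2_sq_diff_le f g) simp
    also have "\<dots> \<le> (2^n * (1/4)^n + (2 * L2_sq M (\<lambda>x. 2 * f x) + 2) / 2^n) / 2"
      using le[of n] s by (intro divide_right_mono add_mono mult_left_mono) auto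
    also have "\<dots> = ((1 + 2 * L2_sq M (\<lambda>x. 2 * f x) + 2) * (1/2)^n) / 2"
      by (simp add: power_divide field_simps flip: power_mult_distrib)
    also have "\<dots> \<le> (1 + 2 * L2_sq M (\<lambda>x. 2 * f x) + 2) * (1/2)^n" by simp
    finally show ?thesis .
  qed
  have "(\<lambda>n. L2_sq M f - L2_sq M (g n)) \<longlonglongrightarrow> 0"
  proof (rule Lim_null_comparison)
    show "\<forall>\<^sub>F n in sequentially. norm (L2_sq M f - L2_sq M (g n)) \<le> (1 + 2 * L2_sq M (\<lambda>x. 2 * f x) + 2) * (1/2)^n"
      using bound by simp
    have "(\<lambda>n. (1 + 2 * L2_sq M (\<lambda>x. 2 * f x) + 2) * (1/2)^n) \<longlonglongrightarrow> (1 + 2 * L2_sq M (\<lambda>x. 2 * f x) + 2) * 0"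
      by (intro tendsto_intros LIMSEQ_power_zero) simp
    then show "(\<lambda>n. (1 + 2 * L2_sq M (\<lambda>x. 2 * f x) + 2) * (1/2)^n) \<longlonglongrightarrow> 0" by simp
  qed
  then have "(\<lambda>n. L2_sq M f - (L2_sq M f - L2_sq M (g n))) \<longlonglongrightarrow> L2_sq M f - 0" by (intro tendsto_diff tendsto_const)
  then show ?thesis by simp
qed

text \<open>The endpoint 0 is negligible, which reconciles the intervals [0, t] with the half-open
  ones on which the Wiener integral is prescribed.\<close>

lemma half_line_AE_pos: "AE x in half_line. 0 < x"
proof -
  have "AE x in lborel. x \<noteq> (0::real)" by (rule AE_lborel_singleton)
  then show ?thesis unfolding half_line_def
    by (subst AE_restrict_space_iff) (auto elim: eventually_mono)
qed

lemma indicator_interval: "0 \<le> s \<Longrightarrow> s \<le> t \<Longrightarrow> indicator {s<..t} = (\<lambda>x. time_ind t x - time_ind s x)"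
  by (auto simp: fun_eq_iff time_ind_def indicator_def)

definition tensor :: "(real \<Rightarrow> real) \<Rightarrow> real \<times> real \<Rightarrow> real" where
  "tensor h = (\<lambda>(x, y). h x * h y)"

lemma L2_sym_zero: "(\<lambda>x. 0) \<in> L2_sym" by (simp add: L2_sym_def)

lemma L2_sym_lin:
  assumes "f \<in> L2_sym" "g \<in> L2_sym" shows "(\<lambda>x. a * f x + b * g x) \<in> L2_sym"
proof -
  have "AE z in quadrant. f (fst z, snd z) = f (snd z, fst z)" "AE z in quadrant. g (fst z, snd z) = g (snd z, fst z)"
    using assms by (auto simp: L2_sym_def case_prod_beta')
  then have "AE z in quadrant. a * f (fst z, snd z) + b * g (fst z, snd z) = a * f (snd z, fst z) + b * g (snd z, fst z)"
    by eventually_elim simp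
  then show ?thesis using assms by (auto simp: L2_sym_def case_prod_beta')
qed

lemma tensor_L2_sym: "h \<in> L2_fun half_line \<Longrightarrow> tensor h \<in> L2_sym"
  unfolding L2_sym_def tensor_def using tensor_L2(1)[of h h] by (auto simp: mult.commute)

lemma L2_sym_subset: "L2_sym \<subseteq> L2_fun quadrant" by (auto simp: L2_sym_def)

text \<open>Telescoping: h \<otimes> h - g \<otimes> g = h \<otimes> (h - g) + (h - g) \<otimes> g,
  and norms of tensor products are multiplicative.\<close>

lemma L2_sq_tensor_diff:
  assumes g: "g \<in> L2_fun half_line" and h: "h \<in> L2_fun half_line"
  shows "L2_sq quadrant (\<lambda>z. tensor h z - tensor g z) \<le>
    2 * (L2_sq half_line h + L2_sq half_line g) * L2_sq half_line (\<lambda>x. h x - g x)"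
proof -
  have d: "(\<lambda>x. h x - g x) \<in> L2_fun half_line" using g h by auto
  have "L2_sq quadrant (\<lambda>z. (case z of (x, y) \<Rightarrow> h x * (h y - g y)) + (case z of (x, y) \<Rightarrow> (h x - g x) * g y))
    \<le> 2 * L2_sq quadrant (\<lambda>(x, y). h x * (h y - g y)) + 2 * L2_sq quadrant (\<lambda>(x, y). (h x - g x) * g y)"
    by (intro L2_sq_add_le tensor_L2 g h d)
  also have "\<dots> = 2 * (L2_sq half_line h + L2_sq half_line g) * L2_sq half_line (\<lambda>x. h x - g x)"
    using tensor_L2(2)[OF h d] tensor_L2(2)[OF d g] by (simp add: algebra_simps)
  finally show ?thesis by (simp add: tensor_def case_prod_beta' algebra_simps)
qed

lemma continuous_linear_L2_subset:
  "continuous_linear_L2 A V B T \<Longrightarrow> V' \<subseteq> V \<Longrightarrow> continuous_linear_L2 A V' B T"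
  unfolding continuous_linear_L2_def
proof (intro conjI ballI allI impI)
  fix f and \<epsilon> :: real
  assume "(\<forall>f\<in>V. T f \<in> L2_fun B) \<and>
     (\<forall>f\<in>V. \<forall>g\<in>V. \<forall>a b. AE \<omega> in B. T (\<lambda>x. a * f x + b * g x) \<omega> = a * T f \<omega> + b * T g \<omega>) \<and>
     (\<forall>f\<in>V. \<forall>\<epsilon>>0. \<exists>\<delta>>0. \<forall>g\<in>V. L2_norm A (\<lambda>x. g x - f x) < \<delta> \<longrightarrow> L2_norm B (\<lambda>\<omega>. T g \<omega> - T f \<omega>) < \<epsilon>)"
    and V: "V' \<subseteq> V" and f: "f \<in> V'" and \<epsilon>: "\<epsilon> > 0"
  then obtain \<delta> where "\<delta> > 0" "\<forall>g\<in>V. L2_norm A (\<lambda>x. g x - f x) < \<delta> \<longrightarrow> L2_norm B (\<lambda>\<omega>. T g \<omega> - T f \<omega>) < \<epsilon>"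
    by blast
  with V show "\<exists>\<delta>>0. \<forall>g\<in>V'. L2_norm A (\<lambda>x. g x - f x) < \<delta> \<longrightarrow> L2_norm B (\<lambda>\<omega>. T g \<omega> - T f \<omega>) < \<epsilon>"
    by blast
qed blast+

section \<open>Existence and values of the double Wiener integral\<close>

context brownian
begin

abbreviation "J \<equiv> wiener_integral M W"

lemma J_cl: "continuous_linear_L2 half_line (L2_fun half_line) M J"
  using wiener_integral by (simp add: is_wiener_integral_def)

lemma J_interval: "0 \<le> s \<Longrightarrow> s \<le> t \<Longrightarrow> AE \<omega> in M. J (indicator {s<..t}) \<omega> = W t \<omega> - W s \<omega>"
  using wiener_integral by (simp add: is_wiener_integral_def)

lemma J_time_ind:
  assumes "0 \<le> t" shows "AE \<omega> in M. J (time_ind t) \<omega> = W t \<omega>"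
proof -
  have "AE \<omega> in M. J (time_ind t) \<omega> = J (indicator {0<..t}) \<omega>"
  proof (rule continuous_linear_L2_cong[OF J_cl order_refl time_ind_L2])
    show "indicator {0<..t} \<in> L2_fun half_line"
      using assms by (subst indicator_interval) (auto intro!: time_ind_L2)
    show "AE x in half_line. time_ind t x = indicator {0<..t} x"
      using half_line_AE_pos by eventually_elim (auto simp: time_ind_def indicator_def)
  qed
  with J_interval[OF order_refl assms] W_0 show ?thesis by eventually_elim simp
qed

lemma J_lincomb:
  assumes "snd ` set xs \<subseteq> {0..}" shows "AE \<omega> in M. J (lincomb time_ind xs) \<omega> = lincomb W xs \<omega>"
proof -
  have "AE \<omega> in M. J (lincomb time_ind xs) \<omega> = lincomb (\<lambda>t. J (time_ind t)) xs \<omega>"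
  proof (rule conjunct2, rule continuous_linear_L2_lincomb[OF J_cl L2_fun_zero _ time_ind_L2 assms])
    show "(\<lambda>x. a * f x + b * g x) \<in> L2_fun half_line" if "f \<in> L2_fun half_line" "g \<in> L2_fun half_line" for f g a b
      using that by (intro L2_fun_add L2_fun_cmult)
  qed
  moreover have "AE \<omega> in M. lincomb (\<lambda>t. J (time_ind t)) xs \<omega> = lincomb W xs \<omega>"
    by (rule AE_lincomb_cong[OF _ assms]) (auto intro: J_time_ind)
  ultimately show ?thesis by eventually_elim simp
qed

lemma tensor_lincomb: "tensor (lincomb time_ind xs) = lincomb rect_ind (tensor_list xs xs)"
proof
  fix z :: "real \<times> real"
  show "tensor (lincomb time_ind xs) z = lincomb rect_ind (tensor_list xs xs) z"
    unfolding lincomb_tensor_list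
    using sum_list_tensor[of "\<lambda>s. time_ind s (fst z)" "\<lambda>s. time_ind s (snd z)" xs xs]
    by (simp add: tensor_def rect_ind_def case_prod_beta' lincomb_def)
qed

text \<open>For step functions the characterizing identity of the double integral is pure algebra:
  the product of the two sums minus the Gram form of the indicators.\<close>

lemma WW_tensor_lincomb:
  assumes "snd ` set xs \<subseteq> {0..}"
  shows "lincomb WW (tensor_list xs xs) \<omega> = (lincomb W xs \<omega>)\<^sup>2 - L2_sq half_line (lincomb time_ind xs)"
proof -
  have "lincomb WW (tensor_list xs xs) \<omega> =
    (\<Sum>(c, s)\<leftarrow>xs. c * (\<Sum>(c', t)\<leftarrow>xs. c' * (W s \<omega> * W t \<omega> - min s t)))"
    unfolding lincomb_tensor_list by (simp add: WW_def)
  also have "\<dots> = lincomb W xs \<omega> * lincomb W xs \<omega> - (\<Sum>(c, s)\<leftarrow>xs. c * (\<Sum>(c', t)\<leftarrow>xs. c' * min s t))"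
    unfolding sum_list_tensor_diff sum_list_tensor by (simp add: lincomb_def)
  also have "(\<Sum>(c, s)\<leftarrow>xs. c * (\<Sum>(c', t)\<leftarrow>xs. c' * min s t)) = (\<Sum>(c, s)\<leftarrow>xs. c * (\<Sum>(c', t)\<leftarrow>xs. c' * (\<integral>x. time_ind t x * time_ind s x \<partial>half_line)))"
  proof (intro sum_list_pair_cong)
    fix p q assume "p \<in> set xs" "q \<in> set xs"
    then have "snd p \<ge> 0" "snd q \<ge> 0" using assms by auto
    then show "min (snd p) (snd q) = (\<integral>x. time_ind (snd q) x * time_ind (snd p) x \<partial>half_line)"
      by (simp add: integral_time_ind min.commute)
  qed
  also have "\<dots> = L2_sq half_line (lincomb time_ind xs)"
    by (rule L2_sq_lincomb[OF time_ind_L2 assms, symmetric])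
  finally show ?thesis by (simp add: power2_eq_square)
qed

lemma WW_L2: "p \<in> nonneg_pairs \<Longrightarrow> WW p \<in> L2_fun M"
  using double_integral_bound(1)[of "[(1, p)]"] by (simp add: lincomb_def[abs_def])

text \<open>Rectangles, although not symmetric, are a convenient dense family, so the map is built
  on all of L2 of the quadrant and then restricted. Its value at h \<otimes> h is found for step
  functions and carried over by almost sure limits, because squaring does not map L2 into
  itself.\<close>

theorem double_wiener_integral_exists: "\<exists>I. is_double_wiener_integral M W I"
proof -
  have "\<exists>T. continuous_linear_L2 quadrant (L2_fun quadrant) M T \<and>
    (\<forall>xs. snd ` set xs \<subseteq> nonneg_pairs \<longrightarrow> (AE \<omega> in M. T (lincomb rect_ind xs) \<omega> = lincomb WW xs \<omega>))"
    by (rule L2_extension[where C=2]) (auto intro: rect_ind_L2 WW_L2 L2_dense_quadrant double_integral_bound(2))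
  then obtain T where T: "continuous_linear_L2 quadrant (L2_fun quadrant) M T"
    "\<And>xs. snd ` set xs \<subseteq> nonneg_pairs \<Longrightarrow> AE \<omega> in M. T (lincomb rect_ind xs) \<omega> = lincomb WW xs \<omega>" by blast
  have "AE \<omega> in M. T (tensor h) \<omega> = (J h \<omega>)\<^sup>2 - (\<integral>t. (h t)\<^sup>2 \<partial>half_line)" if h: "h \<in> L2_fun half_line" for h
  proof -
    have hh: "tensor h \<in> L2_fun quadrant" using tensor_L2_sym[OF h] L2_sym_subset by auto
    \<comment> \<open>One step function has to approximate h, its Wiener integral and the image of
      its tensor square simultaneously, at geometric rates that give almost sure
      convergence.\<close>
    define P where "P n xs \<longleftrightarrow> snd ` set xs \<subseteq> {0..} \<and> L2_sq half_line (\<lambda>x. h x - lincomb time_ind xs x) \<le> (1/4)^n \<and>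
      L2_sq M (\<lambda>\<omega>. J h \<omega> - J (lincomb time_ind xs) \<omega>) \<le> 1 * (1/2)^n \<and>
      L2_sq M (\<lambda>\<omega>. T (tensor h) \<omega> - T (tensor (lincomb time_ind xs)) \<omega>) \<le> 1 * (1/2)^n" for n :: nat and xs
    have "\<exists>xs. P n xs" for n
    proof -
      have pos: "(1/2::real)^n > 0" by simp
      from continuous_linear_L2_cont[OF J_cl h pos] obtain \<delta>1 where \<delta>1: "\<delta>1 > 0"
        "\<And>g. g \<in> L2_fun half_line \<Longrightarrow> L2_sq half_line (\<lambda>x. h x - g x) < \<delta>1 \<Longrightarrow> L2_sq M (\<lambda>\<omega>. J h \<omega> - J g \<omega>) < (1/2)^n" by blast
      from continuous_linear_L2_cont[OF T(1) hh pos] obtain \<delta>2 where \<delta>2: "\<delta>2 > 0"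
        "\<And>g. g \<in> L2_fun quadrant \<Longrightarrow> L2_sq quadrant (\<lambda>x. tensor h x - g x) < \<delta>2 \<Longrightarrow> L2_sq M (\<lambda>\<omega>. T (tensor h) \<omega> - T g \<omega>) < (1/2)^n" by blast
      \<comment> \<open>If the squared distance of g to h is below 1, the squared norm of g is at
        most twice that of h plus 2; so \<open>K\<close> dominates the factor in
        \<open>L2_sq_tensor_diff\<close>.\<close>
      define K where "K = 6 * L2_sq half_line h + 5"
      have K: "K > 0" using L2_sq_nonneg[of half_line h] unfolding K_def by linarith
      \<comment> \<open>In turn: a bounded norm of g, the rate for the norms, and the moduli of
        continuity of \<open>J\<close> and \<open>T\<close>.\<close>
      define \<delta> where "\<delta> = min (min 1 ((1/4)^n)) (min \<delta>1 (\<delta>2 / K))"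
      have "\<delta> > 0" using \<delta>1 \<delta>2 K by (simp add: \<delta>_def)
      then obtain xs where xs: "snd ` set xs \<subseteq> {0..}" "L2_sq half_line (\<lambda>x. h x - lincomb time_ind xs x) < \<delta>"
        using L2_dense_half_line[OF h] unfolding L2_dense_def by blast
      define g where "g = lincomb time_ind xs"
      have g: "g \<in> L2_fun half_line" unfolding g_def using xs by (intro L2_fun_lincomb[where I="{0..}"] time_ind_L2)
      have small: "L2_sq half_line (\<lambda>x. h x - g x) < 1" "L2_sq half_line (\<lambda>x. h x - g x) < (1/4)^n"
        "L2_sq half_line (\<lambda>x. h x - g x) < \<delta>1" "L2_sq half_line (\<lambda>x. h x - g x) < \<delta>2 / K"
        using xs(2) by (simp_all add: \<delta>_def g_def)
      have "L2_sq half_line (\<lambda>x. h x + (g x - h x)) \<le> 2 * L2_sq half_line h + 2 * L2_sq half_line (\<lambda>x. g x - h x)"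
        using g h by (intro L2_sq_add_le) auto
      then have "L2_sq half_line g \<le> 2 * L2_sq half_line h + 2"
        using small(1) by (simp add: L2_sq_commute[of half_line g])
      moreover have "2 * (a + b) \<le> 6 * a + 5" if "b \<le> 2 * a + 2" "0 \<le> a" for a b :: real using that by argo
      ultimately have "2 * (L2_sq half_line h + L2_sq half_line g) \<le> K" by (simp add: K_def)
      then have "L2_sq quadrant (\<lambda>z. tensor h z - tensor g z) \<le> K * L2_sq half_line (\<lambda>x. h x - g x)"
        by (intro order_trans[OF L2_sq_tensor_diff[OF g h]] mult_right_mono) auto
      also have "\<dots> < \<delta>2" using small(4) K by (simp add: field_simps)
      finally have "L2_sq quadrant (\<lambda>z. tensor h z - tensor g z) < \<delta>2" .
      moreover have "tensor g \<in> L2_fun quadrant" using tensor_L2_sym[OF g] L2_sym_subset by auto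
      ultimately have "L2_sq M (\<lambda>\<omega>. T (tensor h) \<omega> - T (tensor g) \<omega>) < (1/2)^n" using \<delta>2 by blast
      moreover have "L2_sq M (\<lambda>\<omega>. J h \<omega> - J g \<omega>) < (1/2)^n" using \<delta>1(2) g small by blast
      ultimately show ?thesis using xs(1) small(2) unfolding g_def P_def by (intro exI[of _ xs]) simp
    qed
    then obtain X where "\<And>n. P n (X n)" by metis
    then have X: "\<And>n. snd ` set (X n) \<subseteq> {0..}"
      and X1: "\<And>n. L2_sq half_line (\<lambda>x. h x - lincomb time_ind (X n) x) \<le> (1/4)^n"
      and X2: "\<And>n. L2_sq M (\<lambda>\<omega>. J h \<omega> - J (lincomb time_ind (X n)) \<omega>) \<le> 1 * (1/2)^n"
      and X3: "\<And>n. L2_sq M (\<lambda>\<omega>. T (tensor h) \<omega> - T (tensor (lincomb time_ind (X n))) \<omega>) \<le> 1 * (1/2)^n"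
      unfolding P_def by blast+
    have g: "lincomb time_ind (X n) \<in> L2_fun half_line" for n using X by (intro L2_fun_lincomb[where I="{0..}"] time_ind_L2)
    have gg: "tensor (lincomb time_ind (X n)) \<in> L2_fun quadrant" for n using tensor_L2_sym[OF g[of n]] L2_sym_subset by auto
    have l1: "(\<lambda>n. L2_sq half_line (lincomb time_ind (X n))) \<longlonglongrightarrow> L2_sq half_line h"
      by (rule L2_sq_tendsto[OF h g X1])
    have l2: "AE \<omega> in M. (\<lambda>n. J (lincomb time_ind (X n)) \<omega>) \<longlonglongrightarrow> J h \<omega>"
    proof (rule L2_fast_convergence_AE_0)
      show "L2_sq M (\<lambda>x. J (lincomb time_ind (X n)) x - J h x) \<le> 1 * (1/2)^n" for n
        using X2[of n] by (simp add: L2_sq_commute[of M "J h"])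
    qed (auto intro: continuous_linear_L2_fun[OF J_cl] g h)
    have l3: "AE \<omega> in M. (\<lambda>n. T (tensor (lincomb time_ind (X n))) \<omega>) \<longlonglongrightarrow> T (tensor h) \<omega>"
    proof (rule L2_fast_convergence_AE_0)
      show "L2_sq M (\<lambda>x. T (tensor (lincomb time_ind (X n))) x - T (tensor h) x) \<le> 1 * (1/2)^n" for n
        using X3[of n] by (simp add: L2_sq_commute[of M "T (tensor h)"])
    qed (auto intro: continuous_linear_L2_fun[OF T(1)] gg hh)
    have "AE \<omega> in M. T (tensor (lincomb time_ind (X n))) \<omega> = (J (lincomb time_ind (X n)) \<omega>)\<^sup>2 - L2_sq half_line (lincomb time_ind (X n))" for n
      using T(2)[OF tensor_list_subset[OF X[of n] X[of n]]] J_lincomb[OF X[of n]]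
      unfolding tensor_lincomb by eventually_elim (simp add: WW_tensor_lincomb[OF X])
    then have "AE \<omega> in M. \<forall>n. T (tensor (lincomb time_ind (X n))) \<omega> = (J (lincomb time_ind (X n)) \<omega>)\<^sup>2 - L2_sq half_line (lincomb time_ind (X n))"
      by (simp add: AE_all_countable)
    with l2 l3 show ?thesis
    proof eventually_elim
      case (elim \<omega>)
      have "(\<lambda>n. (J (lincomb time_ind (X n)) \<omega>)\<^sup>2 - L2_sq half_line (lincomb time_ind (X n))) \<longlonglongrightarrow> (J h \<omega>)\<^sup>2 - L2_sq half_line h"
        by (intro tendsto_intros elim l1)
      moreover have "(\<lambda>n. (J (lincomb time_ind (X n)) \<omega>)\<^sup>2 - L2_sq half_line (lincomb time_ind (X n))) \<longlonglongrightarrow> T (tensor h) \<omega>"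
        using elim by simp
      ultimately show ?case unfolding L2_sq_def[of half_line h] by (rule LIMSEQ_unique[rotated])
    qed
  qed
  then show ?thesis
    using continuous_linear_L2_subset[OF T(1) L2_sym_subset]
    unfolding is_double_wiener_integral_def tensor_def by blast
qed

abbreviation "I2 \<equiv> double_wiener_integral M W"

lemma I2: "is_double_wiener_integral M W I2"
  unfolding double_wiener_integral_def using double_wiener_integral_exists by (rule someI_ex)

lemma I2_cl: "continuous_linear_L2 quadrant L2_sym M I2"
  using I2 by (simp add: is_double_wiener_integral_def)

lemma I2_tensor: "h \<in> L2_fun half_line \<Longrightarrow> AE \<omega> in M. I2 (tensor h) \<omega> = (J h \<omega>)\<^sup>2 - L2_sq half_line h"
  using I2 unfolding is_double_wiener_integral_def tensor_def L2_sq_def by blast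

lemma I2_lincomb:
  assumes "\<And>i. i \<in> I \<Longrightarrow> d i \<in> L2_sym" "snd ` set xs \<subseteq> I"
  shows "lincomb d xs \<in> L2_sym" "AE \<omega> in M. I2 (lincomb d xs) \<omega> = lincomb (\<lambda>i. I2 (d i)) xs \<omega>"
proof -
  note c = continuous_linear_L2_lincomb[OF I2_cl L2_sym_zero L2_sym_lin assms]
  show "lincomb d xs \<in> L2_sym" by (rule c[THEN conjunct1])
  show "AE \<omega> in M. I2 (lincomb d xs) \<omega> = lincomb (\<lambda>i. I2 (d i)) xs \<omega>" by (rule c[THEN conjunct2])
qed

definition sym_rect :: "real \<times> real \<Rightarrow> real \<times> real \<Rightarrow> real" where
  "sym_rect p z = (rect_ind p z + rect_ind p (snd z, fst z)) / 2"

text \<open>Polarization: with u the sum of the two indicators, the symmetrized rectangle is half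
  the difference between u \<otimes> u and the tensor squares of the indicators. This derives values
  at rectangles from the prescribed values at h \<otimes> h.\<close>

lemma I2_sym_rect:
  assumes p: "p \<in> nonneg_pairs"
  shows "sym_rect p \<in> L2_sym" "AE \<omega> in M. I2 (sym_rect p) \<omega> = WW p \<omega>"
proof -
  obtain s t where st: "p = (s, t)" "0 \<le> s" "0 \<le> t" using p by (cases p) auto
  define u where "u = lincomb time_ind [(1, s), (1, t)]"
  have ust: "snd ` set [(1, s), (1, t)] \<subseteq> {0..}" using st by auto
  have u: "u \<in> L2_fun half_line" unfolding u_def using st by (intro L2_fun_lincomb[where I="{0..}"] time_ind_L2) auto
  define xs where "xs = [(1/2::real, u), (-1/2, time_ind s), (-1/2, time_ind t)]"
  have xs: "snd ` set xs \<subseteq> L2_fun half_line" by (auto simp: xs_def u time_ind_L2)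
  have eq: "sym_rect p = lincomb tensor xs"
    by (auto simp: fun_eq_iff xs_def sym_rect_def rect_ind_def tensor_def u_def st algebra_simps)
  have L: "lincomb tensor xs \<in> L2_sym" "AE \<omega> in M. I2 (lincomb tensor xs) \<omega> = lincomb (\<lambda>h. I2 (tensor h)) xs \<omega>"
    using I2_lincomb[of "L2_fun half_line" tensor xs] tensor_L2_sym xs by blast+
  show "sym_rect p \<in> L2_sym" unfolding eq by (rule L(1))
  have "(\<integral>x. (u x)\<^sup>2 \<partial>half_line) = (\<integral>x. time_ind s x * time_ind s x + 2 * (time_ind s x * time_ind t x) + time_ind t x * time_ind t x \<partial>half_line)"
    by (simp add: u_def power2_eq_square algebra_simps)
  also have "\<dots> = s + 2 * min s t + t" using st by (simp add: integral_time_ind)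
  finally have N: "L2_sq half_line u = s + 2 * min s t + t" by (simp add: L2_sq_def)
  have Ns: "L2_sq half_line (time_ind r) = r" if "0 \<le> r" for r
    using integral_time_ind(2)[OF that that] by (simp add: L2_sq_def power2_eq_square)
  have "AE \<omega> in M. J u \<omega> = W s \<omega> + W t \<omega>" using J_lincomb[OF ust] by (simp add: u_def)
  with L(2) I2_tensor[OF u] I2_tensor[OF time_ind_L2[of s]] I2_tensor[OF time_ind_L2[of t]]
    J_time_ind[OF st(2)] J_time_ind[OF st(3)]
  show "AE \<omega> in M. I2 (sym_rect p) \<omega> = WW p \<omega>" unfolding eq
  proof eventually_elim
    case (elim \<omega>)
    have "I2 (lincomb tensor xs) \<omega> = ((W s \<omega> + W t \<omega>)\<^sup>2 - (s + 2 * min s t + t)) / 2 - ((W s \<omega>)\<^sup>2 - s) / 2 - ((W t \<omega>)\<^sup>2 - t) / 2"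
      unfolding elim(1) using elim(2-) st by (simp add: xs_def N Ns)
    also have "\<dots> = WW p \<omega>" by (simp add: WW_def st power2_eq_square field_simps)
    finally show ?case .
  qed
qed

text \<open>Since f is symmetric, symmetrizing an approximating combination of rectangles does not
  increase its distance bound, by convexity of the square and invariance of the measure under
  exchange of coordinates. The symmetrized combination has double integral
  \<open>lincomb WW xs\<close>, whose law is known.\<close>

lemma I2_approx:
  assumes f: "f \<in> L2_sym" and \<epsilon>: "\<epsilon> > 0"
  shows "\<exists>xs. snd ` set xs \<subseteq> nonneg_pairs \<and> L2_sq M (\<lambda>\<omega>. I2 f \<omega> - lincomb WW xs \<omega>) < \<epsilon>"
proof -
  interpret hl: pair_sigma_finite half_line half_line by (rule pair_sigma_finite_half_line)
  from continuous_linear_L2_cont[OF I2_cl f \<epsilon>] obtain \<delta> where \<delta>: "\<delta> > 0"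
    "\<And>g. g \<in> L2_sym \<Longrightarrow> L2_sq quadrant (\<lambda>x. f x - g x) < \<delta> \<Longrightarrow> L2_sq M (\<lambda>\<omega>. I2 f \<omega> - I2 g \<omega>) < \<epsilon>" by blast
  have fL: "f \<in> L2_fun quadrant" using f L2_sym_subset by auto
  obtain xs where xs: "snd ` set xs \<subseteq> nonneg_pairs" "L2_sq quadrant (\<lambda>z. f z - lincomb rect_ind xs z) < \<delta>"
    using L2_dense_quadrant[OF fL] \<delta>(1) unfolding L2_dense_def by blast
  define R where "R z = f z - lincomb rect_ind xs z" for z
  have RL: "R \<in> L2_fun quadrant" unfolding R_def using xs
    by (intro L2_fun_diff fL L2_fun_lincomb[where I=nonneg_pairs] rect_ind_L2)
  have swap: "(\<integral>z. h (snd z, fst z) \<partial>quadrant) = (\<integral>z. h z \<partial>quadrant)"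
    if "h \<in> borel_measurable quadrant" for h :: "real \<times> real \<Rightarrow> real"
    using hl.integral_product_swap[of h] that by (simp add: quadrant_def case_prod_beta')
  have swap_int: "integrable quadrant (\<lambda>z. h (snd z, fst z))" if "integrable quadrant h" for h :: "real \<times> real \<Rightarrow> real"
    using hl.integrable_product_swap[of h] that by (simp add: quadrant_def case_prod_beta')
  have R2: "integrable quadrant (\<lambda>z. (R z)\<^sup>2)" using RL by (rule L2_funD)
  have symsum: "lincomb sym_rect xs z = (lincomb rect_ind xs z + lincomb rect_ind xs (snd z, fst z)) / 2" for z
    by (induction xs) (auto simp: sym_rect_def algebra_simps add_divide_distrib)
  have L: "lincomb sym_rect xs \<in> L2_sym" "AE \<omega> in M. I2 (lincomb sym_rect xs) \<omega> = lincomb (\<lambda>i. I2 (sym_rect i)) xs \<omega>"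
    using I2_lincomb[of nonneg_pairs sym_rect xs] I2_sym_rect xs(1) by blast+
  have "AE z in quadrant. f z = f (snd z, fst z)" using f by (simp add: L2_sym_def case_prod_beta')
  then have "AE z in quadrant. (f z - lincomb sym_rect xs z)\<^sup>2 \<le> ((R z)\<^sup>2 + (R (snd z, fst z))\<^sup>2) / 2"
  proof eventually_elim
    case (elim z)
    have e: "f z - lincomb sym_rect xs z = (R z + R (snd z, fst z)) / 2" using elim unfolding symsum R_def by (simp add: field_simps)
    show ?case unfolding e by (rule mean_square_le)
  qed
  moreover have "integrable quadrant (\<lambda>z. (f z - lincomb sym_rect xs z)\<^sup>2)"
    using fL L(1) L2_sym_subset by (intro L2_funD L2_fun_diff) auto
  ultimately have "L2_sq quadrant (\<lambda>z. f z - lincomb sym_rect xs z) \<le> (\<integral>z. ((R z)\<^sup>2 + (R (snd z, fst z))\<^sup>2) / 2 \<partial>quadrant)"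
    unfolding L2_sq_def using R2 swap_int[OF R2] by (intro integral_mono_AE) auto
  also have "\<dots> = L2_sq quadrant R"
    using R2 swap_int[OF R2] swap[of "\<lambda>z. (R z)\<^sup>2"] by (simp add: L2_sq_def)
  also have "\<dots> < \<delta>" using xs(2) by (simp add: R_def[abs_def])
  finally have "L2_sq M (\<lambda>\<omega>. I2 f \<omega> - I2 (lincomb sym_rect xs) \<omega>) < \<epsilon>" using \<delta>(2) L(1) by blast
  moreover have "L2_sq M (\<lambda>\<omega>. I2 f \<omega> - I2 (lincomb sym_rect xs) \<omega>) = L2_sq M (\<lambda>\<omega>. I2 f \<omega> - lincomb WW xs \<omega>)"
  proof (rule L2_sq_cong_AE)
    note m = continuous_linear_L2_fun[OF I2_cl, THEN L2_funD(1)]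
    show "(\<lambda>\<omega>. I2 f \<omega> - I2 (lincomb sym_rect xs) \<omega>) \<in> borel_measurable M"
      by (intro borel_measurable_diff m f L)
    show "(\<lambda>\<omega>. I2 f \<omega> - lincomb WW xs \<omega>) \<in> borel_measurable M"
      using double_integral_bound(1)[OF xs(1)] by (intro borel_measurable_diff m f L2_funD(1))
    have "AE \<omega> in M. lincomb (\<lambda>i. I2 (sym_rect i)) xs \<omega> = lincomb WW xs \<omega>"
      using I2_sym_rect(2) xs(1) by (intro AE_lincomb_cong) auto
    with L(2) show "AE \<omega> in M. I2 f \<omega> - I2 (lincomb sym_rect xs) \<omega> = I2 f \<omega> - lincomb WW xs \<omega>"
      by eventually_elim simp
  qed
  ultimately show ?thesis using xs(1) by auto
qed

end

section \<open>Weak limits of double Wiener integrals\<close>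

lemma cmod_iexp_diff_le: "cmod (iexp a - iexp b) \<le> \<bar>a - b\<bar>"
proof -
  have "iexp a - iexp b = iexp b * (iexp (a - b) - 1)"
    by (simp add: algebra_simps flip: exp_add)
  then have "cmod (iexp a - iexp b) = cmod (iexp (a - b) - 1)"
    by (simp add: norm_mult)
  also have "\<dots> \<le> \<bar>a - b\<bar>" using iexp_approx1[of "a - b" 0] by simp
  finally show ?thesis .
qed

text \<open>Nonnegativity of the variance of |X|.\<close>

lemma (in prob_space) expectation_abs_le_L2_norm:
  assumes "X \<in> L2_fun M"
  shows "integrable M (\<lambda>\<omega>. \<bar>X \<omega>\<bar>)" "(\<integral>\<omega>. \<bar>X \<omega>\<bar> \<partial>M) \<le> sqrt (L2_sq M X)"
proof -
  have "integrable M (\<lambda>\<omega>. 1 * X \<omega>)"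
    using assms by (intro L2_fun_mult_integrable) (auto simp: L2_fun_def)
  then show i: "integrable M (\<lambda>\<omega>. \<bar>X \<omega>\<bar>)" by simp
  have "0 \<le> variance (\<lambda>\<omega>. \<bar>X \<omega>\<bar>)" by (rule variance_positive)
  also have "\<dots> = expectation (\<lambda>\<omega>. \<bar>X \<omega>\<bar>\<^sup>2) - (expectation (\<lambda>\<omega>. \<bar>X \<omega>\<bar>))\<^sup>2"
    using assms by (intro variance_eq i) (auto simp: L2_funD)
  finally have "(expectation (\<lambda>\<omega>. \<bar>X \<omega>\<bar>))\<^sup>2 \<le> L2_sq M X" by (simp add: L2_sq_def)
  then show "(\<integral>\<omega>. \<bar>X \<omega>\<bar> \<partial>M) \<le> sqrt (L2_sq M X)" by (rule real_le_rsqrt)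
qed

text \<open>The exponential is Lipschitz on the imaginary axis. Through this bound every L2
  approximation of a double integral becomes an approximation of its law.\<close>

lemma (in prob_space) char_distr_diff_le:
  assumes "X \<in> borel_measurable M" "Y \<in> borel_measurable M" "(\<lambda>\<omega>. X \<omega> - Y \<omega>) \<in> L2_fun M"
  shows "cmod (char (distr M borel X) t - char (distr M borel Y) t) \<le> \<bar>t\<bar> * sqrt (L2_sq M (\<lambda>\<omega>. X \<omega> - Y \<omega>))"
proof -
  note [measurable] = assms(1,2)
  have i: "integrable M (\<lambda>\<omega>. iexp (t * Z \<omega>))" if "Z \<in> borel_measurable M" for Z
    using that by (intro integrable_iexp) auto
  have "cmod (char (distr M borel X) t - char (distr M borel Y) t) = cmod (\<integral>\<omega>. iexp (t * X \<omega>) - iexp (t * Y \<omega>) \<partial>M)"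
    using i[OF assms(1)] i[OF assms(2)] by (simp add: char_distr assms)
  also have "\<dots> \<le> (\<integral>\<omega>. cmod (iexp (t * X \<omega>) - iexp (t * Y \<omega>)) \<partial>M)" by (rule integral_norm_bound)
  also have "\<dots> \<le> (\<integral>\<omega>. \<bar>t\<bar> * \<bar>X \<omega> - Y \<omega>\<bar> \<partial>M)"
  proof (rule integral_mono)
    show "integrable M (\<lambda>\<omega>. cmod (iexp (t * X \<omega>) - iexp (t * Y \<omega>)))"
      by (intro integrable_norm Bochner_Integration.integrable_diff i assms)
    show "integrable M (\<lambda>\<omega>. \<bar>t\<bar> * \<bar>X \<omega> - Y \<omega>\<bar>)"
      by (intro integrable_mult_right expectation_abs_le_L2_norm assms)
    show "cmod (iexp (t * X \<omega>) - iexp (t * Y \<omega>)) \<le> \<bar>t\<bar> * \<bar>X \<omega> - Y \<omega>\<bar>" for \<omega>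
      using cmod_iexp_diff_le[of "t * X \<omega>" "t * Y \<omega>"] by (simp add: abs_mult flip: right_diff_distrib)
  qed
  also have "\<dots> = \<bar>t\<bar> * (\<integral>\<omega>. \<bar>X \<omega> - Y \<omega>\<bar> \<partial>M)" by simp
  also have "\<dots> \<le> \<bar>t\<bar> * sqrt (L2_sq M (\<lambda>\<omega>. X \<omega> - Y \<omega>))"
    by (intro mult_left_mono expectation_abs_le_L2_norm assms) simp
  finally show ?thesis .
qed

text \<open>The law is the image of the standard normal law under multiplication by sqrt v. For v =
  0 this image is the Dirac mass, so one computation covers both cases of the definition.\<close>

lemma normal_law_facts:
  assumes "v \<ge> 0"
  shows "prob_space (normal_law 0 v)" "sets (normal_law 0 v) = sets borel" "space (normal_law 0 v) = UNIV"
    "char (normal_law 0 v) t = complex_of_real (exp (- v * t\<^sup>2 / 2))"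
proof -
  interpret S: prob_space std_normal_distribution by (rule prob_space_std_normal)
  have *: "normal_law 0 v = distr std_normal_distribution borel (\<lambda>x. sqrt v * x)"
  proof (cases "v = 0")
    case True
    then show ?thesis using S.distr_const[of "0::real" borel] by (simp add: normal_law_def)
  next
    case False
    then have v: "v > 0" using assms by simp
    have "distr std_normal_distribution lborel (\<lambda>x. x) = std_normal_distribution"
      by (rule distr_id2) simp
    then have "distributed std_normal_distribution lborel (\<lambda>x. x) (normal_density 0 1)"
      by (auto simp: distributed_def)
    from S.normal_density_affine[OF this, of "sqrt v" 0] v
    have "distr std_normal_distribution lborel (\<lambda>x. sqrt v * x) = density lborel (\<lambda>x. ennreal (normal_density 0 (sqrt v) x))"
      by (simp add: distributed_def)
    moreover have "distr std_normal_distribution lborel (\<lambda>x. sqrt v * x) = distr std_normal_distribution borel (\<lambda>x. sqrt v * x)"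
      by (rule distr_cong) auto
    ultimately show ?thesis using False by (simp add: normal_law_def)
  qed
  show "prob_space (normal_law 0 v)" unfolding * by (rule S.prob_space_distr) simp
  show "sets (normal_law 0 v) = sets borel" "space (normal_law 0 v) = UNIV" unfolding * by simp_all
  have "char (normal_law 0 v) t = (\<integral>x. iexp (t * (sqrt v * x)) \<partial>std_normal_distribution)"
    unfolding * by (rule S.char_distr) simp
  also have "\<dots> = char std_normal_distribution (t * sqrt v)" by (simp add: char_def mult_ac)
  also have "\<dots> = complex_of_real (exp (- v * t\<^sup>2 / 2))"
    using assms by (simp add: char_std_normal_distribution power_mult_distrib mult_ac)
  finally show "char (normal_law 0 v) t = complex_of_real (exp (- v * t\<^sup>2 / 2))" .
qed

section \<open>Kernels built from diagonal unit squares\<close>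

definition block :: "nat \<Rightarrow> real \<times> real \<Rightarrow> real" where
  "block k = tensor (indicator {real k<..real (Suc k)})"

text \<open>The supports are disjoint squares along the diagonal. At each point a series of blocks
  thus has at most one nonzero term, which removes all questions of pointwise convergence and all
  cross terms of squares.\<close>

lemma block_disjoint: "(\<forall>k. block k z = 0) \<or> (\<exists>k0. \<forall>k. block k z = (if k = k0 then 1 else 0))"
proof (cases "\<exists>k. block k z \<noteq> 0")
  case True
  then obtain k0 where k0: "block k0 z \<noteq> 0" by blast
  obtain x y where z: "z = (x, y)" by (cases z)
  have x: "real k0 < x" "x \<le> real (Suc k0)" and y: "real k0 < y" "y \<le> real (Suc k0)"
    using k0 by (auto simp: block_def tensor_def z indicator_def split: if_splits)
  have "block k z = (if k = k0 then 1 else 0)" for k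
  proof (cases "k = k0")
    case True
    then show ?thesis using x y by (simp add: block_def tensor_def z indicator_def)
  next
    case False
    have "\<not> (real k < x \<and> x \<le> real (Suc k))"
    proof
      assume "real k < x \<and> x \<le> real (Suc k)"
      then have "real k < real (Suc k0)" "real k0 < real (Suc k)" using x by linarith+
      then show False using False by simp
    qed
    then show ?thesis using False by (auto simp: block_def tensor_def z indicator_def)
  qed
  then show ?thesis by blast
qed auto

lemma block_ind_L2: "indicator {real k<..real (Suc k)} \<in> L2_fun half_line"
  by (subst indicator_interval) (auto intro!: L2_fun_diff time_ind_L2)

lemma block_ind_sq: "L2_sq half_line (indicator {real k<..real (Suc k)}) = 1"
proof -
  have "L2_sq half_line (indicator {real k<..real (Suc k)}) = (\<integral>x. time_ind (real (Suc k)) x * time_ind (real (Suc k)) x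
     - 2 * (time_ind (real k) x * time_ind (real (Suc k)) x) + time_ind (real k) x * time_ind (real k) x \<partial>half_line)"
    unfolding L2_sq_def by (subst indicator_interval) (auto simp: power2_eq_square algebra_simps)
  also have "\<dots> = 1" by (simp add: integral_time_ind del: of_nat_Suc)
  finally show ?thesis .
qed

definition block_series :: "(nat \<Rightarrow> real) \<Rightarrow> real \<times> real \<Rightarrow> real" where
  "block_series \<mu> z = (\<Sum>k. \<mu> k * block k z)"

lemma block_sym: "block k \<in> L2_sym"
  unfolding block_def by (intro tensor_L2_sym block_ind_L2)

lemma block_series_sums: "(\<lambda>K. \<Sum>k<K. \<mu> k * block k z) \<longlonglongrightarrow> block_series \<mu> z"
  and block_partial_le: "\<bar>\<Sum>k<K. \<mu> k * block k z\<bar> \<le> \<bar>block_series \<mu> z\<bar>"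
  and block_partial_square: "(\<Sum>k<K. \<mu> k * block k z)\<^sup>2 = (\<Sum>k<K. (\<mu> k)\<^sup>2 * (block k z)\<^sup>2)"
proof -
  have "(\<lambda>k. \<mu> k * block k z) sums block_series \<mu> z \<and> \<bar>\<Sum>k<K. \<mu> k * block k z\<bar> \<le> \<bar>block_series \<mu> z\<bar> \<and>
    (\<Sum>k<K. \<mu> k * block k z)\<^sup>2 = (\<Sum>k<K. (\<mu> k)\<^sup>2 * (block k z)\<^sup>2)"
  proof (cases "\<forall>k. block k z = 0")
    case True
    then show ?thesis by (simp add: block_series_def)
  next
    case False
    then obtain k0 where k0: "\<And>k. block k z = (if k = k0 then 1 else 0)" using block_disjoint[of z] by blast
    have e: "(\<lambda>k. \<mu> k * block k z) = (\<lambda>k. if k = k0 then \<mu> k else 0)" by (auto simp: k0)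
    have s: "(\<lambda>k. \<mu> k * block k z) sums \<mu> k0" unfolding e by (rule sums_single)
    have p: "(\<Sum>k<K. \<mu> k * block k z) = (if k0 < K then \<mu> k0 else 0)" unfolding e by simp
    have "(\<Sum>k<K. (\<mu> k)\<^sup>2 * (block k z)\<^sup>2) = (\<Sum>k<K. if k = k0 then (\<mu> k)\<^sup>2 else 0)"
      by (intro sum.cong) (auto simp: k0)
    then have "(\<Sum>k<K. (\<mu> k)\<^sup>2 * (block k z)\<^sup>2) = (if k0 < K then (\<mu> k0)\<^sup>2 else 0)" by simp
    then show ?thesis using s p sums_unique[OF s] by (auto simp: block_series_def)
  qed
  then show "(\<lambda>K. \<Sum>k<K. \<mu> k * block k z) \<longlonglongrightarrow> block_series \<mu> z"
    "\<bar>\<Sum>k<K. \<mu> k * block k z\<bar> \<le> \<bar>block_series \<mu> z\<bar>"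
    "(\<Sum>k<K. \<mu> k * block k z)\<^sup>2 = (\<Sum>k<K. (\<mu> k)\<^sup>2 * (block k z)\<^sup>2)"
    by (auto simp: sums_def)
qed

text \<open>The squared partial sums increase and integrate to the partial sums of \<mu>_k^2, so
  monotone convergence gives square integrability. The series then dominates its own partial sums,
  and dominated convergence gives the L2 limit.\<close>

lemma block_series_L2:
  assumes \<mu>: "summable (\<lambda>k. (\<mu> k)\<^sup>2)"
  shows "block_series \<mu> \<in> L2_sym"
    "(\<lambda>K. L2_sq quadrant (\<lambda>z. block_series \<mu> z - (\<Sum>k<K. \<mu> k * block k z))) \<longlonglongrightarrow> 0"
proof -
  have bL: "block k \<in> L2_fun quadrant" for k using block_sym L2_sym_subset by auto
  note [measurable] = bL[THEN L2_funD(1)]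
  have bsq: "(\<integral>z. (block k z)\<^sup>2 \<partial>quadrant) = 1" for k
    using tensor_L2(2)[OF block_ind_L2 block_ind_L2, of k k] unfolding block_ind_sq
    by (simp add: block_def tensor_def L2_sq_def)
  have meas[measurable]: "block_series \<mu> \<in> borel_measurable quadrant"
    unfolding block_series_def[abs_def] by measurable
  have "integrable quadrant (\<lambda>z. (block_series \<mu> z)\<^sup>2)"
  proof (rule integrable_monotone_convergence)
    show "integrable quadrant (\<lambda>z. (\<Sum>k<K. \<mu> k * block k z)\<^sup>2)" for K
      unfolding block_partial_square using bL by (intro Bochner_Integration.integrable_sum integrable_mult_right L2_funD)
    show "AE z in quadrant. mono (\<lambda>K. (\<Sum>k<K. \<mu> k * block k z)\<^sup>2)"
      unfolding block_partial_square by (intro AE_I2 incseq_SucI) simp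
    show "AE z in quadrant. (\<lambda>K. (\<Sum>k<K. \<mu> k * block k z)\<^sup>2) \<longlonglongrightarrow> (block_series \<mu> z)\<^sup>2"
      by (intro AE_I2 tendsto_power block_series_sums)
    have "(\<integral>z. (\<Sum>k<K. \<mu> k * block k z)\<^sup>2 \<partial>quadrant) = (\<Sum>k<K. (\<mu> k)\<^sup>2)" for K
      unfolding block_partial_square using bL by (subst Bochner_Integration.integral_sum) (auto simp: bsq L2_funD)
    then show "(\<lambda>K. \<integral>z. (\<Sum>k<K. \<mu> k * block k z)\<^sup>2 \<partial>quadrant) \<longlonglongrightarrow> (\<Sum>k. (\<mu> k)\<^sup>2)"
      using summable_LIMSEQ[OF \<mu>] by simp
  qed measurable
  then have gL: "block_series \<mu> \<in> L2_fun quadrant" by (simp add: L2_fun_def)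
  have "block k (x, y) = block k (y, x)" for k x y by (simp add: block_def tensor_def mult.commute)
  then have "block_series \<mu> (x, y) = block_series \<mu> (y, x)" for x y unfolding block_series_def by metis
  with gL show "block_series \<mu> \<in> L2_sym" by (simp add: L2_sym_def)
  show "(\<lambda>K. L2_sq quadrant (\<lambda>z. block_series \<mu> z - (\<Sum>k<K. \<mu> k * block k z))) \<longlonglongrightarrow> 0"
    by (rule L2_sq_dominated_convergence(2)[OF _ meas gL]) (auto intro!: AE_I2 block_partial_le block_series_sums)
qed

lemma lincomb_upt: "lincomb d (map (\<lambda>k. (\<mu> k, k)) [0..<K]) z = (\<Sum>k<K. \<mu> k * d k z)"
  by (simp add: lincomb_def interv_sum_list_conv_sum_set_nat atLeast0LessThan o_def)

section \<open>Laws of block series and of weak limits\<close>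

context brownian
begin

text \<open>Increments over unit intervals are independent with variance 1, so the factors are
  values of \<open>psi\<close> without further normalization.\<close>

lemma char_increment_squares:
  "char (distr M borel (\<lambda>\<omega>. \<Sum>k<K. \<mu> k * ((W (real (Suc k)) \<omega> - W (real k) \<omega>)\<^sup>2 - 1))) t = (\<Prod>k<K. psi (t * \<mu> k))"
proof -
  define D where "D k \<omega> = W (real (Suc k)) \<omega> - W (real k) \<omega>" for k \<omega>
  have [measurable]: "D k \<in> borel_measurable M" for k
    unfolding D_def by (intro borel_measurable_diff W_measurable) auto
  have "distr M borel (\<lambda>\<omega>. (W (real (Suc k)) \<omega> - W (real k) \<omega>) / sqrt (real (Suc k) - real k)) = std_normal_distribution" for k
    by (rule std_increment) auto
  then have law: "distr M borel (D k) = std_normal_distribution" for k by (simp add: D_def[abs_def])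
  have "indep_vars (\<lambda>_. borel) D {..<K}"
    using W_indep[of real K] by (simp add: D_def[abs_def] mono_onI)
  from indep_vars_compose2[OF this, of "\<lambda>k x. \<mu> k * (x\<^sup>2 - 1)" "\<lambda>_. borel"]
  have "indep_vars (\<lambda>_. borel) (\<lambda>k \<omega>. \<mu> k * ((D k \<omega>)\<^sup>2 - 1)) {..<K}" by simp
  then have "char (distr M borel (\<lambda>\<omega>. \<Sum>k<K. \<mu> k * ((D k \<omega>)\<^sup>2 - 1))) t = (\<Prod>k<K. char (distr M borel (\<lambda>\<omega>. \<mu> k * ((D k \<omega>)\<^sup>2 - 1))) t)"
    by (rule char_distr_sum)
  also have "\<dots> = (\<Prod>k<K. psi (t * \<mu> k))"
  proof (intro prod.cong refl)
    fix k
    have "char (distr M borel (\<lambda>\<omega>. \<mu> k * ((D k \<omega>)\<^sup>2 - 1))) t = (\<integral>\<omega>. iexp (t * (\<mu> k * ((D k \<omega>)\<^sup>2 - 1))) \<partial>M)"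
      by (rule char_distr) measurable
    also have "\<dots> = (\<integral>x. iexp (t * (\<mu> k * (x\<^sup>2 - 1))) \<partial>distr M borel (D k))"
      by (subst integral_distr) auto
    also have "\<dots> = psi (t * \<mu> k)" unfolding law psi_eq by (simp add: mult_ac)
    finally show "char (distr M borel (\<lambda>\<omega>. \<mu> k * ((D k \<omega>)\<^sup>2 - 1))) t = psi (t * \<mu> k)" .
  qed
  finally show ?thesis by (simp add: D_def)
qed

lemma I2_L2: "f \<in> L2_sym \<Longrightarrow> I2 f \<in> L2_fun M"
  by (rule continuous_linear_L2_fun[OF I2_cl])

text \<open>The partial sums of the kernel integrate to the finite sums of the preceding lemma;
  continuity of \<open>I2\<close> and the bound of characteristic functions by L2 distances pass to
  the limit.\<close>

lemma char_I2_block_series: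
  assumes \<mu>: "summable (\<lambda>k. (\<mu> k)\<^sup>2)"
  shows "(\<lambda>K. \<Prod>k<K. psi (t * \<mu> k)) \<longlonglongrightarrow> char (distr M borel (I2 (block_series \<mu>))) t"
proof -
  let ?g = "block_series \<mu>"
  define G where "G K = lincomb block (map (\<lambda>k. (\<mu> k, k)) [0..<K])" for K
  have G: "G K \<in> L2_sym" "AE \<omega> in M. I2 (G K) \<omega> = lincomb (\<lambda>k. I2 (block k)) (map (\<lambda>k. (\<mu> k, k)) [0..<K]) \<omega>" for K
    unfolding G_def using I2_lincomb[of UNIV block] block_sym by blast+
  note gL = block_series_L2(1)[OF \<mu>]
  have b: "AE \<omega> in M. I2 (block k) \<omega> = (W (real (Suc k)) \<omega> - W (real k) \<omega>)\<^sup>2 - 1" for k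
  proof -
    have "0 \<le> real k" "real k \<le> real (Suc k)" by auto
    from J_interval[OF this] I2_tensor[OF block_ind_L2[of k]] show ?thesis
      unfolding block_ind_sq block_def by eventually_elim simp
  qed
  have ch: "char (distr M borel (I2 (G K))) t = (\<Prod>k<K. psi (t * \<mu> k))" for K
  proof -
    have "AE \<omega> in M. lincomb (\<lambda>k. I2 (block k)) (map (\<lambda>k. (\<mu> k, k)) [0..<K]) \<omega>
      = lincomb (\<lambda>k \<omega>. (W (real (Suc k)) \<omega> - W (real k) \<omega>)\<^sup>2 - 1) (map (\<lambda>k. (\<mu> k, k)) [0..<K]) \<omega>"
      by (rule AE_lincomb_cong[of UNIV]) (use b in auto)
    with G(2)[of K] have "AE \<omega> in M. I2 (G K) \<omega> = (\<Sum>k<K. \<mu> k * ((W (real (Suc k)) \<omega> - W (real k) \<omega>)\<^sup>2 - 1))"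
      by eventually_elim (simp add: lincomb_upt del: of_nat_Suc)
    moreover have "(\<lambda>\<omega>. \<Sum>k<K. \<mu> k * ((W (real (Suc k)) \<omega> - W (real k) \<omega>)\<^sup>2 - 1)) \<in> borel_measurable M"
      by (intro borel_measurable_sum borel_measurable_times borel_measurable_diff borel_measurable_power borel_measurable_const W_measurable) auto
    ultimately have "distr M borel (I2 (G K)) = distr M borel (\<lambda>\<omega>. \<Sum>k<K. \<mu> k * ((W (real (Suc k)) \<omega> - W (real k) \<omega>)\<^sup>2 - 1))"
      using L2_funD(1)[OF I2_L2[OF G(1)]] by (intro distr_cong_AE) auto
    then show ?thesis by (simp add: char_increment_squares del: of_nat_Suc)
  qed
  have conv: "(\<lambda>K. L2_sq quadrant (\<lambda>z. ?g z - G K z)) \<longlonglongrightarrow> 0"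
    using block_series_L2(2)[OF \<mu>] by (simp add: G_def lincomb_upt)
  have lim: "(\<lambda>K. L2_sq M (\<lambda>\<omega>. I2 ?g \<omega> - I2 (G K) \<omega>)) \<longlonglongrightarrow> 0"
  proof (rule LIMSEQ_I)
    fix \<epsilon> :: real assume "\<epsilon> > 0"
    from continuous_linear_L2_cont[OF I2_cl gL this] obtain \<delta> where \<delta>: "\<delta> > 0"
      "\<And>g. g \<in> L2_sym \<Longrightarrow> L2_sq quadrant (\<lambda>x. ?g x - g x) < \<delta> \<Longrightarrow> L2_sq M (\<lambda>\<omega>. I2 ?g \<omega> - I2 g \<omega>) < \<epsilon>" by blast
    from order_tendstoD(2)[OF conv \<delta>(1)] obtain N where "\<And>K. K \<ge> N \<Longrightarrow> L2_sq quadrant (\<lambda>z. ?g z - G K z) < \<delta>"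
      by (auto simp: eventually_sequentially)
    then show "\<exists>N. \<forall>K\<ge>N. norm (L2_sq M (\<lambda>\<omega>. I2 ?g \<omega> - I2 (G K) \<omega>) - 0) < \<epsilon>"
      using \<delta>(2) G(1) by (intro exI[of _ N]) simp
  qed
  have "(\<lambda>K. char (distr M borel (I2 (G K))) t - char (distr M borel (I2 ?g)) t) \<longlonglongrightarrow> 0"
  proof (rule Lim_null_comparison)
    show "\<forall>\<^sub>F K in sequentially. norm (char (distr M borel (I2 (G K))) t - char (distr M borel (I2 ?g)) t)
      \<le> \<bar>t\<bar> * sqrt (L2_sq M (\<lambda>\<omega>. I2 ?g \<omega> - I2 (G K) \<omega>))"
    proof (rule always_eventually, rule allI)
      fix K
      show "norm (char (distr M borel (I2 (G K))) t - char (distr M borel (I2 ?g)) t) \<le> \<bar>t\<bar> * sqrt (L2_sq M (\<lambda>\<omega>. I2 ?g \<omega> - I2 (G K) \<omega>))"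
        unfolding L2_sq_commute[of M "I2 ?g"]
        by (intro char_distr_diff_le L2_funD(1) L2_fun_diff I2_L2 G gL)
    qed
    have "(\<lambda>K. \<bar>t\<bar> * sqrt (L2_sq M (\<lambda>\<omega>. I2 ?g \<omega> - I2 (G K) \<omega>))) \<longlonglongrightarrow> \<bar>t\<bar> * sqrt 0"
      by (intro tendsto_intros lim)
    then show "(\<lambda>K. \<bar>t\<bar> * sqrt (L2_sq M (\<lambda>\<omega>. I2 ?g \<omega> - I2 (G K) \<omega>))) \<longlonglongrightarrow> 0" by simp
  qed
  then show ?thesis unfolding ch by (rule LIM_zero_cancel)
qed

text \<open>Replacing each integral by a combination of rectangles at L2 distance below 2^(-n)
  changes its characteristic function by at most |t| 2^(-n). The limit theorem for products of
  \<open>psi\<close> then applies, and the coefficients it provides are realized by a block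
  series.\<close>

theorem I2_weak_limit_char:
  assumes f: "\<And>n. f n \<in> L2_sym" and F: "\<And>n. F n \<in> borel_measurable M"
    and eq: "\<And>n. AE \<omega> in M. F n \<omega> = I2 (f n) \<omega>"
    and L: "real_distribution L" and conv: "weak_conv_m (\<lambda>n. distr M borel (F n)) L"
  shows "\<exists>\<rho>\<ge>0. \<exists>g\<in>L2_sym. \<forall>t. char L t = char (distr M borel (I2 g)) t * complex_of_real (exp (- \<rho> * t\<^sup>2))"
proof -
  have "\<exists>xs. snd ` set xs \<subseteq> nonneg_pairs \<and> L2_sq M (\<lambda>\<omega>. I2 (f n) \<omega> - lincomb WW xs \<omega>) < (1/4)^n" for n
    using f by (intro I2_approx) auto
  then have "\<exists>X. \<forall>n. snd ` set (X n) \<subseteq> nonneg_pairs \<and> L2_sq M (\<lambda>\<omega>. I2 (f n) \<omega> - lincomb WW (X n) \<omega>) < (1/4)^n"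
    by (intro choice allI)
  then obtain X where X: "\<And>n. snd ` set (X n) \<subseteq> nonneg_pairs"
    and Xd: "\<And>n. L2_sq M (\<lambda>\<omega>. I2 (f n) \<omega> - lincomb WW (X n) \<omega>) < (1/4)^n" by blast
  have "\<exists>p. distr M borel (lincomb WW (X n)) = distr (std_gauss (fst p)) borel (\<lambda>x. \<Sum>i<fst p. snd p i * ((x i)\<^sup>2 - 1))" for n
    using double_integral_law[OF X[of n]] by auto
  then have "\<exists>p. \<forall>n. distr M borel (lincomb WW (X n)) = distr (std_gauss (fst (p n))) borel (\<lambda>x. \<Sum>i<fst (p n). snd (p n) i * ((x i)\<^sup>2 - 1))"
    by (intro choice allI)
  then obtain p where p: "\<And>n. distr M borel (lincomb WW (X n)) = distr (std_gauss (fst (p n))) borel (\<lambda>x. \<Sum>i<fst (p n). snd (p n) i * ((x i)\<^sup>2 - 1))"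
    by blast
  define m where "m n = fst (p n)" for n
  define d where "d n = snd (p n)" for n
  have chX: "char (distr M borel (lincomb WW (X n))) t = (\<Prod>i<m n. psi (t * d n i))" for n t
    unfolding p m_def d_def by (rule char_diag_law)
  have diff: "cmod (char (distr M borel (F n)) t - (\<Prod>i<m n. psi (t * d n i))) \<le> \<bar>t\<bar> * (1/2)^n" for n t
  proof -
    note Xl = double_integral_bound(1)[OF X[of n]]
    have "distr M borel (F n) = distr M borel (I2 (f n))"
      using eq[of n] F[of n] L2_funD(1)[OF I2_L2[OF f]] by (intro distr_cong_AE) auto
    then have "cmod (char (distr M borel (F n)) t - (\<Prod>i<m n. psi (t * d n i))) = cmod (char (distr M borel (I2 (f n))) t - char (distr M borel (lincomb WW (X n))) t)"
      by (simp add: chX)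
    also have "\<dots> \<le> \<bar>t\<bar> * sqrt (L2_sq M (\<lambda>\<omega>. I2 (f n) \<omega> - lincomb WW (X n) \<omega>))"
      by (intro char_distr_diff_le L2_funD(1) L2_fun_diff I2_L2 f Xl)
    also have "\<dots> \<le> \<bar>t\<bar> * sqrt ((1/4)^n)"
      using Xd[of n] by (intro mult_left_mono real_sqrt_le_mono) auto
    also have "sqrt ((1/4)^n) = (1/2)^n" by (simp add: real_sqrt_power real_sqrt_divide)
    finally show ?thesis .
  qed
  have rd: "real_distribution (distr M borel (F n))" for n using F by (rule real_distribution_distr)
  \<comment> \<open>Skorohod coupling turns weak convergence into pointwise convergence, after which
    characteristic functions converge even at moving frequencies.\<close>
  from Skorohod[OF rd L conv] obtain \<Omega> Ys Y where \<Omega>: "prob_space (\<Omega> :: real measure)"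
    and Ys: "\<And>n::nat. Ys n \<in> borel_measurable \<Omega>" "\<And>n. distr \<Omega> borel (Ys n) = distr M borel (F n)"
    and Y: "Y \<in> measurable \<Omega> lborel" "distr \<Omega> borel Y = L" and lim: "\<And>x. x \<in> space \<Omega> \<Longrightarrow> (\<lambda>n. Ys n x) \<longlonglongrightarrow> Y x" by blast
  interpret O: prob_space \<Omega> by fact
  \<comment> \<open>Serves twice: with the identity for \<open>r\<close> and constant
    \<open>t\<close> it gives the pointwise limit, and with \<open>s = 0\<close> the tightness
    hypothesis.\<close>
  have key: "(\<lambda>n. \<Prod>i<m (r n). psi (t n * d (r n) i)) \<longlonglongrightarrow> char L s"
    if r: "filterlim r at_top sequentially" and t: "t \<longlonglongrightarrow> s" for r :: "nat \<Rightarrow> nat" and t s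
  proof -
    have "(\<lambda>n. char (distr \<Omega> borel (Ys (r n))) (t n)) \<longlonglongrightarrow> char (distr \<Omega> borel Y) s"
    proof (rule O.char_distr_tendsto_AE[OF _ _ _ t])
      show "AE x in \<Omega>. (\<lambda>n. Ys (r n) x) \<longlonglongrightarrow> Y x"
        using lim by (intro AE_I2 filterlim_compose[OF _ r])
    qed (use Ys Y in auto)
    then have 1: "(\<lambda>n. char (distr M borel (F (r n))) (t n)) \<longlonglongrightarrow> char L s" unfolding Ys Y .
    have 2: "(\<lambda>n. char (distr M borel (F (r n))) (t n) - (\<Prod>i<m (r n). psi (t n * d (r n) i))) \<longlonglongrightarrow> 0"
    proof (rule Lim_null_comparison)
      show "\<forall>\<^sub>F n in sequentially. norm (char (distr M borel (F (r n))) (t n) - (\<Prod>i<m (r n). psi (t n * d (r n) i))) \<le> \<bar>t n\<bar> * (1/2)^(r n)"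
        using diff by simp
      have "(\<lambda>n. (1/2::real)^n) \<longlonglongrightarrow> 0" by (rule LIMSEQ_power_zero) simp
      from filterlim_compose[OF this r] have "(\<lambda>n. \<bar>t n\<bar> * (1/2)^(r n)) \<longlonglongrightarrow> \<bar>s\<bar> * 0"
        by (intro tendsto_intros t)
      then show "(\<lambda>n. \<bar>t n\<bar> * (1/2)^(r n)) \<longlonglongrightarrow> 0" by simp
    qed
    from tendsto_diff[OF 1 2] show ?thesis by simp
  qed
  interpret L: real_distribution L by (rule L)
  have L0: "char L 0 = 1" using L.prob_space by (simp add: char_def)
  have "\<exists>\<rho>\<ge>0. \<exists>\<mu>. summable (\<lambda>k. (\<mu> k)\<^sup>2) \<and>
    (\<forall>t. (\<lambda>K. (\<Prod>k<K. psi (t * \<mu> k)) * complex_of_real (exp (- \<rho> * t\<^sup>2))) \<longlonglongrightarrow> char L t)"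
  proof (rule quadratic_char_limit)
    show "(\<lambda>n. \<Prod>i<m n. psi (t * d n i)) \<longlonglongrightarrow> char L t" for t
      using key[OF filterlim_ident tendsto_const] .
    show "(\<lambda>n. \<Prod>i<m (r n). psi (t n * d (r n) i)) \<longlonglongrightarrow> 1" if "filterlim r at_top sequentially" "t \<longlonglongrightarrow> 0" for r t
      using key[OF that] L0 by simp
  qed
  then obtain \<rho> \<mu> where \<rho>: "\<rho> \<ge> 0" and \<mu>: "summable (\<lambda>k. (\<mu> k)\<^sup>2)"
    and ch: "\<And>t. (\<lambda>K. (\<Prod>k<K. psi (t * \<mu> k)) * complex_of_real (exp (- \<rho> * t\<^sup>2))) \<longlonglongrightarrow> char L t" by blast
  have "char L t = char (distr M borel (I2 (block_series \<mu>))) t * complex_of_real (exp (- \<rho> * t\<^sup>2))" for t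
    using ch tendsto_mult[OF char_I2_block_series[OF \<mu>] tendsto_const] by (rule LIMSEQ_unique)
  with \<rho> block_series_L2(1)[OF \<mu>] show ?thesis by blast
qed

end

section \<open>Realization of the limit law on a product space\<close>

theorem theorem3p1:
  fixes M :: "'w measure" and W :: "real \<Rightarrow> 'w \<Rightarrow> real"
    and f :: "nat \<Rightarrow> real \<times> real \<Rightarrow> real" and F :: "nat \<Rightarrow> 'w \<Rightarrow> real"
    and M_inf :: "'v measure" and F_inf :: "'v \<Rightarrow> real"
  assumes "standard_brownian_motion M W"
    and "\<And>n. n \<ge> 1 \<Longrightarrow> f n \<in> L2_sym"
    and "\<And>n. n \<ge> 1 \<Longrightarrow> F n \<in> borel_measurable M"
    and "\<And>n. n \<ge> 1 \<Longrightarrow> AE \<omega> in M. F n \<omega> = double_wiener_integral M W (f n) \<omega>"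
    and "prob_space M_inf" and "F_inf \<in> borel_measurable M_inf"
    and "weak_conv_m (\<lambda>n. distr M borel (F n)) (distr M_inf borel F_inf)"
  shows "\<exists>(l0::real). \<exists>g\<in>L2_sym.
    \<exists>(M' :: ('w \<times> real) measure) (\<pi> :: 'w \<times> real \<Rightarrow> 'w) (N :: 'w \<times> real \<Rightarrow> real).
      enlargement M M' \<pi> \<and>
      N \<in> borel_measurable M' \<and>
      distr M' borel N = normal_law 0 (l0\<^sup>2) \<and>
      independent_of_process M' N (\<lambda>t \<omega>. W t (\<pi> \<omega>)) \<and>
      distr M_inf borel F_inf =
        distr M' borel (\<lambda>\<omega>. N \<omega> + double_wiener_integral M W g (\<pi> \<omega>))"
proof -
  interpret brownian M W by unfold_locales (rule assms(1))
  define L where "L = distr M_inf borel F_inf"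
  have L: "real_distribution L"
    unfolding L_def using assms(5,6) by (rule prob_space.real_distribution_distr)
  \<comment> \<open>The hypotheses concern n \<ge> 1 only, so the sequence is shifted by
    one.\<close>
  have "weak_conv_m (\<lambda>n. distr M borel (F (Suc n))) L"
    using assms(7) unfolding weak_conv_m_def weak_conv_def L_def by (auto intro: LIMSEQ_Suc)
  from I2_weak_limit_char[of "\<lambda>n. f (Suc n)" "\<lambda>n. F (Suc n)", OF _ _ _ L this] assms(2-4)
  obtain \<rho> g where \<rho>: "\<rho> \<ge> 0" and g: "g \<in> L2_sym"
    and ch: "\<And>t. char L t = char (distr M borel (I2 g)) t * complex_of_real (exp (- \<rho> * t\<^sup>2))" by auto
  \<comment> \<open>A centred Gaussian variable of variance l0^2 has characteristic function
    exp(-l0^2 t^2 / 2), which has to equal exp(-\<rho> t^2).\<close>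
  define l0 where "l0 = sqrt (2 * \<rho>)"
  have l0: "l0\<^sup>2 = 2 * \<rho>" using \<rho> by (simp add: l0_def)
  define \<nu> where "\<nu> = normal_law 0 (l0\<^sup>2)"
  note nf = normal_law_facts[OF zero_le_power2[of l0], folded \<nu>_def]
  interpret N: prob_space \<nu> by (rule nf)
  interpret P: pair_prob_space M \<nu> ..
  \<comment> \<open>The Gaussian variable is adjoined as a second coordinate: \<open>fst\<close> is
    the projection of the enlargement and \<open>snd\<close> the variable N.\<close>
  define M' where "M' = M \<Otimes>\<^sub>M \<nu>"
  have spM': "space M' = space M \<times> UNIV" by (simp add: M'_def space_pair_measure nf)
  have M'p: "prob_space M'" unfolding M'_def by unfold_locales
  have [measurable]: "snd \<in> borel_measurable M'"
    unfolding M'_def measurable_cong_sets[OF refl nf(2), symmetric] by (rule measurable_snd)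
  have [measurable]: "fst \<in> measurable M' M" unfolding M'_def by (rule measurable_fst)
  have rect: "measure M' (A \<times> B) = prob A * measure \<nu> B" if "A \<in> sets M" "B \<in> sets \<nu>" for A B
    unfolding M'_def measure_def N.emeasure_pair_measure_Times[OF that] by (rule enn2real_mult)
  have [measurable]: "I2 g \<in> borel_measurable M" by (rule L2_funD(1)[OF I2_L2[OF g]])
  have en: "enlargement M M' fst"
    unfolding enlargement_def using M'p by (auto simp: M'_def N.distr_pair_fst)
  have lawN: "distr M' borel snd = \<nu>"
  proof (rule measure_eqI)
    fix A assume A: "A \<in> sets (distr M' borel (snd :: 'w \<times> real \<Rightarrow> real))"
    then have A': "A \<in> sets \<nu>" by (simp add: nf)
    have "emeasure (distr M' borel snd) A = emeasure M' (space M \<times> A)"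
      using A by (subst emeasure_distr) (auto simp: spM' intro!: arg_cong[where f="emeasure M'"])
    also have "\<dots> = emeasure \<nu> A"
      unfolding M'_def using A' by (subst N.emeasure_pair_measure_Times) (auto simp: emeasure_space_1)
    finally show "emeasure (distr M' borel snd) A = emeasure \<nu> A" .
  qed (simp add: nf)
  \<comment> \<open>Events of the Gaussian variable are cylinders over \<open>UNIV\<close> in the
    second factor, events of the process cylinders over the first. Their intersection is a
    rectangle, on which the product measure factors.\<close>
  have ind: "independent_of_process M' snd (\<lambda>t \<omega>. W t (fst \<omega>))"
    unfolding independent_of_process_def
  proof (rule prob_space.indep_setI[OF M'p])
    define V where "V \<omega> = (\<lambda>t\<in>{0..}. W t \<omega>)" for \<omega>
    have V[measurable]: "V \<in> measurable M (PiM {0..} (\<lambda>_. borel))"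
      unfolding V_def by (intro measurable_restrict W_measurable) simp
    have s1: "sets (vimage_algebra (space M') snd borel) = {snd -` A \<inter> space M' | A. A \<in> sets (borel :: real measure)}"
      by (rule sets_vimage_algebra2) simp
    have s2: "sets (vimage_algebra (space M') (\<lambda>\<omega>. \<lambda>t\<in>{0..}. W t (fst \<omega>)) (PiM {0..} (\<lambda>_. borel))) =
      {(\<lambda>\<omega>. V (fst \<omega>)) -` A \<inter> space M' | A. A \<in> sets (PiM {0..} (\<lambda>_. borel))}"
      unfolding V_def by (rule sets_vimage_algebra2) (auto simp: space_PiM)
    have e1: "\<exists>b\<in>sets borel. a = space M \<times> b" if "a \<in> sets (vimage_algebra (space M') snd borel)" for a
    proof -
      from that obtain A where A: "A \<in> sets borel" "a = snd -` A \<inter> space M'" unfolding s1 by blast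
      then have "a = space M \<times> A" by (auto simp: spM')
      with A(1) show ?thesis by blast
    qed
    have e2: "\<exists>b\<in>sets M. a = b \<times> UNIV" if "a \<in> sets (vimage_algebra (space M') (\<lambda>\<omega>. \<lambda>t\<in>{0..}. W t (fst \<omega>)) (PiM {0..} (\<lambda>_. borel)))" for a
    proof -
      from that obtain A where A: "A \<in> sets (PiM {0..} (\<lambda>_. borel))" "a = (\<lambda>\<omega>. V (fst \<omega>)) -` A \<inter> space M'"
        unfolding s2 by blast
      have "V -` A \<inter> space M \<in> sets M" using V A(1) by (rule measurable_sets)
      moreover have "a = (V -` A \<inter> space M) \<times> UNIV" unfolding A(2) spM' by auto
      ultimately show ?thesis by blast
    qed
    show "sets (vimage_algebra (space M') snd borel) \<subseteq> sets M'"
    proof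
      fix a assume "a \<in> sets (vimage_algebra (space M') snd borel)"
      then obtain b where "b \<in> sets borel" "a = space M \<times> b" using e1 by blast
      then show "a \<in> sets M'" unfolding M'_def by (auto intro!: pair_measureI simp: nf)
    qed
    show "sets (vimage_algebra (space M') (\<lambda>\<omega>. \<lambda>t\<in>{0..}. W t (fst \<omega>)) (PiM {0..} (\<lambda>_. borel))) \<subseteq> sets M'"
    proof
      fix a assume "a \<in> sets (vimage_algebra (space M') (\<lambda>\<omega>. \<lambda>t\<in>{0..}. W t (fst \<omega>)) (PiM {0..} (\<lambda>_. borel)))"
      then obtain b where "b \<in> sets M" "a = b \<times> UNIV" using e2 by blast
      then show "a \<in> sets M'" unfolding M'_def by (auto intro!: pair_measureI simp: nf)
    qed
    fix a b assume a: "a \<in> sets (vimage_algebra (space M') snd borel)"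
      and b: "b \<in> sets (vimage_algebra (space M') (\<lambda>\<omega>. \<lambda>t\<in>{0..}. W t (fst \<omega>)) (PiM {0..} (\<lambda>_. borel)))"
    from e1[OF a] obtain A where A: "A \<in> sets borel" "a = space M \<times> A" by blast
    from e2[OF b] obtain B where B: "B \<in> sets M" "b = B \<times> UNIV" by blast
    have "a \<inter> b = B \<times> A" using A B sets.sets_into_space[OF B(1)] by auto
    moreover have "measure \<nu> UNIV = 1" using N.prob_space nf(3) by simp
    ultimately show "measure M' (a \<inter> b) = measure M' a * measure M' b"
      using A B rect[of "space M" A] rect[of B UNIV] rect[of B A] by (simp add: nf prob_space)
  qed
  \<comment> \<open>By Fubini the characteristic function on the product is the product of those of
    the two summands; Levy uniqueness then identifies the laws.\<close>
  have law: "L = distr M' borel (\<lambda>\<omega>. snd \<omega> + I2 g (fst \<omega>))"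
  proof (rule Levy_uniqueness[OF L])
    interpret M': prob_space M' by (rule M'p)
    show "real_distribution (distr M' borel (\<lambda>\<omega>. snd \<omega> + I2 g (fst \<omega>)))"
      by (intro M'.real_distribution_distr) measurable
    show "char L = char (distr M' borel (\<lambda>\<omega>. snd \<omega> + I2 g (fst \<omega>)))"
    proof
      fix t
      have m: "(\<lambda>(\<omega>, x). iexp (t * (x + I2 g \<omega>))) \<in> borel_measurable (M \<Otimes>\<^sub>M \<nu>)"
      proof -
        have "(\<lambda>\<omega>. iexp (t * (snd \<omega> + I2 g (fst \<omega>)))) \<in> borel_measurable M'" by measurable
        then show ?thesis by (simp add: M'_def case_prod_beta')
      qed
      have i: "integrable (M \<Otimes>\<^sub>M \<nu>) (\<lambda>(\<omega>, x). iexp (t * (x + I2 g \<omega>)))"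
        using m by (intro P.integrable_const_bound[where B=1]) (auto simp: case_prod_beta')
      have "char (distr M' borel (\<lambda>\<omega>. snd \<omega> + I2 g (fst \<omega>))) t = (\<integral>\<omega>. iexp (t * (snd \<omega> + I2 g (fst \<omega>))) \<partial>M')"
        by (rule M'.char_distr) measurable
      also have "\<dots> = (\<integral>\<omega>. (\<integral>x. iexp (t * (x + I2 g \<omega>)) \<partial>\<nu>) \<partial>M)"
        using P.integral_fst[OF i] by (simp add: M'_def case_prod_beta')
      also have "\<dots> = (\<integral>\<omega>. iexp (t * I2 g \<omega>) * char \<nu> t \<partial>M)"
      proof (rule Bochner_Integration.integral_cong[OF refl])
        fix \<omega>
        have "(\<integral>x. iexp (t * (x + I2 g \<omega>)) \<partial>\<nu>) = (\<integral>x. iexp (t * I2 g \<omega>) * iexp (t * x) \<partial>\<nu>)"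
          by (simp add: exp_add[symmetric] algebra_simps)
        then show "(\<integral>x. iexp (t * (x + I2 g \<omega>)) \<partial>\<nu>) = iexp (t * I2 g \<omega>) * char \<nu> t"
          by (simp add: char_def)
      qed
      also have "\<dots> = char (distr M borel (I2 g)) t * char \<nu> t" by (simp add: char_distr)
      also have "char \<nu> t = complex_of_real (exp (- \<rho> * t\<^sup>2))" unfolding nf(4) l0 by simp
      finally show "char L t = char (distr M' borel (\<lambda>\<omega>. snd \<omega> + I2 g (fst \<omega>))) t" using ch by simp
    qed
  qed
  show ?thesis
    using g en lawN ind law unfolding L_def \<nu>_def
    by (intro exI[of _ l0] bexI[of _ g] exI[of _ M'] exI[of _ fst] exI[of _ snd] conjI) auto
qed

end
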